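(* Let $p>3$ be prime, $L=L_{2p^2}$ and $\Gamma=\Gamma_{2p^2}$. Let $E\subset L$ be a primitive totally isotropic sublattice of rank 2 of type $a$ (so $a\in\{1,2,p,2p\}$), and let $\mathcal{C}_E$ be the boundary curve of the Baily-Borel compactification $\mathcal{F}_L(\Gamma)^*$ corresponding to $E$. Then $$\mathcal{C}_E\cong\begin{cases}\mathbb{H}^+/\operatorname{PSL}(2,\mathbb{Z}) & \text{if } a=1,\\ \mathbb{H}^+/\Gamma_1(a) & \text{otherwise.}\end{cases}$$
   Context: A lattice is a free abelian group of finite rank with a non-degenerate even integral quadratic form $x^2=(x,x)$; $\langle m\rangle$ is the rank 1 lattice generated by an element of length $m$, and $U$ is the hyperbolic plane. $L_{2d}=2U\oplus\langle -2d\rangle\oplus\langle -6\rangle$ (signature $(2,4)$), with $\underline v$, $\underline w$ generators of the $\langle -2d\rangle$ and $\langle -6\rangle$ factors, and $\underline v^*=\underline v/2d\in L_{2d}^\vee$. The real spinor norm is normalised so that the reflection $\sigma_w$ in $w$ has spinor norm $-(w,w)/2\in\mathbb{R}^*/(\mathbb{R}^* )^2$; $\operatorname{O}^+(L\otimes\mathbb{R})$ is its kernel and $\operatorname{O}^+(L)=\operatorname{O}(L)\cap \operatorname{O}^+(L\otimes\mathbb{R})$. Put $\Gamma_{2d}=\{g\in \operatorname{O}^+(L_{2d})\mid g\underline v^*\equiv\underline v^*\bmod L_{2d}\}$. $\mathcal{D}_L$ is the component of $\{[x]\in\mathbb{P}(L\otimes\mathbb{C})\mid (x,x)=0,(x,\overline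 x)>0\}$ preserved by $\operatorname{O}^+(L\otimes\mathbb{R})$, and $\mathcal{F}_L(\Gamma)=\mathcal{D}_L/\Gamma$. Its Baily-Borel compactification $\mathcal{F}_L(\Gamma)^*$ decomposes as $\mathcal{F}_L(\Gamma)\sqcup\bigsqcup_E\mathcal{C}_E\sqcup\bigsqcup_l P_l$, where $E$ (resp. $l$) runs over representatives of $\Gamma$-orbits of primitive totally isotropic sublattices of rank 2 (resp. rank 1) of $L$, each $\mathcal{C}_E$ is a curve and each $P_l$ a point. Moreover $\mathcal{C}_E\cong\mathbb{H}^+/G(E)$ with $G(E)=\operatorname{Stab}_\Gamma(E)/\operatorname{Fix}_\Gamma(E)$, where the upper half plane $\mathbb{H}^+$ is identified with $\mathbb{P}(E\otimes\mathbb{C})\cap\overline{\mathcal{D}}_L$ ($\overline{\mathcal{D}}_L$ the topological closure of $\mathcal{D}_L$ in the compact dual). Type: for every $E$ there is a $\mathbb{Z}$-basis $\{v_1,\dots,v_6\}$ of $L$ with $\{v_1,v_2\}$ a basis of $E$, $\{v_1,\dots,v_4\}$ a basis of $E^\perp$, and $((v_i,v_j))_{i=1,2;\,j=5,6}=\begin{pmatrix}0&a\\1&0\end{pmatrix}$ with $a\in\{1,2,p,2p\}$; $E$ and $\mathcal{C}_E$ are then said to be of type $a$. $\Gamma_1(n)=\{Z\in\operatorname{SL}(2,\mathbb{Z})\mid Z\equiv\begin{pmatrix}1&0\\ *&1\end{pmatrix}\bmod n\}$. *)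

theory Defs
  imports "HOL-Analysis.Analysis" "HOL-Algebra.Coset" "HOL-Computational_Algebra.Primes"
    "HOL-Number_Theory.Cong"
begin

section \<open>The lattice \<open>L\<^sub>2\<^sub>d = 2U \<oplus> \<langle>-2d\<rangle> \<oplus> \<langle>-6\<rangle>\<close>\<close>

text \<open>
  Coordinates 1, 2 and 3, 4 belong to the two hyperbolic planes, coordinate 5 to
  \<open>\<langle>-2d\<rangle>\<close> and coordinate 6 to \<open>\<langle>-6\<rangle>\<close> (in the index type \<open>6\<close>, the numeral 6 is 0).
  The form is polymorphic, so that it serves both \<open>L \<otimes> \<real>\<close> and \<open>L \<otimes> \<complex>\<close>; over the
  complex numbers it is the bilinear (not the hermitian) extension.
\<close>

definition bil :: "nat \<Rightarrow> 'a::comm_ring_1 ^ 6 \<Rightarrow> 'a ^ 6 \<Rightarrow> 'a" where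
  "bil d x y = x $ 1 * y $ 2 + x $ 2 * y $ 1 + x $ 3 * y $ 4 + x $ 4 * y $ 3
     - 2 * of_nat d * x $ 5 * y $ 5 - 6 * x $ 6 * y $ 6"

text \<open>The lattice is realised as the set of integral vectors in \<open>L \<otimes> \<real>\<close>.\<close>

definition latt :: "(real ^ 6) set" where
  "latt = {x. \<forall>i. x $ i \<in> \<int>}"

definition vstar :: "nat \<Rightarrow> real ^ 6" where
  "vstar d = (1 / (2 * real d)) *\<^sub>R axis 5 1"

definition is_Z_basis :: "(nat \<Rightarrow> real ^ 6) \<Rightarrow> nat set \<Rightarrow> (real ^ 6) set \<Rightarrow> bool" where
  "is_Z_basis v I M \<longleftrightarrow>
     finite I \<and>
     M = {(\<Sum>i\<in>I. of_int (c i) *\<^sub>R v i) | c :: nat \<Rightarrow> int. True} \<and>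
     (\<forall>c :: nat \<Rightarrow> int. (\<Sum>i\<in>I. of_int (c i) *\<^sub>R v i) = 0 \<longrightarrow> (\<forall>i\<in>I. c i = 0))"

definition primitive_isotropic_rank2 :: "nat \<Rightarrow> (real ^ 6) set \<Rightarrow> bool" where
  "primitive_isotropic_rank2 d E \<longleftrightarrow>
     E \<subseteq> latt \<and>
     (\<exists>v. is_Z_basis v {1..2} E) \<and>
     (\<forall>x\<in>latt. \<forall>n::int. n \<noteq> 0 \<and> of_int n *\<^sub>R x \<in> E \<longrightarrow> x \<in> E) \<and>
     (\<forall>x\<in>E. \<forall>y\<in>E. bil d x y = 0)"

definition perp :: "nat \<Rightarrow> (real ^ 6) set \<Rightarrow> (real ^ 6) set" where
  "perp d E = {x \<in> latt. \<forall>e\<in>E. bil d x e = 0}"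

definition of_type :: "nat \<Rightarrow> nat \<Rightarrow> (real ^ 6) set \<Rightarrow> nat \<Rightarrow> bool" where
  "of_type d p E a \<longleftrightarrow>
     a \<in> {1, 2, p, 2 * p} \<and>
     (\<exists>v. is_Z_basis v {1..6} latt \<and> is_Z_basis v {1..2} E \<and> is_Z_basis v {1..4} (perp d E) \<and>
        bil d (v 1) (v 5) = 0 \<and> bil d (v 1) (v 6) = of_nat a \<and>
        bil d (v 2) (v 5) = 1 \<and> bil d (v 2) (v 6) = 0)"

section \<open>The groups\<close>

definition O_real :: "nat \<Rightarrow> (real ^ 6 ^ 6) set" where
  "O_real d = {g. \<forall>x y. bil d (g *v x) (g *v y) = bil d x y}"

definition O_latt :: "nat \<Rightarrow> (real ^ 6 ^ 6) set" where
  "O_latt d = {g \<in> O_real d. (\<lambda>x. g *v x) ` latt = latt}"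

definition reflect :: "nat \<Rightarrow> real ^ 6 \<Rightarrow> real ^ 6 \<Rightarrow> real ^ 6" where
  "reflect d w x = x - (2 * bil d x w / bil d w w) *\<^sub>R w"

text \<open>
  \<open>\<real>\<^sup>*/(\<real>\<^sup>*)\<^sup>2\<close> is identified with \<open>{1, -1}\<close> through the sign.  By Cartan--Dieudonne every
  isometry is a product of reflections, and the sign of the product below does not depend on the
  chosen decomposition, so this relation is the graph of the real spinor norm.
\<close>

definition has_spinor_norm :: "nat \<Rightarrow> real ^ 6 ^ 6 \<Rightarrow> real \<Rightarrow> bool" where
  "has_spinor_norm d g s \<longleftrightarrow>
     (\<exists>ws. (\<forall>w\<in>set ws. bil d w w \<noteq> 0) \<and>
           (\<forall>x. g *v x = foldr (reflect d) ws x) \<and>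
           s = sgn (\<Prod>w\<leftarrow>ws. - bil d w w / 2))"

definition O_plus_real :: "nat \<Rightarrow> (real ^ 6 ^ 6) set" where
  "O_plus_real d = {g \<in> O_real d. has_spinor_norm d g 1}"

definition O_plus_latt :: "nat \<Rightarrow> (real ^ 6 ^ 6) set" where
  "O_plus_latt d = O_latt d \<inter> O_plus_real d"

definition Gam :: "nat \<Rightarrow> (real ^ 6 ^ 6) set" where
  "Gam d = {g \<in> O_plus_latt d. g *v vstar d - vstar d \<in> latt}"

definition Stab :: "(real ^ 6 ^ 6) set \<Rightarrow> (real ^ 6) set \<Rightarrow> (real ^ 6 ^ 6) set" where
  "Stab G E = {g \<in> G. (\<lambda>x. g *v x) ` E = E}"

definition Fix :: "(real ^ 6 ^ 6) set \<Rightarrow> (real ^ 6) set \<Rightarrow> (real ^ 6 ^ 6) set" where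
  "Fix G E = {g \<in> G. \<forall>x\<in>E. g *v x = x}"

definition matrix_monoid :: "('a::comm_ring_1 ^ 'n ^ 'n) set \<Rightarrow> ('a ^ 'n ^ 'n) monoid" where
  "matrix_monoid G = \<lparr>carrier = G, mult = (**), one = mat 1\<rparr>"

definition G_E :: "(real ^ 6 ^ 6) set \<Rightarrow> (real ^ 6) set \<Rightarrow> (real ^ 6 ^ 6) set monoid" where
  "G_E G E = matrix_monoid (Stab G E) Mod Fix G E"

definition SL2Z :: "(int ^ 2 ^ 2) set" where
  "SL2Z = {Z. det Z = 1}"

definition PSL2Z :: "(int ^ 2 ^ 2) set monoid" where
  "PSL2Z = matrix_monoid SL2Z Mod {mat 1, - mat 1}"

definition Gamma1 :: "nat \<Rightarrow> (int ^ 2 ^ 2) set" where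
  "Gamma1 n = {Z \<in> SL2Z. [Z $ 1 $ 1 = 1] (mod int n) \<and> [Z $ 1 $ 2 = 0] (mod int n) \<and>
                        [Z $ 2 $ 2 = 1] (mod int n)}"

section \<open>Spaces with holomorphic functions and their quotients\<close>

text \<open>
  A complex-analytic curve is given by its topological space and its sheaf of holomorphic
  functions: \<open>hs_hol X U h\<close> says that \<open>h\<close> is holomorphic on the open set \<open>U\<close>, the values of \<open>h\<close>
  outside \<open>U\<close> being irrelevant.
\<close>

record 'a hspace =
  hs_top :: "'a topology"
  hs_hol :: "'a set \<Rightarrow> ('a \<Rightarrow> complex) \<Rightarrow> bool"

definition biholomorphic :: "'a hspace \<Rightarrow> 'b hspace \<Rightarrow> bool" (infix \<open>\<cong>\<^sub>h\<close> 50) where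
  "X \<cong>\<^sub>h Y \<longleftrightarrow>
     (\<exists>f. homeomorphic_map (hs_top X) (hs_top Y) f \<and>
        (\<forall>V h. openin (hs_top Y) V \<longrightarrow>
           (hs_hol Y V h \<longleftrightarrow> hs_hol X {x \<in> topspace (hs_top X). f x \<in> V} (h \<circ> f))))"

definition quot_topology :: "'a topology \<Rightarrow> ('a \<Rightarrow> 'b) \<Rightarrow> 'b topology" where
  "quot_topology X q = topology (\<lambda>U. U \<subseteq> q ` topspace X \<and> openin X {x \<in> topspace X. q x \<in> U})"

lemma openin_quot_topology:
  "openin (quot_topology X q) U \<longleftrightarrow> U \<subseteq> q ` topspace X \<and> openin X {x \<in> topspace X. q x \<in> U}"
proof -
  let ?P = "\<lambda>U. U \<subseteq> q ` topspace X \<and> openin X {x \<in> topspace X. q x \<in> U}"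
  have "istopology ?P"
    unfolding istopology_def
  proof (intro conjI allI impI)
    fix S T
    assume S: "?P S" and T: "?P T"
    have eq: "{x \<in> topspace X. q x \<in> S \<inter> T} =
          {x \<in> topspace X. q x \<in> S} \<inter> {x \<in> topspace X. q x \<in> T}" by blast
    show "openin X {x \<in> topspace X. q x \<in> S \<inter> T}"
      unfolding eq using S T by (intro openin_Int) blast+
    show "S \<inter> T \<subseteq> q ` topspace X" using S by blast
  next
    fix K
    assume K: "\<forall>S\<in>K. ?P S"
    show "\<Union>K \<subseteq> q ` topspace X" using K by blast
    have eq: "{x \<in> topspace X. q x \<in> \<Union>K} = \<Union>((\<lambda>S. {x \<in> topspace X. q x \<in> S}) ` K)"
      by blast
    show "openin X {x \<in> topspace X. q x \<in> \<Union>K}"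
      unfolding eq using K by (intro openin_Union) blast
  qed
  then have "openin (topology ?P) = ?P" by (rule topology_inverse')
  then show ?thesis unfolding quot_topology_def by (rule fun_cong)
qed

lemma quotient_map_quot_topology: "quotient_map X (quot_topology X q) q"
proof -
  have eq: "{x \<in> topspace X. q x \<in> q ` topspace X} = topspace X" by blast
  have "openin (quot_topology X q) (q ` topspace X)"
    unfolding openin_quot_topology eq by (intro conjI order_refl openin_topspace)
  then have 1: "q ` topspace X \<subseteq> topspace (quot_topology X q)" by (rule openin_subset)
  have "openin (quot_topology X q) (topspace (quot_topology X q))" by (rule openin_topspace)
  then have 2: "topspace (quot_topology X q) \<subseteq> q ` topspace X"
    unfolding openin_quot_topology by (rule conjunct1)
  from 1 2 have top: "q ` topspace X = topspace (quot_topology X q)" by (rule subset_antisym)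
  show ?thesis
    unfolding quotient_map_def openin_quot_topology top by blast
qed

definition orbit :: "('g \<Rightarrow> 'a \<Rightarrow> 'a) \<Rightarrow> 'g set \<Rightarrow> 'a \<Rightarrow> 'a set" where
  "orbit act G x = (\<lambda>g. act g x) ` G"

definition quot_space :: "'a hspace \<Rightarrow> ('g \<Rightarrow> 'a \<Rightarrow> 'a) \<Rightarrow> 'g set \<Rightarrow> 'a set hspace" where
  "quot_space X act G =
     \<lparr>hs_top = quot_topology (hs_top X) (orbit act G),
      hs_hol = (\<lambda>V h. hs_hol X {x \<in> topspace (hs_top X). orbit act G x \<in> V} (h \<circ> orbit act G))\<rparr>"

text \<open>
  Quotient by a group of cosets, such as \<open>S Mod N\<close> with \<open>N\<close> acting trivially: a coset acts
  through any of its representatives, so orbits are taken under all of these.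
\<close>

definition quot_space_cosets ::
    "'a hspace \<Rightarrow> ('g \<Rightarrow> 'a \<Rightarrow> 'a) \<Rightarrow> 'g set monoid \<Rightarrow> 'a set hspace" where
  "quot_space_cosets X act Q = quot_space X act (\<Union> (carrier Q))"

section \<open>The upper half plane\<close>

definition upper_half_plane :: "complex hspace" where
  "upper_half_plane = \<lparr>hs_top = top_of_set {z. 0 < Im z}, hs_hol = (\<lambda>U h. h holomorphic_on U)\<rparr>"

definition moebius_act :: "int ^ 2 ^ 2 \<Rightarrow> complex \<Rightarrow> complex" where
  "moebius_act Z = moebius (of_int (Z $ 1 $ 1)) (of_int (Z $ 1 $ 2))
                           (of_int (Z $ 2 $ 1)) (of_int (Z $ 2 $ 2))"

section \<open>The period domain and its boundary components\<close>

text \<open>Points of \<open>\<P>(L \<otimes> \<complex>)\<close> are the complex lines in \<open>L \<otimes> \<complex>\<close>.\<close>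

definition line :: "complex ^ 6 \<Rightarrow> (complex ^ 6) set" where
  "line x = vec.span {x}"

definition proj_top :: "(complex ^ 6) set topology" where
  "proj_top = quot_topology (top_of_set (- {0})) line"

definition cplx_vec :: "real ^ 6 \<Rightarrow> complex ^ 6" where
  "cplx_vec x = (\<chi> i. complex_of_real (x $ i))"

definition cnj_vec :: "complex ^ 6 \<Rightarrow> complex ^ 6" where
  "cnj_vec x = (\<chi> i. cnj (x $ i))"

definition proj_act :: "real ^ 6 ^ 6 \<Rightarrow> (complex ^ 6) set \<Rightarrow> (complex ^ 6) set" where
  "proj_act g l = (\<lambda>x. map_matrix complex_of_real g *v x) ` l"

definition compact_dual :: "nat \<Rightarrow> (complex ^ 6) set set" where
  "compact_dual d = {line x | x. x \<noteq> 0 \<and> bil d x x = 0}"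

text \<open>Note that \<open>(x, cnj x)\<close> is always a real number.\<close>

definition Omega :: "nat \<Rightarrow> (complex ^ 6) set set" where
  "Omega d = {line x | x. x \<noteq> 0 \<and> bil d x x = 0 \<and> 0 < Re (bil d x (cnj_vec x))}"

text \<open>
  There are two such components, interchanged by complex conjugation and both preserved by
  \<open>O\<^sup>+(L \<otimes> \<real>)\<close>; the predicate holds for either choice.
\<close>

definition is_period_domain :: "nat \<Rightarrow> (complex ^ 6) set set \<Rightarrow> bool" where
  "is_period_domain d D \<longleftrightarrow>
     D \<in> connected_components_of (subtopology proj_top (Omega d)) \<and>
     (\<forall>g\<in>O_plus_real d. proj_act g ` D = D)"

definition tensor_C :: "(real ^ 6) set \<Rightarrow> (complex ^ 6) set" where
  "tensor_C E = vec.span (cplx_vec ` E)"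

text \<open>
  The copy of the upper half plane in \<open>\<P>(E \<otimes> \<complex>)\<close>.  The intersection of \<open>\<P>(E \<otimes> \<complex>)\<close> with the
  closure of \<open>D\<close> is a closed half plane, whose boundary circle consists of the real points
  \<open>\<P>(E \<otimes> \<real>)\<close>; these do not belong to the boundary component of \<open>E\<close> and are removed.
\<close>

definition bdry_points ::
    "nat \<Rightarrow> (complex ^ 6) set set \<Rightarrow> (real ^ 6) set \<Rightarrow> (complex ^ 6) set set" where
  "bdry_points d D E =
     ({line x | x. x \<in> tensor_C E \<and> x \<noteq> 0}
        \<inter> Abstract_Topology.closure_of (subtopology proj_top (compact_dual d)) D)
     - {line (cplx_vec x) | x. x \<noteq> 0}"

text \<open>
  A function on an open subset of the projective line \<open>\<P>(E \<otimes> \<complex>)\<close> is holomorphic iff it is so in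
  every affine coordinate \<open>t \<mapsto> [x + t y]\<close> (trivially so if \<open>x\<close> and \<open>y\<close> are dependent).
\<close>

definition bdry_component ::
    "nat \<Rightarrow> (complex ^ 6) set set \<Rightarrow> (real ^ 6) set \<Rightarrow> (complex ^ 6) set hspace" where
  "bdry_component d D E =
     \<lparr>hs_top = subtopology proj_top (bdry_points d D E),
      hs_hol = (\<lambda>U h. \<forall>x\<in>tensor_C E. \<forall>y\<in>tensor_C E.
               (\<lambda>t. h (line (x + t *s y))) holomorphic_on
                 {t. x + t *s y \<noteq> 0 \<and> line (x + t *s y) \<in> U})\<rparr>"

text \<open>
  The boundary curve \<open>C\<^sub>E\<close> of the Baily--Borel compactification of \<open>D / G\<close>: the quotient of the
  boundary component of \<open>E\<close> by \<open>G(E) = Stab(E) / Fix(E)\<close>.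
\<close>

definition boundary_curve ::
    "nat \<Rightarrow> (complex ^ 6) set set \<Rightarrow> (real ^ 6 ^ 6) set \<Rightarrow> (real ^ 6) set
      \<Rightarrow> (complex ^ 6) set set hspace" where
  "boundary_curve d D G E = quot_space_cosets (bdry_component d D E) proj_act (G_E G E)"

end

theory Submission
  imports Defs
begin

text \<open>
  The basis defining the type of \<open>E\<close> can be normalised so that \<open>\<langle>v\<^sub>1, v\<^sub>2, v\<^sub>5, v\<^sub>6\<rangle>\<close> splits off
  orthogonally, because the discriminant of \<open>\<langle>v\<^sub>3, v\<^sub>4\<rangle>\<close> is prime to \<open>a\<close>.  Write \<open>g\<close> in the stabiliser of \<open>E\<close> as
  \<open>v\<^sub>1 \<mapsto> \<alpha> v\<^sub>1 + \<gamma> v\<^sub>2\<close>, \<open>v\<^sub>2 \<mapsto> \<beta> v\<^sub>1 + \<delta> v\<^sub>2\<close>.  The determinant is \<open>1\<close> because \<open>g\<close> preserves the period domain and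
  hence the side of the real locus on which its closure meets \<open>P(E \<otimes> \<complex>)\<close>; pairing \<open>g v\<^sub>1\<close> with \<open>v\<^sub>5\<close>
  gives \<open>a | \<gamma>\<close>; and if \<open>p\<close> divides \<open>a\<close> then \<open>v\<^sub>1/p\<close> is congruent to a multiple of \<open>v\<^sup>*\<close> modulo \<open>L\<close>, so that
  \<open>\<alpha> \<equiv> 1\<close> modulo \<open>p\<close>.  Conversely every such matrix extends to \<open>L\<close>, acting trivially on \<open>\<langle>v\<^sub>3, v\<^sub>4\<rangle>\<close> and on the
  discriminant group; over the reals the extension is a product of Eichler transvections, each of which is
  a product of reflections of total spinor norm \<open>1\<close>.  In the coordinate \<open>c\<^sub>2/c\<^sub>1\<close> of the point
  \<open>[c\<^sub>1 v\<^sub>1 + c\<^sub>2 v\<^sub>2]\<close> the stabiliser thus acts through \<open>\<Gamma>\<^sub>1(a)\<close>.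
\<close>

text \<open>For \<open>d = p^2\<close> with \<open>p > 3\<close> the \<open>p\<close>-part of the
  discriminant group is cyclic of order \<open>p^2\<close>, since 6 is a unit modulo
  \<open>p\<close>, and the 2-part is \<open>(Z/2)^2\<close>, coming from coordinates 5 and 6. A
  prime dividing both \<open>a\<close> and the discriminant of \<open><v3, v4>\<close> would make
  that plane degenerate modulo the prime and supply, next to \<open>v1\<close>, further classes. The
  2-part has no room for them; for \<open>p\<close> the norm form is used as well. Modulo 2 the
  congruence on \<open>\<alpha>\<close> comes from the determinant: \<open>\<gamma>\<close> is even,
  so \<open>\<alpha> \<delta>\<close> is odd. The delicate point of the converse is integrality, as
  the vector dual to \<open>v1\<close> has denominators dividing powers of \<open>a\<close>. Spinor
  norm 1 is certified by an explicit word in reflections, while invariance of the period domain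
  comes from \<open>is_period_domain\<close>. Quotients see only the union of the cosets, so
  \<open>PSL2Z\<close> acts like \<open>SL2Z = Gamma1 1\<close> and all types can be treated
  uniformly.\<close>

lemma exhaust_6:
  fixes x :: 6
  shows "x = 1 \<or> x = 2 \<or> x = 3 \<or> x = 4 \<or> x = 5 \<or> x = 6"
proof (induct x)
  case (of_int z)
  then have "z = 0 \<or> z = 1 \<or> z = 2 \<or> z = 3 \<or> z = 4 \<or> z = 5" by fastforce
  then show ?case by auto
qed

lemma forall_6: "(\<forall>i::6. P i) \<longleftrightarrow> P 1 \<and> P 2 \<and> P 3 \<and> P 4 \<and> P 5 \<and> P 6"
  by (metis exhaust_6)

lemma vec6_eq_iff:
  fixes x y :: "'a ^ 6"
  shows "x = y \<longleftrightarrow> x $ 1 = y $ 1 \<and> x $ 2 = y $ 2 \<and> x $ 3 = y $ 3 \<and> x $ 4 = y $ 4 \<and> x $ 5 = y $ 5 \<and> x $ 6 = y $ 6"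
  unfolding vec_eq_iff forall_6 by (rule refl)

section \<open>The bilinear form\<close>

lemma bil_commute: "bil d x y = bil d y x"
  by (simp add: bil_def algebra_simps)

lemma bil_linear [simp]:
  "bil d (x + y) z = bil d x z + bil d y z" "bil d z (x + y) = bil d z x + bil d z y"
  "bil d (x - y) z = bil d x z - bil d y z" "bil d z (x - y) = bil d z x - bil d z y"
  "bil d (- x) z = - bil d x z" "bil d z (- x) = - bil d z x"
  "bil d (c *s x) z = c * bil d x z" "bil d z (c *s x) = c * bil d z x"
  "bil d 0 z = 0" "bil d z 0 = 0"
  by (simp_all add: bil_def algebra_simps)

lemma bil_scaleR [simp]:
  fixes x y :: "real ^ 6"
  shows "bil d (c *\<^sub>R x) y = c * bil d x y" "bil d x (c *\<^sub>R y) = c * bil d x y"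
  by (simp_all add: bil_def algebra_simps)

lemma cplx_vec_simps [simp]:
  "cplx_vec (x + y) = cplx_vec x + cplx_vec y" "cplx_vec (x - y) = cplx_vec x - cplx_vec y"
  "cplx_vec (- x) = - cplx_vec x" "cplx_vec (c *\<^sub>R x) = complex_of_real c *s cplx_vec x"
  "cplx_vec 0 = 0" "cplx_vec x $ i = complex_of_real (x $ i)"
  by (simp_all add: cplx_vec_def vec_eq_iff)

lemma cplx_vec_eq_0_iff [simp]: "cplx_vec x = 0 \<longleftrightarrow> x = 0"
  by (simp add: vec_eq_iff)

lemma bil_cplx_vec [simp]: "bil d (cplx_vec x) (cplx_vec y) = complex_of_real (bil d x y)"
  by (simp add: bil_def)

lemma cnj_vec_simps [simp]:
  "cnj_vec (x + y) = cnj_vec x + cnj_vec y" "cnj_vec (c *s x) = cnj c *s cnj_vec x"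
  "cnj_vec (x - y) = cnj_vec x - cnj_vec y" "cnj_vec (- x) = - cnj_vec x"
  "cnj_vec (cplx_vec r) = cplx_vec r" "cnj_vec x $ i = cnj (x $ i)"
  by (simp_all add: cnj_vec_def vec_eq_iff)

lemma latt_simps [intro, simp]:
  "0 \<in> latt"
  "x \<in> latt \<Longrightarrow> y \<in> latt \<Longrightarrow> x + y \<in> latt" "x \<in> latt \<Longrightarrow> y \<in> latt \<Longrightarrow> x - y \<in> latt"
  "x \<in> latt \<Longrightarrow> - x \<in> latt" "c \<in> \<int> \<Longrightarrow> x \<in> latt \<Longrightarrow> c *\<^sub>R x \<in> latt"
  by (auto simp: latt_def)

section \<open>Eichler transvections and the spinor norm\<close>

lemma reflect_linear: "linear (reflect d w)"
  by (rule linearI) (simp_all add: reflect_def vec6_eq_iff add_divide_distrib algebra_simps)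

lemma reflect_isometry:
  assumes "bil d w w \<noteq> 0"
  shows "bil d (reflect d w x) (reflect d w y) = bil d x y"
  using assms by (simp add: reflect_def bil_commute[of d w y] field_simps)

text \<open>Spinor norm 1, certified by an explicit word in reflections. With maps instead of
  matrices, products become concatenations of words.\<close>

definition refl_prod_pos :: "nat \<Rightarrow> (real ^ 6 \<Rightarrow> real ^ 6) \<Rightarrow> bool" where
  "refl_prod_pos d F \<longleftrightarrow>
     (\<exists>ws. (\<forall>w\<in>set ws. bil d w w \<noteq> 0) \<and> F = foldr (reflect d) ws \<and> (\<Prod>w\<leftarrow>ws. - bil d w w / 2) > 0)"

lemma refl_prod_pos_id: "refl_prod_pos d id"
  unfolding refl_prod_pos_def by (intro exI[of _ "[]"]) simp

lemma refl_prod_pos_comp: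
  assumes "refl_prod_pos d F" "refl_prod_pos d G"
  shows "refl_prod_pos d (F \<circ> G)"
proof -
  from assms obtain us ws where
    "\<forall>w\<in>set us. bil d w w \<noteq> 0" "F = foldr (reflect d) us" "(\<Prod>w\<leftarrow>us. - bil d w w / 2) > 0"
    "\<forall>w\<in>set ws. bil d w w \<noteq> 0" "G = foldr (reflect d) ws" "(\<Prod>w\<leftarrow>ws. - bil d w w / 2) > 0"
    unfolding refl_prod_pos_def by blast
  then show ?thesis
    unfolding refl_prod_pos_def by (intro exI[of _ "us @ ws"]) auto
qed

lemma foldr_reflect_linear: "linear (foldr (reflect d) ws)"
proof (induction ws)
  case Nil
  then show ?case by (simp only: foldr_Nil linear_id)
next
  case (Cons w ws)
  then show ?case unfolding foldr_Cons by (intro linear_compose reflect_linear)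
qed

lemma refl_prod_pos_linear: "refl_prod_pos d F \<Longrightarrow> linear F"
  unfolding refl_prod_pos_def using foldr_reflect_linear by blast

lemma refl_prod_pos_isometry:
  assumes "refl_prod_pos d F"
  shows "bil d (F x) (F y) = bil d x y"
proof -
  have "\<forall>w\<in>set ws. bil d w w \<noteq> 0 \<Longrightarrow> bil d (foldr (reflect d) ws x) (foldr (reflect d) ws y) = bil d x y"
    for ws by (induction ws) (auto simp: reflect_isometry)
  then show ?thesis using assms unfolding refl_prod_pos_def by blast
qed

lemma refl_prod_pos_matrix:
  assumes "refl_prod_pos d F"
  shows "matrix F \<in> O_plus_real d"
proof -
  have app: "matrix F *v x = F x" for x
    using refl_prod_pos_linear[OF assms] by (simp add: matrix_works)
  from assms obtain ws where "\<forall>w\<in>set ws. bil d w w \<noteq> 0" "F = foldr (reflect d) ws"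
    "(\<Prod>w\<leftarrow>ws. - bil d w w / 2) > 0"
    unfolding refl_prod_pos_def by blast
  then have "has_spinor_norm d (matrix F) 1"
    unfolding has_spinor_norm_def app by (intro exI[of _ ws] conjI) (auto simp del: bil_linear)
  then show ?thesis
    unfolding O_plus_real_def O_real_def by (simp add: app refl_prod_pos_isometry[OF assms])
qed

text \<open>The Eichler transvection. For isotropic \<open>e\<close> orthogonal to \<open>a\<close>
  it is a unipotent isometry that fixes \<open>e\<close> and sends \<open>x\<close> orthogonal to
  \<open>e\<close> to \<open>x - (x, a) e\<close>.\<close>

definition eichler :: "nat \<Rightarrow> real ^ 6 \<Rightarrow> real ^ 6 \<Rightarrow> real ^ 6 \<Rightarrow> real ^ 6" where
  "eichler d e a x = x + bil d x e *\<^sub>R a - bil d x a *\<^sub>R e - (bil d a a / 2 * bil d x e) *\<^sub>R e"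

text \<open>The vector \<open>a - ((a, a)/2) e\<close> has the same norm as \<open>a\<close>, so the
  two spinor norms multiply to a square.\<close>

lemma eichler_eq_reflect:
  assumes "bil d e e = 0" "bil d e a = 0" "bil d a a \<noteq> 0"
  shows "eichler d e a = reflect d (a - (bil d a a / 2) *\<^sub>R e) \<circ> reflect d a"
proof
  fix x
  define n where "n = bil d a a"
  define b where "b = a - (n / 2) *\<^sub>R e"
  \<comment> \<open>The first reflection removes \<open>k a\<close>, the second returns
    \<open>k + (x, e)\<close> times \<open>b\<close>; together they leave
    \<open>(x, e) a\<close>.\<close>
  define k where "k = 2 * bil d x a / n"
  have n: "n \<noteq> 0" using assms by (simp add: n_def)
  have kn: "(k + bil d x e) * (n / 2) = bil d x a + n / 2 * bil d x e"
    using n by (simp add: k_def distrib_right)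
  have bb: "bil d b b = n"
    using assms by (simp add: b_def n_def bil_commute[of d a e])
  have "bil d (reflect d a x) b = bil d x b - k * bil d a b"
    by (simp add: reflect_def k_def n_def)
  also have "bil d a b = n"
    using assms by (simp add: b_def n_def bil_commute[of d a e])
  also have "bil d x b - k * n = - ((k + bil d x e) * (n / 2))"
    unfolding kn using n by (simp add: b_def k_def)
  finally have q: "2 * bil d (reflect d a x) b / bil d b b = - (k + bil d x e)"
    using n by (simp add: bb)
  have "(reflect d b \<circ> reflect d a) x = reflect d a x + (k + bil d x e) *\<^sub>R b"
    unfolding comp_def reflect_def[of d b] q by (simp only: scaleR_minus_left diff_minus_eq_add)
  also have "\<dots> = x - k *\<^sub>R a + (k + bil d x e) *\<^sub>R b"
    by (simp add: reflect_def k_def n_def)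
  also have "(k + bil d x e) *\<^sub>R b = (k + bil d x e) *\<^sub>R a - (bil d x a + n / 2 * bil d x e) *\<^sub>R e"
    unfolding kn[symmetric] b_def by (simp add: scaleR_diff_right)
  finally show "eichler d e a x = (reflect d (a - (bil d a a / 2) *\<^sub>R e) \<circ> reflect d a) x"
    by (simp add: eichler_def b_def n_def scaleR_left_distrib)
qed

lemma eichler_refl_prod_pos:
  assumes "bil d e e = 0" "bil d e a = 0" "bil d a a \<noteq> 0"
  shows "refl_prod_pos d (eichler d e a)"
proof -
  have b: "bil d (a - (bil d a a / 2) *\<^sub>R e) (a - (bil d a a / 2) *\<^sub>R e) = bil d a a"
    using assms by (simp add: bil_commute[of d a e])
  show ?thesis
    unfolding refl_prod_pos_def eichler_eq_reflect[OF assms]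
    using assms(3) by (intro exI[of _ "[a - (bil d a a / 2) *\<^sub>R e, a]"])
      (simp add: b zero_less_mult_iff del: bil_linear bil_scaleR, linarith?)
qed

text \<open>The cross term \<open>(a, b)\<close> in the norm of \<open>a + b\<close> is produced by
  the composition, when \<open>a\<close> is paired with the term \<open>(x, e) b\<close>.\<close>

lemma eichler_add:
  assumes "bil d e e = 0" "bil d e a = 0" "bil d e b = 0"
  shows "eichler d e (a + b) = eichler d e a \<circ> eichler d e b"
proof
  fix x
  show "eichler d e (a + b) x = (eichler d e a \<circ> eichler d e b) x"
    using assms by (simp add: eichler_def bil_commute[of d b a] bil_commute[of d b e] bil_commute[of d a e]
        vec6_eq_iff) (simp add: field_simps)
qed

text \<open>An isotropic \<open>a\<close> is the sum of the anisotropic vectors \<open>a/2 + b\<close> and \<open>a/2 - b\<close>.\<close>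

lemma eichler_isotropic_refl_prod_pos:
  assumes "bil d e e = 0" "bil d e a = 0" "bil d a a = 0"
    and "bil d e b = 0" "bil d b b = 0" "bil d a b \<noteq> 0"
  shows "refl_prod_pos d (eichler d e a)"
proof -
  let ?a = "(1/2) *\<^sub>R a + b" and ?b = "(1/2) *\<^sub>R a - b"
  have "refl_prod_pos d (eichler d e ?a \<circ> eichler d e ?b)"
    using assms by (intro refl_prod_pos_comp eichler_refl_prod_pos) (auto simp: bil_commute[of d b a])
  also have "eichler d e ?a \<circ> eichler d e ?b = eichler d e (?a + ?b)"
    using assms by (intro eichler_add[symmetric]) auto
  also have "?a + ?b = a" by (simp add: vec6_eq_iff)
  finally show ?thesis .
qed

section \<open>The period domain\<close>

lemma line_def': "line x = range (\<lambda>c. c *s x)"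
  unfolding line_def by (rule vec.span_singleton)

lemma line_smult:
  assumes "c \<noteq> 0"
  shows "line (c *s x) = line x"
proof -
  have "\<exists>k'. k *s x = k' *s (c *s x)" for k
    using assms by (intro exI[of _ "k / c"]) simp
  moreover have "\<exists>k'. k *s (c *s x) = k' *s x" for k
    by (intro exI[of _ "k * c"]) simp
  ultimately show ?thesis
    unfolding line_def' image_def by (intro Collect_cong) (metis UNIV_I)
qed

lemma line_eqD:
  assumes "line x = line y" "x \<noteq> 0"
  obtains c where "c \<noteq> 0" "x = c *s y"
proof -
  have "x \<in> line x" unfolding line_def' by (intro range_eqI[of _ _ 1]) simp
  then have "x \<in> line y" by (simp only: assms)
  then obtain c where "x = c *s y" unfolding line_def' by blast
  moreover from this assms have "c \<noteq> 0" by auto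
  ultimately show ?thesis using that by blast
qed

lemma topspace_proj_top: "topspace proj_top = line ` (- {0})"
  using quotient_imp_surjective_map[OF quotient_map_quot_topology[of "top_of_set (- {0})" line]]
  by (simp add: proj_top_def)

text \<open>Cones are the preimages of sets of lines; on them openness and membership can be tested
  on vectors.\<close>

definition cone :: "(complex ^ 6) set \<Rightarrow> bool" where
  "cone W \<longleftrightarrow> 0 \<notin> W \<and> (\<forall>x\<in>W. \<forall>c. c \<noteq> 0 \<longrightarrow> c *s x \<in> W)"

lemma line_in_cone_iff:
  assumes "cone W" "x \<noteq> 0"
  shows "line x \<in> line ` W \<longleftrightarrow> x \<in> W"
proof
  assume "line x \<in> line ` W"
  then obtain y where y: "y \<in> W" "line x = line y" by blast
  with line_eqD[OF y(2) assms(2)] assms(1) show "x \<in> W" unfolding cone_def by metis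
qed auto

lemma openin_proj_top_cone:
  assumes "cone W" "open W"
  shows "openin proj_top (line ` W)"
proof -
  have "{x \<in> - {0}. line x \<in> line ` W} = W"
    using line_in_cone_iff[OF assms(1)] assms(1) unfolding cone_def by auto
  moreover have "W \<subseteq> - {0}" using assms(1) unfolding cone_def by auto
  ultimately show ?thesis
    unfolding proj_top_def openin_quot_topology using assms(2)
    by (auto intro!: open_subset)
qed

lemma continuous_map_line:
  assumes "continuous_on S f" "\<And>x. x \<in> S \<Longrightarrow> f x \<noteq> 0"
  shows "continuous_map (top_of_set S) proj_top (\<lambda>x. line (f x))"
proof -
  have "continuous_map (top_of_set S) (top_of_set (- {0})) f"
    using assms by (auto simp: continuous_map_in_subtopology)
  moreover have "continuous_map (top_of_set (- {0})) proj_top line"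
    unfolding proj_top_def by (intro quotient_imp_continuous_map quotient_map_quot_topology)
  ultimately have "continuous_map (top_of_set S) proj_top (line \<circ> f)"
    by (rule continuous_map_compose)
  then show ?thesis by (simp add: comp_def)
qed

section \<open>The two components of the set of positive isotropic lines\<close>

definition period_vec :: "nat \<Rightarrow> complex ^ 6 \<Rightarrow> bool" where
  "period_vec d x \<longleftrightarrow> x \<noteq> 0 \<and> bil d x x = 0 \<and> 0 < Re (bil d x (cnj_vec x))"

text \<open>
  The orientation that \<open>x\<close> induces on the positive definite plane spanned by \<open>e\<^sub>1 + e\<^sub>2\<close> and
  \<open>e\<^sub>3 + e\<^sub>4\<close>; its sign separates the two components of the period domain.
\<close>

definition orient :: "complex ^ 6 \<Rightarrow> real" where
  "orient x = Im ((x $ 3 + x $ 4) * cnj (x $ 1 + x $ 2))"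

text \<open>Each hyperbolic plane is diagonalised by
  \<open>2 x y = ((x + y)^2 - (x - y)^2)/2\<close>; \<open>pos_part\<close> and
  \<open>neg_part\<close> are the definite parts of \<open>2 (x, cnj x)\<close>.\<close>

definition pos_part :: "complex ^ 6 \<Rightarrow> real" where
  "pos_part x = (cmod (x $ 1 + x $ 2))\<^sup>2 + (cmod (x $ 3 + x $ 4))\<^sup>2"

definition neg_part :: "nat \<Rightarrow> complex ^ 6 \<Rightarrow> real" where
  "neg_part d x = (cmod (x $ 1 - x $ 2))\<^sup>2 + (cmod (x $ 3 - x $ 4))\<^sup>2 +
     4 * real d * (cmod (x $ 5))\<^sup>2 + 12 * (cmod (x $ 6))\<^sup>2"

lemma orient_smult: "orient (c *s x) = (cmod c)\<^sup>2 * orient x"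
proof -
  have "(c *s x) $ 3 + (c *s x) $ 4 = c * (x $ 3 + x $ 4)" "(c *s x) $ 1 + (c *s x) $ 2 = c * (x $ 1 + x $ 2)"
    by (simp_all add: algebra_simps)
  then have "((c *s x) $ 3 + (c *s x) $ 4) * cnj ((c *s x) $ 1 + (c *s x) $ 2) =
      (c * cnj c) * ((x $ 3 + x $ 4) * cnj (x $ 1 + x $ 2))"
    by (simp only: complex_cnj_mult ac_simps)
  also have "c * cnj c = complex_of_real ((cmod c)\<^sup>2)"
    by (rule complex_norm_square[symmetric])
  finally show ?thesis by (simp add: orient_def del: of_real_power)
qed

lemma Re_bil_cnj: "2 * Re (bil d x (cnj_vec x)) = pos_part x - neg_part d x"
  by (simp add: bil_def pos_part_def neg_part_def cmod_power2) (simp add: algebra_simps power2_eq_square)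

lemma two_bil_self:
  fixes x :: "complex ^ 6"
  shows "2 * bil d x x = (x $ 1 + x $ 2)\<^sup>2 + (x $ 3 + x $ 4)\<^sup>2 -
    ((x $ 1 - x $ 2)\<^sup>2 + (x $ 3 - x $ 4)\<^sup>2 + 4 * of_nat d * (x $ 5)\<^sup>2 + 12 * (x $ 6)\<^sup>2)"
  by (simp add: bil_def algebra_simps power2_eq_square)

text \<open>\<open>p^2 + q^2 = (p + i q)(p - i q)\<close>, and the factors have squared moduli
  \<open>|p|^2 + |q|^2\<close> minus and plus \<open>2 Im (q cnj p)\<close>.\<close>

lemma cmod_sum_squares:
  "(cmod (p\<^sup>2 + q\<^sup>2))\<^sup>2 = ((cmod p)\<^sup>2 + (cmod q)\<^sup>2)\<^sup>2 - 4 * (Im (q * cnj p))\<^sup>2"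
  by (simp only: cmod_power2) (simp add: power2_eq_square algebra_simps)

text \<open>With \<open>p\<close>, \<open>q\<close> the sums \<open>x1 + x2\<close>,
  \<open>x3 + x4\<close> and vanishing orientation, \<open>|p^2 + q^2|\<close> equals
  \<open>pos_part\<close>. On the quadric it is also the modulus of a sum of the negative squares,
  at most \<open>neg_part\<close>, which is smaller.\<close>

lemma period_vec_orient:
  assumes "period_vec d x"
  shows "orient x \<noteq> 0"
proof
  assume o: "orient x = 0"
  let ?p = "(x $ 1 + x $ 2)\<^sup>2 + (x $ 3 + x $ 4)\<^sup>2"
  have "(cmod ?p)\<^sup>2 = (pos_part x)\<^sup>2"
    using o unfolding cmod_sum_squares by (simp add: orient_def pos_part_def)
  then have "cmod ?p = pos_part x"
    by (rule power2_eq_imp_eq) (simp_all add: pos_part_def)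
  moreover have "?p = (x $ 1 - x $ 2)\<^sup>2 + (x $ 3 - x $ 4)\<^sup>2 + 4 * of_nat d * (x $ 5)\<^sup>2 + 12 * (x $ 6)\<^sup>2"
    using assms two_bil_self[of d x] by (simp add: period_vec_def)
  moreover have "cmod \<dots> \<le> neg_part d x"
    unfolding neg_part_def
    by (intro norm_triangle_le add_mono) (simp_all add: norm_mult norm_power)
  moreover have "neg_part d x < pos_part x"
    using assms Re_bil_cnj[of d x] by (simp add: period_vec_def)
  ultimately show False by simp
qed

lemma period_vec_smult:
  assumes "period_vec d x" "c \<noteq> 0"
  shows "period_vec d (c *s x)"
proof -
  have "bil d (c *s x) (cnj_vec (c *s x)) = (c * cnj c) * bil d x (cnj_vec x)"
    by (simp add: mult_ac)
  also have "c * cnj c = complex_of_real ((cmod c)\<^sup>2)"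
    by (rule complex_norm_square[symmetric])
  finally have "Re (bil d (c *s x) (cnj_vec (c *s x))) = (cmod c)\<^sup>2 * Re (bil d x (cnj_vec x))"
    by (simp only: Re_complex_of_real Im_complex_of_real times_complex.simps)
  then show ?thesis using assms by (simp add: period_vec_def del: bil_linear cnj_vec_simps) (simp add: period_vec_def)
qed

lemma cone_period_vec: "cone {x. period_vec d x}"
  using period_vec_smult by (auto simp: cone_def) (simp add: period_vec_def)

lemma Omega_eq: "Omega d = line ` {x. period_vec d x}"
  by (auto simp: Omega_def period_vec_def)

lemma cone_orient: "cone {x. 0 < s * orient x}"
proof -
  have "0 < s * orient (c *s x)" if "0 < s * orient x" "c \<noteq> 0" for c x
  proof -
    have "s * orient (c *s x) = (cmod c)\<^sup>2 * (s * orient x)" by (simp add: orient_smult)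
    also have "0 < \<dots>" using that by simp
    finally show ?thesis .
  qed
  then show ?thesis by (auto simp: cone_def) (simp add: orient_def)
qed

lemma continuous_on_orient [continuous_intros]:
  "continuous_on S f \<Longrightarrow> continuous_on S (\<lambda>x. orient (f x))"
  unfolding orient_def by (intro continuous_intros)

lemma open_orient: "open {x. 0 < s * orient x}"
  by (intro open_Collect_less continuous_intros)

definition half_period :: "nat \<Rightarrow> real \<Rightarrow> (complex ^ 6) set set" where
  "half_period d s = line ` {x. period_vec d x \<and> 0 < s * orient x}"

lemma line_in_half_period_iff:
  assumes "x \<noteq> 0"
  shows "line x \<in> half_period d s \<longleftrightarrow> period_vec d x \<and> 0 < s * orient x"
proof -
  have "cone {x. period_vec d x \<and> 0 < s * orient x}"
    using cone_period_vec[of d] cone_orient[of s] unfolding cone_def by auto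
  from line_in_cone_iff[OF this assms] show ?thesis unfolding half_period_def by simp
qed

text \<open>
  Let \<open>u = \<plusminus>i\<close>, \<open>p = x\<^sub>1 + x\<^sub>2\<close> and \<open>q = x\<^sub>3 + x\<^sub>4\<close>.  The path fixes \<open>p - u q\<close>, multiplies \<open>p + u q\<close> by \<open>t\<^sup>2\<close>
  and the part of \<open>x\<close> in the negative definite complement by \<open>t\<close>, so that it stays on the quadric;
  up to a scalar its end point at \<open>t = 0\<close> does not depend on \<open>x\<close>.
\<close>

definition contract :: "complex \<Rightarrow> complex ^ 6 \<Rightarrow> real \<Rightarrow> complex ^ 6" where
  "contract u x t =
     (let p = (\<chi> i. if i = 1 \<or> i = 2 then (x $ 1 + x $ 2) / 2 else if i = 3 \<or> i = 4 then (x $ 3 + x $ 4) / 2 else 0);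
          q = (\<chi> i. if i = 1 \<or> i = 2 then - u * (x $ 3 + x $ 4) / 2 else if i = 3 \<or> i = 4 then u * (x $ 1 + x $ 2) / 2 else 0)
      in t *\<^sub>R (x - p) + ((1 + t\<^sup>2) / 2) *\<^sub>R p + ((1 - t\<^sup>2) / 2) *\<^sub>R q)"

lemma contract_continuous: "continuous_on S (contract u x)"
  unfolding contract_def Let_def by (intro continuous_intros) auto

lemma contract_components:
  "contract u x t $ 1 + contract u x t $ 2 =
     ((1 + t\<^sup>2) / 2) *\<^sub>R (x $ 1 + x $ 2) - ((1 - t\<^sup>2) / 2) *\<^sub>R (u * (x $ 3 + x $ 4))"
  "contract u x t $ 3 + contract u x t $ 4 =
     ((1 + t\<^sup>2) / 2) *\<^sub>R (x $ 3 + x $ 4) + ((1 - t\<^sup>2) / 2) *\<^sub>R (u * (x $ 1 + x $ 2))"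
  "contract u x t $ 1 - contract u x t $ 2 = t *\<^sub>R (x $ 1 - x $ 2)"
  "contract u x t $ 3 - contract u x t $ 4 = t *\<^sub>R (x $ 3 - x $ 4)"
  "contract u x t $ 5 = t *\<^sub>R x $ 5" "contract u x t $ 6 = t *\<^sub>R x $ 6"
  by (simp_all add: contract_def Let_def complex_eq_iff field_simps)

lemma contract_1: "contract u x 1 = x"
  by (simp add: contract_def Let_def)

lemma contract_0:
  assumes "u\<^sup>2 = -1"
  shows "contract u x 0 = ((x $ 1 + x $ 2 - u * (x $ 3 + x $ 4)) / 4) *s
    (\<chi> i. if i = 1 \<or> i = 2 then 1 else if i = 3 \<or> i = 4 then u else 0)"
proof -
  have u: "u * (u * z) = - z" for z
    using assms by (simp add: power2_eq_square flip: mult.assoc)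
  show ?thesis
    by (simp add: contract_def Let_def vec6_eq_iff) (simp add: scaleR_conv_of_real u ring_distribs add_divide_distrib
        diff_divide_distrib mult.commute[of _ u])
qed

text \<open>The map \<open>(p, q) -> (a p - b u q, a q + b u p)\<close> scales
  \<open>p - u q\<close> by \<open>a + b\<close> and \<open>p + u q\<close> by \<open>a - b\<close>,
  since \<open>u^2 = -1\<close>. It is applied with \<open>a = (1 + t^2)/2\<close> and
  \<open>b = (1 - t^2)/2\<close>.\<close>

lemma rotate_norms:
  fixes a b :: real
  assumes "u = \<i> \<or> u = -\<i>"
  shows "Im u * Im ((a *\<^sub>R q + b *\<^sub>R (u * p)) * cnj (a *\<^sub>R p - b *\<^sub>R (u * q))) =
      (a\<^sup>2 + b\<^sup>2) * (Im u * Im (q * cnj p)) + (a * b) * ((cmod p)\<^sup>2 + (cmod q)\<^sup>2)"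
    and "(cmod (a *\<^sub>R p - b *\<^sub>R (u * q)))\<^sup>2 + (cmod (a *\<^sub>R q + b *\<^sub>R (u * p)))\<^sup>2 =
      (a\<^sup>2 + b\<^sup>2) * ((cmod p)\<^sup>2 + (cmod q)\<^sup>2) + 4 * (a * b) * (Im u * Im (q * cnj p))"
    and "(a *\<^sub>R p - b *\<^sub>R (u * q))\<^sup>2 + (a *\<^sub>R q + b *\<^sub>R (u * p))\<^sup>2 = of_real (a\<^sup>2 - b\<^sup>2) * (p\<^sup>2 + q\<^sup>2)"
  using assms
  unfolding cmod_power2
  by (auto simp: complex_eq_iff power2_eq_square) (simp_all add: algebra_simps)

lemma contract_period:
  assumes x: "period_vec d x" and o: "0 < Im u * orient x" and u: "u = \<i> \<or> u = -\<i>" and t: "0 \<le> t" "t \<le> 1"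
  shows "period_vec d (contract u x t)" "0 < Im u * orient (contract u x t)"
proof -
  let ?y = "contract u x t"
  have "2 * bil d ?y ?y = of_real (t\<^sup>2) * (2 * bil d x x)"
    unfolding two_bil_self contract_components rotate_norms(3)[OF u]
    by (simp add: scaleR_conv_of_real) (simp add: field_simps power2_eq_square)
  then have b: "bil d ?y ?y = 0" using x by (simp add: period_vec_def)
  have ab: "((1 + t\<^sup>2) / 2)\<^sup>2 + ((1 - t\<^sup>2) / 2)\<^sup>2 = (1 + t^4) / 2" "(1 + t\<^sup>2) / 2 * ((1 - t\<^sup>2) / 2) = (1 - t^4) / 4"
    by (simp_all add: power2_eq_square power4_eq_xxxx field_simps)
  have op: "Im u * orient ?y = ((1 - t^4) * pos_part x + 2 * (1 + t^4) * (Im u * orient x)) / 4"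
    unfolding orient_def pos_part_def contract_components rotate_norms(1)[OF u] ab by argo
  have pp: "pos_part ?y = ((1 + t^4) * pos_part x + 2 * (1 - t^4) * (Im u * orient x)) / 2"
    unfolding orient_def pos_part_def contract_components rotate_norms(2)[OF u] ab by argo
  have np: "neg_part d ?y = t\<^sup>2 * neg_part d x"
    unfolding neg_part_def contract_components norm_scaleR power_mult_distrib by (simp add: ring_distribs)
  have t4: "t^4 \<le> 1" using t by (simp add: power_le_one)
  have P: "0 \<le> neg_part d x" "neg_part d x < pos_part x"
    using x Re_bil_cnj[of d x] by (auto simp: period_vec_def neg_part_def)
  show pos: "0 < Im u * orient ?y"
  proof -
    have "0 \<le> (1 - t^4) * pos_part x" using t4 P by simp
    moreover have "0 < 2 * (1 + t^4) * (Im u * orient x)"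
      by (rule mult_pos_pos[OF _ o]) (auto intro: add_pos_nonneg)
    ultimately show ?thesis unfolding op by (intro divide_pos_pos add_nonneg_pos) simp_all
  qed
  \<comment> \<open>The negative part shrinks by \<open>t^2\<close>, which is at most
    \<open>(1 + t^4)/2\<close>, the factor in front of the positive part.\<close>
  have "t\<^sup>2 * neg_part d x \<le> t\<^sup>2 * pos_part x"
    using P by (intro mult_left_mono) auto
  also have "\<dots> \<le> (1 + t^4) * pos_part x / 2"
  proof -
    have "0 \<le> (1 - t\<^sup>2)\<^sup>2 * pos_part x" using P by simp
    also have "\<dots> = (1 + t^4) * pos_part x - 2 * (t\<^sup>2 * pos_part x)"
      by (simp add: power2_eq_square power4_eq_xxxx algebra_simps)
    finally show ?thesis by simp
  qed
  finally have a: "t\<^sup>2 * neg_part d x \<le> (1 + t^4) * pos_part x / 2" .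
  have c: "0 \<le> (1 - t^4) * (Im u * orient x)" using t4 o by simp
  have "neg_part d ?y < pos_part ?y"
  \<comment> \<open>Strictness comes from \<open>neg_part < pos_part\<close> at \<open>t = 1\<close>
    and from the orientation term for \<open>t < 1\<close>.\<close>
  proof (cases "t = 1")
    case True
    then show ?thesis using P by (simp add: contract_1)
  next
    case False
    then have "t < 1" using t by simp
    then have "t^4 < 1" using t by (simp add: power_less_one_iff)
    then have "0 < (1 - t^4) * (Im u * orient x)" using o by simp
    then show ?thesis using a unfolding pp np by argo
  qed
  then have "0 < Re (bil d ?y (cnj_vec ?y))" using Re_bil_cnj[of d ?y] by simp
  with b show "period_vec d ?y"
    using pos by (auto simp: period_vec_def)
qed

text \<open>Both lines are joined to the end point of \<open>contract\<close>, which depends only on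
  the sign \<open>s\<close>.\<close>

lemma half_period_connected:
  assumes x: "period_vec d x" "0 < s * orient x" and y: "period_vec d y" "0 < s * orient y" and s: "s = 1 \<or> s = -1"
  shows "connected_component_of (subtopology proj_top (Omega d)) (line x) (line y)"
proof -
  define u where "u = Complex 0 s"
  have u: "u = \<i> \<or> u = -\<i>" "Im u = s" "u\<^sup>2 = -1" using s by (auto simp: u_def complex_eq_iff power2_eq_square)
  define b :: "complex ^ 6" where "b = (\<chi> i. if i = 1 \<or> i = 2 then 1 else if i = 3 \<or> i = 4 then u else 0)"
  have "connected_component_of (subtopology proj_top (Omega d)) (line z) (line b)"
    if z: "period_vec d z" "0 < s * orient z" for z
  proof -
    let ?f = "\<lambda>t. line (contract u z t)"
    have per: "period_vec d (contract u z t)" if "t \<in> {0..1}" for t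
      using contract_period(1)[OF z(1), of u t] z u that by simp
    have "continuous_map (top_of_set {0..1}) proj_top ?f"
      using per by (intro continuous_map_line contract_continuous) (auto simp: period_vec_def)
    then have "continuous_map (top_of_set {0..1}) (subtopology proj_top (Omega d)) ?f"
      using per by (auto simp: continuous_map_in_subtopology Omega_eq)
    then have "connectedin (subtopology proj_top (Omega d)) (?f ` {0..1})"
      by (rule connectedin_continuous_map_image) simp
    moreover have "line z \<in> ?f ` {0..1}"
      by (intro image_eqI[of _ _ 1]) (simp_all add: contract_1)
    moreover have "contract u z 0 \<noteq> 0"
      using per[of 0] by (simp add: period_vec_def)
    then have "line b \<in> ?f ` {0..1}"
      unfolding contract_0[OF u(3)] b_def[symmetric]
      by (intro image_eqI[of _ _ 0]) (auto simp: contract_0[OF u(3)] line_smult b_def[symmetric])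
    ultimately show ?thesis unfolding connected_component_of_def by blast
  qed
  note to_b = this
  have "connected_component_of (subtopology proj_top (Omega d)) (line b) (line y)"
    using to_b[OF y] by (subst connected_component_of_sym)
  with to_b[OF x] show ?thesis by (rule connected_component_of_trans)
qed

text \<open>\<open>half_period d s\<close> is connected and open, and its complement in
  \<open>Omega\<close> is the equally open \<open>half_period d (- s)\<close>; a connected clopen
  set is a component.\<close>

lemma period_domain_half:
  assumes "is_period_domain d D"
  obtains s where "s = 1 \<or> s = -1" "D = half_period d s"
proof -
  let ?X = "subtopology proj_top (Omega d)"
  have "line ` {x. period_vec d x} \<subseteq> line ` (- {0})"
    by (intro image_mono) (auto simp: period_vec_def)
  then have topX: "topspace ?X = Omega d"
    unfolding topspace_subtopology topspace_proj_top Omega_eq by (rule Int_absorb1)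
  have D: "D \<in> connected_components_of ?X" using assms by (simp add: is_period_domain_def)
  then obtain l where l: "l \<in> Omega d" "D = Collect (connected_component_of ?X l)"
    unfolding connected_components_of_def topX by auto
  then obtain x where x: "period_vec d x" "l = line x" unfolding Omega_eq by auto
  define s where "s = sgn (orient x)"
  have s: "s = 1 \<or> s = -1" "0 < s * orient x"
    using period_vec_orient[OF x(1)] by (auto simp: s_def sgn_if)
  have op: "openin ?X (half_period d r)" for r
  proof -
    have "half_period d r = Omega d \<inter> line ` {x. 0 < r * orient x}"
    proof -
      have "line z \<in> line ` {x. 0 < r * orient x} \<longleftrightarrow> 0 < r * orient z" if "period_vec d z" for z
        using line_in_cone_iff[OF cone_orient, of z r] that by (auto simp: period_vec_def)
      then show ?thesis unfolding half_period_def Omega_eq by auto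
    qed
    then show ?thesis
      using openin_proj_top_cone[OF cone_orient open_orient, of r] by (auto simp: openin_subtopology)
  qed
  have compl: "half_period d (- s) = topspace ?X - half_period d s"
  proof -
    have "period_vec d z \<Longrightarrow> 0 < - s * orient z \<longleftrightarrow> \<not> 0 < s * orient z" for z
      using period_vec_orient[of d z] s(1) by auto
    moreover have "period_vec d z \<Longrightarrow> line z \<in> half_period d s \<longleftrightarrow> 0 < s * orient z" for z
      using line_in_half_period_iff[of z d s] by (auto simp: period_vec_def)
    ultimately show ?thesis unfolding topX unfolding Omega_eq half_period_def[of d "- s"] by auto
  qed
  have cl: "closedin ?X (half_period d s)"
    unfolding closedin_def using op[of "- s"] unfolding compl
    by (auto simp: topX simp del: topspace_subtopology) (auto simp: half_period_def Omega_eq)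
  have lin: "l \<in> half_period d s" using x s by (auto simp: half_period_def)
  have "half_period d s \<subseteq> D"
    using half_period_connected[OF x(1) s(2) _ _ s(1)] unfolding l(2) x(2) half_period_def by auto
  moreover have "D \<subseteq> half_period d s"
  proof -
    have "connectedin ?X D" using D by (rule connectedin_connected_components_of)
    from connectedin_clopen_cases[OF this cl op]
    have "D \<subseteq> half_period d s \<or> disjnt D (half_period d s)" .
    moreover have "l \<in> D" unfolding l(2) using l(1) topX by (simp add: connected_component_of_refl)
    ultimately show ?thesis using lin unfolding disjnt_def by blast
  qed
  ultimately show ?thesis using that[OF s(1)] by simp
qed

section \<open>Normalised bases\<close>

text \<open>Divisibility arguments call for integral vectors with explicit coefficients;
  \<open>rvec\<close> later carries the results back to \<open>latt\<close>.\<close>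

definition zbasis6 :: "int ^ 6 \<Rightarrow> int ^ 6 \<Rightarrow> int ^ 6 \<Rightarrow> int ^ 6 \<Rightarrow> int ^ 6 \<Rightarrow> int ^ 6 \<Rightarrow> bool" where
  "zbasis6 u1 u2 u3 u4 u5 u6 \<longleftrightarrow>
     (\<forall>x. \<exists>c1 c2 c3 c4 c5 c6. x = c1 *s u1 + c2 *s u2 + c3 *s u3 + c4 *s u4 + c5 *s u5 + c6 *s u6) \<and>
     (\<forall>c1 c2 c3 c4 c5 c6. c1 *s u1 + c2 *s u2 + c3 *s u3 + c4 *s u4 + c5 *s u5 + c6 *s u6 = 0 \<longrightarrow>
        c1 = 0 \<and> c2 = 0 \<and> c3 = 0 \<and> c4 = 0 \<and> c5 = 0 \<and> c6 = 0)"

lemma zbasis6_expand: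
  assumes "zbasis6 u1 u2 u3 u4 u5 u6"
  obtains c1 c2 c3 c4 c5 c6 where "x = c1 *s u1 + c2 *s u2 + c3 *s u3 + c4 *s u4 + c5 *s u5 + c6 *s u6"
proof -
  have "\<exists>c1 c2 c3 c4 c5 c6. x = c1 *s u1 + c2 *s u2 + c3 *s u3 + c4 *s u4 + c5 *s u5 + c6 *s u6"
    by (rule assms[unfolded zbasis6_def, THEN conjunct1, THEN spec])
  then show ?thesis by (elim exE) (rule that)
qed

lemma zbasis6_independent:
  assumes "zbasis6 u1 u2 u3 u4 u5 u6"
    and "c1 *s u1 + c2 *s u2 + c3 *s u3 + c4 *s u4 + c5 *s u5 + c6 *s u6 = 0"
  shows "c1 = 0 \<and> c2 = 0 \<and> c3 = 0 \<and> c4 = 0 \<and> c5 = 0 \<and> c6 = 0"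
  by (rule assms(1)[unfolded zbasis6_def, THEN conjunct2, rule_format, OF assms(2)])

text \<open>A unitriangular substitution wide enough for both normalisations below, the one at
  \<open>f\<close> and the decoupling of \<open>w\<close>.\<close>

lemma zbasis6_transform:
  assumes "zbasis6 u1 u2 u3 u4 u5 u6"
  shows "zbasis6 u1 u2 (u3 + a1 *s u1 + a2 *s u2) (u4 + b1 *s u1 + b2 *s u2)
    (u5 + e *s u2) (u6 + g2 *s u2 + g3 *s u3 + g4 *s u4)"
  unfolding zbasis6_def
proof (intro conjI allI impI)
  fix x
  obtain c1 c2 c3 c4 c5 c6 where x: "x = c1 *s u1 + c2 *s u2 + c3 *s u3 + c4 *s u4 + c5 *s u5 + c6 *s u6"
    using zbasis6_expand[OF assms] .
  have "x = (c1 - a1 * (c3 - g3 * c6) - b1 * (c4 - g4 * c6)) *s u1 +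
      (c2 - e * c5 - g2 * c6 - a2 * (c3 - g3 * c6) - b2 * (c4 - g4 * c6)) *s u2 +
      (c3 - g3 * c6) *s (u3 + a1 *s u1 + a2 *s u2) + (c4 - g4 * c6) *s (u4 + b1 *s u1 + b2 *s u2) +
      c5 *s (u5 + e *s u2) + c6 *s (u6 + g2 *s u2 + g3 *s u3 + g4 *s u4)"
    unfolding x vec_eq_iff by (simp add: algebra_simps)
  then show "\<exists>c1 c2 c3 c4 c5 c6. x = c1 *s u1 + c2 *s u2 + c3 *s (u3 + a1 *s u1 + a2 *s u2) +
      c4 *s (u4 + b1 *s u1 + b2 *s u2) + c5 *s (u5 + e *s u2) + c6 *s (u6 + g2 *s u2 + g3 *s u3 + g4 *s u4)"
    by (intro exI)
next
  fix c1 c2 c3 c4 c5 c6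
  assume "c1 *s u1 + c2 *s u2 + c3 *s (u3 + a1 *s u1 + a2 *s u2) +
      c4 *s (u4 + b1 *s u1 + b2 *s u2) + c5 *s (u5 + e *s u2) + c6 *s (u6 + g2 *s u2 + g3 *s u3 + g4 *s u4) = 0"
    (is "?s = 0")
  also have "?s = (c1 + a1 * c3 + b1 * c4) *s u1 + (c2 + a2 * c3 + b2 * c4 + e * c5 + g2 * c6) *s u2 +
      (c3 + g3 * c6) *s u3 + (c4 + g4 * c6) *s u4 + c5 *s u5 + c6 *s u6"
    unfolding vec_eq_iff by (simp add: algebra_simps)
  finally have "c1 + a1 * c3 + b1 * c4 = 0 \<and> c2 + a2 * c3 + b2 * c4 + e * c5 + g2 * c6 = 0 \<and>
      c3 + g3 * c6 = 0 \<and> c4 + g4 * c6 = 0 \<and> c5 = 0 \<and> c6 = 0"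
    by (rule zbasis6_independent[OF assms])
  then show "c1 = 0" "c2 = 0" "c3 = 0" "c4 = 0" "c5 = 0" "c6 = 0" by auto
qed

text \<open>A basis stays independent modulo \<open>n\<close>: a combination divisible by
  \<open>n\<close> is \<open>n y\<close> with \<open>y\<close> integral, and the coefficients of
  both sides agree.\<close>

lemma zbasis6_dvd:
  assumes "zbasis6 u1 u2 u3 u4 u5 u6" and n: "n \<noteq> 0"
    and dvd: "\<forall>i. n dvd (c1 *s u1 + c2 *s u2 + c3 *s u3 + c4 *s u4 + c5 *s u5 + c6 *s u6) $ i"
  shows "n dvd c1" "n dvd c3" "n dvd c4"
proof -
  let ?x = "c1 *s u1 + c2 *s u2 + c3 *s u3 + c4 *s u4 + c5 *s u5 + c6 *s u6"
  have "\<exists>y. ?x = n *s y"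
    using dvd by (intro exI[of _ "\<chi> i. ?x $ i div n"]) (simp add: vec_eq_iff)
  then obtain y where y: "?x = n *s y" by blast
  obtain e1 e2 e3 e4 e5 e6 where e: "y = e1 *s u1 + e2 *s u2 + e3 *s u3 + e4 *s u4 + e5 *s u5 + e6 *s u6"
    using zbasis6_expand[OF assms(1)] .
  have "(c1 - n * e1) *s u1 + (c2 - n * e2) *s u2 + (c3 - n * e3) *s u3 + (c4 - n * e4) *s u4 +
      (c5 - n * e5) *s u5 + (c6 - n * e6) *s u6 = ?x - n *s y"
    unfolding e vec_eq_iff by (simp add: algebra_simps)
  also have "\<dots> = 0" using y by simp
  finally have "c1 - n * e1 = 0 \<and> c2 - n * e2 = 0 \<and> c3 - n * e3 = 0 \<and> c4 - n * e4 = 0 \<and>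
      c5 - n * e5 = 0 \<and> c6 - n * e6 = 0"
    by (rule zbasis6_independent[OF assms(1)])
  then show "n dvd c1" "n dvd c3" "n dvd c4" by (auto simp: dvd_def)
qed

section \<open>The dual lattice modulo \<open>p\<close> and modulo 2\<close>

lemma bil_axis:
  fixes x :: "int ^ 6"
  shows "bil d x (axis 1 1) = x $ 2" "bil d x (axis 2 1) = x $ 1" "bil d x (axis 3 1) = x $ 4"
    "bil d x (axis 4 1) = x $ 3" "bil d x (axis 5 1) = - 2 * int d * x $ 5" "bil d x (axis 6 1) = - 6 * x $ 6"
  by (simp_all add: bil_def axis_def)

lemma bil_self_even:
  fixes x :: "int ^ 6"
  shows "even (bil d x x)"
  by (simp add: bil_def)

text \<open>
  If \<open>x/p\<close> and \<open>(y - c x/p)/p\<close> lie in the dual lattice, then \<open>(y, y) \<equiv> 2 c\<^sup>2 x\<^sub>5\<^sup>2\<close> modulo \<open>p\<close>, since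
  only the fifth coordinate of a vector of the dual lattice can have \<open>p\<close> in its denominator.
\<close>

lemma dependent_mod_prime:
  fixes x y :: "int ^ 6" and p :: nat
  assumes p: "prime p" "p > 3"
    and x: "\<And>z. int p dvd bil (p\<^sup>2) x z" "bil (p\<^sup>2) x x = 0"
    and y: "\<And>z. (int p)\<^sup>2 dvd int p * bil (p\<^sup>2) y z - c * bil (p\<^sup>2) x z" "int p dvd bil (p\<^sup>2) y y"
  shows "(\<forall>i. int p dvd x $ i) \<or> (\<exists>s. \<forall>i. int p dvd (y - s *s x) $ i)"
proof -
  have pp: "prime (int p)" using p by simp
  have p2: "\<not> int p dvd 2" and p3: "\<not> int p dvd 3"
    using p by (auto dest!: zdvd_imp_le)
  then have "\<not> int p dvd 2 * 3" using pp by (simp only: prime_dvd_mult_iff) blast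
  then have p6: "\<not> int p dvd 6" by simp
  \<comment> \<open>Only coordinate 5 escapes, because its pairing carries the factor
    \<open>2 p^2\<close>.\<close>
  have xi: "int p dvd x $ 1" "int p dvd x $ 2" "int p dvd x $ 3" "int p dvd x $ 4" "int p dvd x $ 6"
    using x(1)[of "axis 1 1"] x(1)[of "axis 2 1"] x(1)[of "axis 3 1"] x(1)[of "axis 4 1"]
      x(1)[of "axis 6 1"] p6 pp by (simp_all add: bil_axis prime_dvd_mult_iff)
  then obtain x1 x2 x3 x4 x6 where X: "x $ 1 = int p * x1" "x $ 2 = int p * x2" "x $ 3 = int p * x3"
    "x $ 4 = int p * x4" "x $ 6 = int p * x6" by (elim dvdE) (rule that)
  have p0: "int p \<noteq> 0" using p by auto
  have cancel: "int p dvd u - c * v" if "(int p)\<^sup>2 dvd int p * u - c * (int p * v)" for u v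
  proof -
    have "int p * int p dvd int p * (u - c * v)"
      using that by (simp add: power2_eq_square right_diff_distrib mult.left_commute)
    then show ?thesis using p0 by simp
  qed
  have "int p dvd 6 * (c * x6 - y $ 6)"
    using cancel[of "- 6 * y $ 6" "- 6 * x6"] y(1)[of "axis 6 1"] by (simp add: bil_axis X algebra_simps)
  then have "int p dvd c * x6 - y $ 6"
    using p6 pp by (simp only: prime_dvd_mult_iff) blast
  then have Y6: "int p dvd y $ 6 - c * x6"
    by (simp only: dvd_diff_commute)
  have Y: "int p dvd y $ 1 - c * x1" "int p dvd y $ 2 - c * x2" "int p dvd y $ 3 - c * x3" "int p dvd y $ 4 - c * x4"
    using cancel y(1)[of "axis 1 1"] y(1)[of "axis 2 1"] y(1)[of "axis 3 1"] y(1)[of "axis 4 1"]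
    by (simp_all add: bil_axis X)
  obtain z1 z2 z3 z4 z6 where Z': "y $ 1 - c * x1 = int p * z1" "y $ 2 - c * x2 = int p * z2"
    "y $ 3 - c * x3 = int p * z3" "y $ 4 - c * x4 = int p * z4" "y $ 6 - c * x6 = int p * z6"
    using Y Y6 by (elim dvdE) (rule that)
  then have Z: "y $ 1 = c * x1 + int p * z1" "y $ 2 = c * x2 + int p * z2"
    "y $ 3 = c * x3 + int p * z3" "y $ 4 = c * x4 + int p * z4" "y $ 6 = c * x6 + int p * z6"
    by auto
  \<comment> \<open>The fifth term of \<open>(x, x)\<close> carries \<open>d = p^2\<close>. After
    division by \<open>p^2\<close>, isotropy expresses the norm of \<open>x/p\<close> off coordinate
    5 through the square of \<open>x $ 5\<close>.\<close>
  have "0 = (int p)\<^sup>2 * (2 * (x1 * x2 + x3 * x4 - (x $ 5)\<^sup>2 - 3 * x6\<^sup>2))"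
    using x(2) by (simp add: bil_def X power2_eq_square algebra_simps)
  then have q: "x1 * x2 + x3 * x4 - 3 * x6\<^sup>2 = (x $ 5)\<^sup>2" using p0 by simp
  \<comment> \<open>Off coordinate 5, \<open>y\<close> is \<open>c x/p\<close> modulo
    \<open>p\<close>; the fifth term vanishes modulo \<open>p\<close>.\<close>
  have "bil (p\<^sup>2) y y = 2 * c\<^sup>2 * (x1 * x2 + x3 * x4 - 3 * x6\<^sup>2) +
      int p * (2 * (c * x1 * z2 + c * x2 * z1 + int p * z1 * z2 + c * x3 * z4 + c * x4 * z3 + int p * z3 * z4)
         - 2 * int p * (y $ 5)\<^sup>2 - 6 * (2 * c * x6 * z6 + int p * z6\<^sup>2))"
    by (simp add: bil_def Z power2_eq_square algebra_simps)
  then have "int p dvd 2 * c\<^sup>2 * (x $ 5)\<^sup>2"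
    using y(2) unfolding q by (metis dvd_add_left_iff dvd_triv_left)
  then have "int p dvd c \<or> int p dvd x $ 5"
    using pp p2 by (simp add: prime_dvd_mult_iff prime_dvd_power_iff)
  then show ?thesis
  proof
    assume "int p dvd x $ 5"
    then show ?thesis using xi by (simp add: forall_6)
  next
    \<comment> \<open>Now both vectors are supported on coordinate 5 modulo \<open>p\<close>, so
      \<open>y\<close> is a multiple of \<open>x\<close> once \<open>x $ 5\<close> is a
      unit.\<close>
    assume c: "int p dvd c"
    then have yi: "int p dvd y $ 1" "int p dvd y $ 2" "int p dvd y $ 3" "int p dvd y $ 4" "int p dvd y $ 6"
      unfolding Z by auto
    show ?thesis
    proof (cases "int p dvd x $ 5")
      case True
      then show ?thesis using xi by (simp add: forall_6)
    next
      case False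
      then have "coprime (x $ 5) (int p)" using pp by (metis coprime_commute prime_imp_coprime)
      then obtain t where t: "[x $ 5 * t = 1] (mod int p)" using cong_solve_coprime_int by blast
      have "int p dvd x $ 5 * t - 1" using t by (simp add: cong_iff_dvd_diff)
      then have "int p dvd - y $ 5 * (x $ 5 * t - 1)" by (rule dvd_mult)
      then have "int p dvd y $ 5 - (y $ 5 * t) * x $ 5" by (simp add: algebra_simps)
      then have "\<forall>i. int p dvd (y - (y $ 5 * t) *s x) $ i"
        using xi yi by (simp add: forall_6)
      then show ?thesis by blast
    qed
  qed
qed

text \<open>As \<open>d\<close> is odd, the 2-part of the discriminant group comes from the halves
  of axes 5 and 6. Isotropy gives \<open>x $ 5\<close> and \<open>x $ 6\<close> equal parity; when
  both are odd, \<open>c\<close> is even and half of \<open>y - (c/2) x\<close> lies in the dual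
  lattice.\<close>

lemma parity_mod_two:
  fixes x y :: "int ^ 6"
  assumes d: "odd d"
    and x: "\<And>z. even (bil d x z)" "bil d x x = 0"
    and y: "\<And>z. 4 dvd 2 * bil d y z - c * bil d x z"
  shows "even (x $ 1) \<and> even (x $ 2) \<and> even (x $ 3) \<and> even (x $ 4) \<and>
    ((\<forall>i. even (x $ i)) \<or> odd (x $ 5) \<and> odd (x $ 6) \<and>
       (\<exists>s. even ((y - s *s x) $ 1) \<and> even ((y - s *s x) $ 2) \<and> even ((y - s *s x) $ 3) \<and> even ((y - s *s x) $ 4)))"
proof -
  have xi: "even (x $ 1)" "even (x $ 2)" "even (x $ 3)" "even (x $ 4)"
    using x(1)[of "axis 1 1"] x(1)[of "axis 2 1"] x(1)[of "axis 3 1"] x(1)[of "axis 4 1"]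
    by (simp_all add: bil_axis)
  then obtain x1 x2 x3 x4 where X: "x $ 1 = 2 * x1" "x $ 2 = 2 * x2" "x $ 3 = 2 * x3" "x $ 4 = 2 * x4"
    by (auto elim!: evenE)
  show ?thesis
  proof (cases "even (x $ 5) \<and> even (x $ 6)")
    case True
    then show ?thesis using xi by (simp add: forall_6)
  next
    case False
    have "2 * (2 * (x1 * x2 + x3 * x4)) = int d * (x $ 5)\<^sup>2 + 3 * (x $ 6)\<^sup>2"
      using x(2) by (simp add: bil_def X power2_eq_square algebra_simps)
    then have "even (int d * (x $ 5)\<^sup>2 + 3 * (x $ 6)\<^sup>2)" by (metis dvd_triv_left)
    then have odd: "odd (x $ 5)" "odd (x $ 6)" using False d by auto
    \<comment> \<open>Coordinate 6 detects the parity of \<open>c\<close>, because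
      \<open>x $ 6\<close> is odd.\<close>
    have "4 dvd 2 * (- 6 * y $ 6) - c * (- 6 * x $ 6)"
      using y[of "axis 6 1"] by (simp only: bil_axis)
    then obtain k where "2 * (- 6 * y $ 6) - c * (- 6 * x $ 6) = 4 * k" by (elim dvdE)
    then have "3 * (c * x $ 6) = 2 * (k + 3 * y $ 6)" by (simp add: algebra_simps)
    then have "even (3 * (c * x $ 6))" by (metis dvd_triv_left)
    then have "even c" using odd(2) by simp
    then obtain s where s: "c = 2 * s" by (elim evenE)
    have half: "even (u - s * v)" if "4 dvd 2 * u - c * v" for u v
    proof -
      have "2 * 2 dvd 2 * (u - s * v)" using that unfolding s by (simp add: algebra_simps)
      then show ?thesis by (simp only: dvd_times_left_cancel_iff)
    qed
    have "even ((y - s *s x) $ 1) \<and> even ((y - s *s x) $ 2) \<and> even ((y - s *s x) $ 3) \<and> even ((y - s *s x) $ 4)"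
      using half[OF y[of "axis 1 1"]] half[OF y[of "axis 2 1"]] half[OF y[of "axis 3 1"]] half[OF y[of "axis 4 1"]]
      by (simp add: bil_axis)
    then show ?thesis using xi odd by blast
  qed
qed


text \<open>Intermediate normal form: \<open>v2\<close> and \<open>f\<close> already span a
  hyperbolic plane orthogonal to the other basis vectors, but \<open>w\<close> may still pair with
  \<open>k3\<close> and \<open>k4\<close>.\<close>

locale pre_frame =
  fixes d a :: nat and v1 v2 k3 k4 f w :: "int ^ 6"
  assumes basis: "zbasis6 v1 v2 k3 k4 f w"
    and gram:
      "bil d v1 v1 = 0" "bil d v1 v2 = 0" "bil d v2 v2 = 0"
      "bil d v1 k3 = 0" "bil d v1 k4 = 0" "bil d v2 k3 = 0" "bil d v2 k4 = 0"
      "bil d v1 f = 0" "bil d v1 w = int a" "bil d v2 f = 1" "bil d v2 w = 0"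
      "bil d f f = 0" "bil d f k3 = 0" "bil d f k4 = 0" "bil d f w = 0"
begin

lemmas gram' = gram
  gram(2)[unfolded bil_commute[of d v1]] gram(4)[unfolded bil_commute[of d v1]]
  gram(5)[unfolded bil_commute[of d v1]] gram(6)[unfolded bil_commute[of d v2]]
  gram(7)[unfolded bil_commute[of d v2]] gram(8)[unfolded bil_commute[of d v1]]
  gram(9)[unfolded bil_commute[of d v1]] gram(10)[unfolded bil_commute[of d v2]]
  gram(11)[unfolded bil_commute[of d v2]] gram(13)[unfolded bil_commute[of d f]]
  gram(14)[unfolded bil_commute[of d f]] gram(15)[unfolded bil_commute[of d f]]

definition disc :: int where
  "disc = bil d k3 k3 * bil d k4 k4 - (bil d k3 k4)\<^sup>2"

lemma kernel_mod_p:
  fixes p :: nat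
  assumes p: "prime p" "p > 3" "d = p\<^sup>2" "a = p * a'" "coprime a' p"
    and y: "int p dvd bil d (y3 *s k3 + y4 *s k4) k3" "int p dvd bil d (y3 *s k3 + y4 *s k4) k4"
  shows "int p dvd y3 \<and> int p dvd y4"
proof -
  define y where "y = y3 *s k3 + y4 *s k4"
  have "coprime (int a') (int p)" using p by simp
  then obtain b where b: "[int a' * b = 1] (mod int p)" using cong_solve_coprime_int by blast
  \<comment> \<open>Since \<open>(v1, w) = p a'\<close>, the product \<open>c a'\<close> has to
    agree with \<open>(y, w)\<close> modulo \<open>p\<close>.\<close>
  define c where "c = bil d y w * b"
  have "int p dvd 1 - int a' * b"
    using b by (metis cong_iff_dvd_diff cong_sym)
  then have cw: "int p dvd bil d y w - c * int a'"
    unfolding c_def by (metis dvd_mult mult.assoc mult.commute mult.right_neutral right_diff_distrib)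
  have zx: "int p dvd bil d v1 z" and zy: "(int p)\<^sup>2 dvd int p * bil d y z - c * bil d v1 z" for z
  proof -
    obtain c1 c2 c3 c4 c5 c6 where z: "z = c1 *s v1 + c2 *s v2 + c3 *s k3 + c4 *s k4 + c5 *s f + c6 *s w"
      using zbasis6_expand[OF basis] .
    have 1: "bil d v1 z = int p * (int a' * c6)"
      unfolding z using p(4) by (simp add: gram')
    then show "int p dvd bil d v1 z" by simp
    have 2: "bil d y z = c3 * bil d y k3 + c4 * bil d y k4 + c6 * bil d y w"
      unfolding z y_def by (simp add: gram')
    have "int p * bil d y z - c * bil d v1 z =
        int p * (c3 * bil d y k3 + c4 * bil d y k4 + c6 * (bil d y w - c * int a'))"
      unfolding 1 2 by (simp add: algebra_simps)
    moreover have "int p dvd c3 * bil d y k3 + c4 * bil d y k4 + c6 * (bil d y w - c * int a')"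
      using y cw unfolding y_def[symmetric] by auto
    ultimately show "(int p)\<^sup>2 dvd int p * bil d y z - c * bil d v1 z"
      by (simp add: power2_eq_square)
  qed
  have "bil d y y = y3 * bil d y k3 + y4 * bil d y k4"
    unfolding y_def by simp
  then have yy: "int p dvd bil d y y" using y unfolding y_def[symmetric] by auto
  from dependent_mod_prime[OF p(1,2) zx[unfolded p(3)] gram(1)[unfolded p(3)] zy[unfolded p(3)] yy[unfolded p(3)]]
  show ?thesis
  proof
    assume "\<forall>i. int p dvd v1 $ i"
    then have "\<forall>i. int p dvd (1 *s v1 + 0 *s v2 + 0 *s k3 + 0 *s k4 + 0 *s f + 0 *s w) $ i" by simp
    from zbasis6_dvd(1)[OF basis _ this] have "int p dvd 1" using p by simp
    then show ?thesis using p by simp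
  next
    assume "\<exists>s. \<forall>i. int p dvd (y - s *s v1) $ i"
    then obtain s where "\<forall>i. int p dvd (y - s *s v1) $ i" by blast
    also have "y - s *s v1 = (- s) *s v1 + 0 *s v2 + y3 *s k3 + y4 *s k4 + 0 *s f + 0 *s w"
      unfolding y_def vec_eq_iff by simp
    finally have "\<forall>i. int p dvd ((- s) *s v1 + 0 *s v2 + y3 *s k3 + y4 *s k4 + 0 *s f + 0 *s w) $ i" .
    moreover have "int p \<noteq> 0" using p by auto
    ultimately show ?thesis using zbasis6_dvd(2,3)[OF basis] by blast
  qed
qed

lemma disc_not_dvd_p:
  fixes p :: nat
  assumes p: "prime p" "p > 3" "d = p\<^sup>2" "a = p * a'" "coprime a' p"
  shows "\<not> int p dvd disc"
proof
  assume D: "int p dvd disc"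
  note ker = kernel_mod_p[OF p]
  \<comment> \<open>Columns of the adjugate of the Gram matrix. They lie in the kernel if
    \<open>p\<close> divides \<open>disc\<close>, so \<open>p\<close> divides every entry, and then
    \<open>k3\<close> itself is in the kernel.\<close>
  have "bil d (bil d k4 k4 *s k3 + (- bil d k3 k4) *s k4) k3 = disc"
    "bil d (bil d k4 k4 *s k3 + (- bil d k3 k4) *s k4) k4 = 0"
    "bil d ((- bil d k3 k4) *s k3 + bil d k3 k3 *s k4) k3 = 0"
    "bil d ((- bil d k3 k4) *s k3 + bil d k3 k3 *s k4) k4 = disc"
    by (simp_all add: disc_def power2_eq_square bil_commute[of d k4 k3])
  then have "int p dvd bil d k4 k4" "int p dvd - bil d k3 k4" "int p dvd bil d k3 k3"
    using ker[of "bil d k4 k4" "- bil d k3 k4"] ker[of "- bil d k3 k4" "bil d k3 k3"] D by auto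
  then have "int p dvd 1" using ker[of 1 0] by simp
  then show False using p by simp
qed

text \<open>The lattice is even, so an even \<open>disc\<close> makes the whole Gram matrix of
  \<open>k3\<close>, \<open>k4\<close> even. Then \<open>v1\<close>, \<open>k3\<close>,
  \<open>k4\<close> are supported modulo 2 on coordinates 5 and 6: three vectors in a plane over the
  field with two elements.\<close>

lemma disc_odd:
  assumes d: "odd d" and a: "a = 2 * a'" "odd a'"
  shows "odd disc"
proof
  assume "even disc"
  then have k34: "even (bil d k3 k4)"
    using bil_self_even[of d k3] by (simp add: disc_def)
  have zx: "even (bil d v1 z)" for z
  proof -
    obtain c1 c2 c3 c4 c5 c6 where z: "z = c1 *s v1 + c2 *s v2 + c3 *s k3 + c4 *s k4 + c5 *s f + c6 *s w"
      using zbasis6_expand[OF basis] .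
    show ?thesis unfolding z using a by (simp add: gram')
  qed
  \<comment> \<open>As \<open>a'\<close> is odd, 1 is its inverse modulo 2 and the multiplier is
    \<open>(y, w)\<close>.\<close>
  have zy: "4 dvd 2 * bil d y z - bil d y w * bil d v1 z"
    if y: "y = k3 \<or> y = k4" for y z
  proof -
    obtain c1 c2 c3 c4 c5 c6 where z: "z = c1 *s v1 + c2 *s v2 + c3 *s k3 + c4 *s k4 + c5 *s f + c6 *s w"
      using zbasis6_expand[OF basis] .
    have e: "even (bil d y k3)" "even (bil d y k4)"
      using y k34 bil_self_even[of d] bil_commute[of d k4 k3] by auto
    have "2 * bil d y z - bil d y w * bil d v1 z =
        2 * (c3 * bil d y k3 + c4 * bil d y k4 + c6 * bil d y w * (1 - int a'))"
      unfolding z using a y by (auto simp: gram' algebra_simps)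
    moreover have "even (c3 * bil d y k3 + c4 * bil d y k4 + c6 * bil d y w * (1 - int a'))"
      using e a by auto
    then have "2 * 2 dvd 2 * (c3 * bil d y k3 + c4 * bil d y k4 + c6 * bil d y w * (1 - int a'))"
      by (rule mult_dvd_mono[OF dvd_refl])
    ultimately show ?thesis by simp
  qed
  have not_even: "\<not> (\<forall>i. even ((r *s v1 + s *s k3 + t *s k4) $ i))" if "odd r \<or> odd s \<or> odd t" for r s t
  proof
    assume "\<forall>i. even ((r *s v1 + s *s k3 + t *s k4) $ i)"
    then have "\<forall>i. even ((r *s v1 + 0 *s v2 + s *s k3 + t *s k4 + 0 *s f + 0 *s w) $ i)" by simp
    from zbasis6_dvd[OF basis _ this] that show False by auto
  qed
  note par = parity_mod_two[OF d zx gram(1) zy]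
  have "\<not> (\<forall>i. even (v1 $ i))" using not_even[of 1 0 0] by simp
  then have x: "even (v1 $ 1)" "even (v1 $ 2)" "even (v1 $ 3)" "even (v1 $ 4)" "odd (v1 $ 5)" "odd (v1 $ 6)"
    and "\<exists>s. even ((k3 - s *s v1) $ 1) \<and> even ((k3 - s *s v1) $ 2) \<and> even ((k3 - s *s v1) $ 3) \<and> even ((k3 - s *s v1) $ 4)"
    and "\<exists>s. even ((k4 - s *s v1) $ 1) \<and> even ((k4 - s *s v1) $ 2) \<and> even ((k4 - s *s v1) $ 3) \<and> even ((k4 - s *s v1) $ 4)"
    using par[of k3] par[of k4] by blast+
  then have k: "even (k3 $ 1)" "even (k3 $ 2)" "even (k3 $ 3)" "even (k3 $ 4)"
     "even (k4 $ 1)" "even (k4 $ 2)" "even (k4 $ 3)" "even (k4 $ 4)" by auto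
  \<comment> \<open>On coordinates 5 and 6, \<open>v1\<close> is \<open>(1, 1)\<close> modulo 2, so
    a vector with even sum there is congruent to 0 or to \<open>v1\<close>.\<close>
  have cases: "even (k3 $ 5 + k3 $ 6) \<or> even (k4 $ 5 + k4 $ 6) \<or> even ((k3 + k4) $ 5 + (k3 + k4) $ 6)"
    by auto
  have shift: "\<exists>r. \<forall>i. even ((y + r *s v1) $ i)"
    if "even (y $ 1)" "even (y $ 2)" "even (y $ 3)" "even (y $ 4)" "even (y $ 5 + y $ 6)" for y :: "int ^ 6"
    using that x by (intro exI[of _ "y $ 5"]) (auto simp: forall_6)
  have eqs: "r *s v1 + 1 *s k3 + 0 *s k4 = k3 + r *s v1" "r *s v1 + 0 *s k3 + 1 *s k4 = k4 + r *s v1"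
    "r *s v1 + 1 *s k3 + 1 *s k4 = (k3 + k4) + r *s v1" for r
    by (simp_all add: vec_eq_iff)
  have none: "\<not> (\<forall>i. even ((k3 + r *s v1) $ i))" "\<not> (\<forall>i. even ((k4 + r *s v1) $ i))"
    "\<not> (\<forall>i. even (((k3 + k4) + r *s v1) $ i))" for r
    by (rule not_even[of r 1 0, unfolded eqs] not_even[of r 0 1, unfolded eqs] not_even[of r 1 1, unfolded eqs],
        simp)+
  from cases show False
  proof (elim disjE)
    assume "even ((k3 + k4) $ 5 + (k3 + k4) $ 6)"
    then have "\<exists>r. \<forall>i. even ((k3 + k4 + r *s v1) $ i)" using k by (intro shift) auto
    then show False using none(3) by blast
  qed (use shift[OF k(1-4)] shift[OF k(5-8)] none in blast)+
qed

text \<open>Projecting \<open>w\<close> off \<open>k3\<close> and \<open>k4\<close> would divide by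
  \<open>disc\<close>, which is invertible only modulo \<open>a\<close>. The remaining pairings are
  divisible by \<open>a = (v1, w)\<close> and are removed by adding multiples of \<open>v1\<close>
  to \<open>k3\<close> and \<open>k4\<close>.\<close>

lemma decouple:
  assumes "coprime disc (int a)"
  obtains k3' k4' w' where "pre_frame d a v1 v2 k3' k4' f w'" "bil d k3' w' = 0" "bil d k4' w' = 0"
proof -
  obtain b where b: "[disc * b = 1] (mod int a)" using cong_solve_coprime_int[OF assms] by blast
  then obtain n where n: "1 - disc * b = int a * n"
    by (metis cong_iff_dvd_diff cong_sym dvdE)
  define r s where "r = bil d k3 w" and "s = bil d k4 w"
  \<comment> \<open>Cramer's rule for the Gram matrix, with \<open>b\<close> in place of
    \<open>1/disc\<close>.\<close>
  define c3 c4 where "c3 = b * (r * bil d k4 k4 - s * bil d k3 k4)" and "c4 = b * (s * bil d k3 k3 - r * bil d k3 k4)"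
  define k3' k4' w' where "k3' = k3 + (- n * r) *s v1 + 0 *s v2" and "k4' = k4 + (- n * s) *s v1 + 0 *s v2"
    and "w' = w + 0 *s v2 + (- c3) *s k3 + (- c4) *s k4"
  have "r = disc * b * r + int a * n * r" "s = disc * b * s + int a * n * s"
    unfolding n[symmetric] by (simp_all add: algebra_simps)
  then have "r - c3 * bil d k3 k3 - c4 * bil d k3 k4 = int a * n * r"
    "s - c3 * bil d k3 k4 - c4 * bil d k4 k4 = int a * n * s"
    unfolding c3_def c4_def disc_def by (simp_all add: algebra_simps power2_eq_square)
  then have "bil d k3' w' = 0" "bil d k4' w' = 0"
    unfolding k3'_def k4'_def w'_def
    by (simp_all add: gram' bil_commute[of d k4 k3] r_def[symmetric] s_def[symmetric])
      (simp_all add: algebra_simps)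
  moreover have "zbasis6 v1 v2 k3' k4' (f + 0 *s v2) w'"
    unfolding k3'_def k4'_def w'_def by (rule zbasis6_transform[OF basis])
  then have "pre_frame d a v1 v2 k3' k4' f w'"
    unfolding pre_frame_def unfolding k3'_def k4'_def w'_def by (simp add: gram')
  ultimately show ?thesis using that by blast
qed

end

text \<open>As \<open>(u2, u5) = 1\<close>, multiples of \<open>u2\<close> remove the pairings with
  \<open>u5\<close>. For the norm of \<open>u5\<close> half its value is used, an integer because
  the lattice is even.\<close>

lemma pre_frame_exists:
  assumes b: "zbasis6 u1 u2 u3 u4 u5 u6"
    and g: "bil d u1 u1 = 0" "bil d u1 u2 = 0" "bil d u2 u2 = 0" "bil d u1 u3 = 0" "bil d u1 u4 = 0"
      "bil d u2 u3 = 0" "bil d u2 u4 = 0" "bil d u1 u5 = 0" "bil d u1 u6 = int a" "bil d u2 u5 = 1" "bil d u2 u6 = 0"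
  obtains k3 k4 f w where "pre_frame d a u1 u2 k3 k4 f w"
proof -
  obtain q where q: "bil d u5 u5 = 2 * q" using bil_self_even[of d u5] by (elim evenE)
  have "zbasis6 u1 u2 (u3 + 0 *s u1 + (- bil d u3 u5) *s u2) (u4 + 0 *s u1 + (- bil d u4 u5) *s u2)
    (u5 + (- q) *s u2) (u6 + (- bil d u5 u6) *s u2 + 0 *s u3 + 0 *s u4)"
    by (rule zbasis6_transform[OF b])
  then have "pre_frame d a u1 u2 (u3 + 0 *s u1 + (- bil d u3 u5) *s u2) (u4 + 0 *s u1 + (- bil d u4 u5) *s u2)
    (u5 + (- q) *s u2) (u6 + (- bil d u5 u6) *s u2 + 0 *s u3 + 0 *s u4)"
    unfolding pre_frame_def using g q
    by (simp add: bil_commute[of d u2 u1] bil_commute[of d u5 u2] bil_commute[of d u5 u3] bil_commute[of d u5 u4])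
  then show ?thesis by (rule that)
qed

section \<open>From the basis of the type to an orthogonal frame\<close>

definition rvec :: "int ^ 6 \<Rightarrow> real ^ 6" where
  "rvec x = (\<chi> i. of_int (x $ i))"

lemma rvec_simps [simp]:
  "rvec (x + y) = rvec x + rvec y" "rvec (c *s x) = of_int c *\<^sub>R rvec x" "rvec 0 = 0"
  by (simp_all add: rvec_def vec_eq_iff)

lemma rvec_eq_iff [simp]: "rvec x = rvec y \<longleftrightarrow> x = y"
  by (simp add: rvec_def vec_eq_iff)

lemma bil_rvec [simp]: "bil d (rvec x) (rvec y) = of_int (bil d x y)"
  by (simp add: rvec_def bil_def)

lemma latt_rvec: "latt = range rvec"
proof -
  have "\<exists>y. x = rvec y" if "x \<in> latt" for x
    using that by (intro exI[of _ "\<chi> i. \<lfloor>x $ i\<rfloor>"]) (simp add: latt_def rvec_def vec_eq_iff)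
  moreover have "rvec y \<in> latt" for y by (simp add: latt_def rvec_def)
  ultimately show ?thesis by auto
qed

lemma is_Z_basis_eq:
  "is_Z_basis v I M \<Longrightarrow> M = {(\<Sum>i\<in>I. of_int (c i) *\<^sub>R v i) | c :: nat \<Rightarrow> int. True}"
  unfolding is_Z_basis_def by (elim conjE)

lemma is_Z_basis_mem:
  assumes "is_Z_basis v I M" "i \<in> I"
  shows "v i \<in> M"
proof -
  have "finite I" using assms by (simp add: is_Z_basis_def)
  then have "v i = (\<Sum>j\<in>I. if j = i then v j else 0)"
    using assms(2) by (simp add: sum.delta')
  also have "\<dots> = (\<Sum>j\<in>I. of_int (if j = i then 1 else 0) *\<^sub>R v j)"
    by (intro sum.cong) auto
  also have "\<dots> \<in> {(\<Sum>i\<in>I. of_int (c i) *\<^sub>R v i) | c :: nat \<Rightarrow> int. True}"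
    by (intro CollectI exI[of _ "\<lambda>j. if j = i then 1 else 0"] conjI refl TrueI)
  finally show ?thesis unfolding is_Z_basis_eq[OF assms(1)] .
qed

lemma sum_1_to_6: "(\<Sum>i\<in>{1..6::nat}. g i) = g 1 + g 2 + g 3 + g 4 + g 5 + (g 6 :: 'a::comm_monoid_add)"
proof -
  have "{1..6::nat} = {1, 2, 3, 4, 5, 6}" by auto
  then show ?thesis by (simp add: ac_simps)
qed

lemma is_Z_basis_zbasis6:
  assumes b: "is_Z_basis v {1..6} latt"
    and u: "v 1 = rvec u1" "v 2 = rvec u2" "v 3 = rvec u3" "v 4 = rvec u4" "v 5 = rvec u5" "v 6 = rvec u6"
  shows "zbasis6 u1 u2 u3 u4 u5 u6"
  unfolding zbasis6_def
proof (intro conjI allI impI)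
  fix x
  have "rvec x \<in> latt" by (simp add: latt_rvec)
  then obtain c :: "nat \<Rightarrow> int" where "rvec x = (\<Sum>i\<in>{1..6}. of_int (c i) *\<^sub>R v i)"
    unfolding is_Z_basis_eq[OF b] by (elim CollectE exE conjE) (rule that)
  then have "rvec x = rvec (c 1 *s u1 + c 2 *s u2 + c 3 *s u3 + c 4 *s u4 + c 5 *s u5 + c 6 *s u6)"
    unfolding sum_1_to_6 u by simp
  then show "\<exists>c1 c2 c3 c4 c5 c6. x = c1 *s u1 + c2 *s u2 + c3 *s u3 + c4 *s u4 + c5 *s u5 + c6 *s u6"
    unfolding rvec_eq_iff by (intro exI)
next
  fix c1 c2 c3 c4 c5 c6
  assume *: "c1 *s u1 + c2 *s u2 + c3 *s u3 + c4 *s u4 + c5 *s u5 + c6 *s u6 = 0"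
  define c :: "nat \<Rightarrow> int" where
    "c = (\<lambda>i. if i = 1 then c1 else if i = 2 then c2 else if i = 3 then c3 else if i = 4 then c4
       else if i = 5 then c5 else c6)"
  have "(\<Sum>i\<in>{1..6}. of_int (c i) *\<^sub>R v i) = rvec (c1 *s u1 + c2 *s u2 + c3 *s u3 + c4 *s u4 + c5 *s u5 + c6 *s u6)"
    unfolding sum_1_to_6 u by (simp add: c_def)
  then have "(\<Sum>i\<in>{1..6}. of_int (c i) *\<^sub>R v i) = 0" unfolding * by simp
  then have all: "\<forall>i\<in>{1..6}. c i = 0"
    using b unfolding is_Z_basis_def by (elim conjE allE[of _ c] impE)
  have "c 1 = 0" "c 2 = 0" "c 3 = 0" "c 4 = 0" "c 5 = 0" "c 6 = 0"
    by (rule all[rule_format], simp)+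
  then show "c1 = 0" "c2 = 0" "c3 = 0" "c4 = 0" "c5 = 0" "c6 = 0" by (simp_all add: c_def)
qed

text \<open>
  The basis \<open>v1, \<dots>, v6\<close> of the type of \<open>E\<close> is normalised so that \<open>\<langle>v1, v2, v5, v6\<rangle>\<close> becomes an orthogonal
  summand; \<open>f\<close> and \<open>w\<close> stand for \<open>v5\<close> and \<open>v6\<close>.
\<close>

locale frame =
  fixes d a :: nat and E :: "(real ^ 6) set" and v1 v2 k3 k4 f w :: "real ^ 6" and m :: int
  assumes a_pos: "a > 0"
    and E_eq: "E = {of_int i *\<^sub>R v1 + of_int j *\<^sub>R v2 | i j. True}"
    and latt_eq: "latt = {of_int c1 *\<^sub>R v1 + of_int c2 *\<^sub>R v2 + of_int c3 *\<^sub>R k3 + of_int c4 *\<^sub>R k4 +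
          of_int c5 *\<^sub>R f + of_int c6 *\<^sub>R w | c1 c2 c3 c4 c5 c6. True}"
    and primitive: "\<And>x n. x \<in> latt \<Longrightarrow> n \<noteq> 0 \<Longrightarrow> of_int n *\<^sub>R x \<in> E \<Longrightarrow> x \<in> E"
    and gram:
      "bil d v1 v1 = 0" "bil d v1 v2 = 0" "bil d v2 v2 = 0"
      "bil d v1 k3 = 0" "bil d v1 k4 = 0" "bil d v2 k3 = 0" "bil d v2 k4 = 0"
      "bil d v1 f = 0" "bil d v1 w = real a" "bil d v2 f = 1" "bil d v2 w = 0"
      "bil d f f = 0" "bil d f k3 = 0" "bil d f k4 = 0" "bil d f w = 0"
      "bil d k3 w = 0" "bil d k4 w = 0" "bil d w w = 2 * of_int m"

lemma frame_exists:
  assumes p: "prime p" "p > 3"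
    and prim: "primitive_isotropic_rank2 (p\<^sup>2) E"
    and type: "of_type (p\<^sup>2) p E a"
  obtains v1 v2 k3 k4 f w m where "frame (p\<^sup>2) a E v1 v2 k3 k4 f w m"
proof -
  from type obtain v where a: "a \<in> {1, 2, p, 2 * p}" and bL: "is_Z_basis v {1..6} latt"
    and bE: "is_Z_basis v {1..2} E" and bP: "is_Z_basis v {1..4} (perp (p\<^sup>2) E)"
    and g: "bil (p\<^sup>2) (v 1) (v 5) = 0" "bil (p\<^sup>2) (v 1) (v 6) = of_nat a"
      "bil (p\<^sup>2) (v 2) (v 5) = 1" "bil (p\<^sup>2) (v 2) (v 6) = 0"
    unfolding of_type_def by (elim conjE exE) (rule that)
  have "v i \<in> range rvec" if "i \<in> {1..6}" for i
    using is_Z_basis_mem[OF bL that] unfolding latt_rvec .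
  then have "\<exists>u. v i = rvec u" if "i \<in> {1..6}" for i using that by blast
  then obtain u where u: "\<And>i. i \<in> {1..6} \<Longrightarrow> v i = rvec (u i)" by metis
  have u': "v 1 = rvec (u 1)" "v 2 = rvec (u 2)" "v 3 = rvec (u 3)" "v 4 = rvec (u 4)" "v 5 = rvec (u 5)" "v 6 = rvec (u 6)"
    by (simp_all add: u)
  have E12: "v 1 \<in> E" "v 2 \<in> E" by (auto intro: is_Z_basis_mem[OF bE])
  have P34: "v 3 \<in> perp (p\<^sup>2) E" "v 4 \<in> perp (p\<^sup>2) E" by (auto intro: is_Z_basis_mem[OF bP])
  have "\<forall>x\<in>E. \<forall>y\<in>E. bil (p\<^sup>2) x y = 0"
    using prim unfolding primitive_isotropic_rank2_def by (elim conjE)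
  then have iso: "bil (p\<^sup>2) x y = 0" if "x \<in> E" "y \<in> E" for x y using that by simp
  have perp: "bil (p\<^sup>2) x y = 0" if "x \<in> E" "y \<in> perp (p\<^sup>2) E" for x y
    using that unfolding perp_def by (simp add: bil_commute[of _ x y])
  have "bil (p\<^sup>2) (u 1) (u 1) = 0" "bil (p\<^sup>2) (u 1) (u 2) = 0" "bil (p\<^sup>2) (u 2) (u 2) = 0"
    "bil (p\<^sup>2) (u 1) (u 3) = 0" "bil (p\<^sup>2) (u 1) (u 4) = 0" "bil (p\<^sup>2) (u 2) (u 3) = 0" "bil (p\<^sup>2) (u 2) (u 4) = 0"
    "bil (p\<^sup>2) (u 1) (u 5) = 0" "bil (p\<^sup>2) (u 1) (u 6) = int a" "bil (p\<^sup>2) (u 2) (u 5) = 1" "bil (p\<^sup>2) (u 2) (u 6) = 0"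
  proof -
    show "bil (p\<^sup>2) (u 1) (u 1) = 0" using iso[OF E12(1) E12(1)] by (simp only: u' bil_rvec of_int_eq_0_iff)
    show "bil (p\<^sup>2) (u 1) (u 2) = 0" using iso[OF E12(1) E12(2)] by (simp only: u' bil_rvec of_int_eq_0_iff)
    show "bil (p\<^sup>2) (u 2) (u 2) = 0" using iso[OF E12(2) E12(2)] by (simp only: u' bil_rvec of_int_eq_0_iff)
    show "bil (p\<^sup>2) (u 1) (u 3) = 0" using perp[OF E12(1) P34(1)] by (simp only: u' bil_rvec of_int_eq_0_iff)
    show "bil (p\<^sup>2) (u 1) (u 4) = 0" using perp[OF E12(1) P34(2)] by (simp only: u' bil_rvec of_int_eq_0_iff)
    show "bil (p\<^sup>2) (u 2) (u 3) = 0" using perp[OF E12(2) P34(1)] by (simp only: u' bil_rvec of_int_eq_0_iff)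
    show "bil (p\<^sup>2) (u 2) (u 4) = 0" using perp[OF E12(2) P34(2)] by (simp only: u' bil_rvec of_int_eq_0_iff)
    show "bil (p\<^sup>2) (u 1) (u 5) = 0" using g(1) by (simp only: u' bil_rvec of_int_eq_0_iff)
    show "bil (p\<^sup>2) (u 1) (u 6) = int a" using g(2) unfolding u' bil_rvec by linarith
    show "bil (p\<^sup>2) (u 2) (u 5) = 1" using g(3) unfolding u' bil_rvec by linarith
    show "bil (p\<^sup>2) (u 2) (u 6) = 0" using g(4) by (simp only: u' bil_rvec of_int_eq_0_iff)
  qed
  from pre_frame_exists[OF is_Z_basis_zbasis6[OF bL u'] this]
  obtain k3 k4 f w where "pre_frame (p\<^sup>2) a (u 1) (u 2) k3 k4 f w" .
  then interpret pre_frame "p\<^sup>2" a "u 1" "u 2" k3 k4 f w .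
  have odd_p: "odd p" using p by (simp add: prime_odd_nat)
  have dp: "coprime disc (int p)" if "a = p * a'" "coprime a' p" for a'
  proof -
    have "prime (int p)" using p by simp
    moreover have "\<not> int p dvd disc" using disc_not_dvd_p[OF p refl that] .
    ultimately show ?thesis by (metis coprime_commute prime_imp_coprime)
  qed
  have d2: "coprime disc 2" if "a = 2 * a'" "odd a'" for a'
    using disc_odd[OF _ that] odd_p by simp
  have "coprime disc (int a)"
  proof -
    consider "a = 1" | "a = 2" | "a = p" | "a = 2 * p" using a by blast
    then show ?thesis
    proof cases
      case 1 then show ?thesis by simp
    next
      case 2 then show ?thesis using d2[of 1] by simp
    next
      case 3 then show ?thesis using dp[of 1] by simp
    next
      case 4
      then have "coprime disc 2" "coprime disc (int p)"
        using d2[of p] dp[of 2] odd_p by (simp_all add: mult.commute)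
      then show ?thesis using 4 by (simp add: coprime_mult_right_iff)
    qed
  qed
  then obtain k3' k4' w' where "pre_frame (p\<^sup>2) a (u 1) (u 2) k3' k4' f w'"
    and kw: "bil (p\<^sup>2) k3' w' = 0" "bil (p\<^sup>2) k4' w' = 0" by (rule decouple)
  then interpret F: pre_frame "p\<^sup>2" a "u 1" "u 2" k3' k4' f w' by simp
  obtain m where m: "bil (p\<^sup>2) w' w' = 2 * m" using bil_self_even[of "p\<^sup>2" w'] by (elim evenE)
  have "frame (p\<^sup>2) a E (v 1) (v 2) (rvec k3') (rvec k4') (rvec f) (rvec w') m"
  proof
    show "a > 0" using a p by auto
    show "E = {of_int i *\<^sub>R v 1 + of_int j *\<^sub>R v 2 | i j. True}"
    proof -
      have "{1..2::nat} = {1, 2}" by auto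
      then have s: "(\<Sum>i\<in>{1..2}. of_int (c i) *\<^sub>R v i) = of_int (c 1) *\<^sub>R v 1 + of_int (c 2) *\<^sub>R v 2"
        for c :: "nat \<Rightarrow> int" by simp
      have "E = {(\<Sum>i\<in>{1..2}. of_int (c i) *\<^sub>R v i) | c :: nat \<Rightarrow> int. True}"
        by (rule is_Z_basis_eq[OF bE])
      also have "\<dots> = {of_int i *\<^sub>R v 1 + of_int j *\<^sub>R v 2 | i j. True}"
        unfolding s
      proof (intro Collect_cong iffI; elim exE conjE)
        fix x i j assume "x = of_int i *\<^sub>R v 1 + of_int j *\<^sub>R v 2"
        then show "\<exists>c :: nat \<Rightarrow> int. x = of_int (c 1) *\<^sub>R v 1 + of_int (c 2) *\<^sub>R v 2 \<and> True"
          by (intro exI[of _ "\<lambda>n::nat. if n = 1 then i else j"]) simp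
      qed blast
      finally show ?thesis .
    qed
    show "latt = {of_int c1 *\<^sub>R v 1 + of_int c2 *\<^sub>R v 2 + of_int c3 *\<^sub>R rvec k3' + of_int c4 *\<^sub>R rvec k4' +
          of_int c5 *\<^sub>R rvec f + of_int c6 *\<^sub>R rvec w' | c1 c2 c3 c4 c5 c6. True}"
    proof (intro equalityI subsetI)
      fix x assume "x \<in> latt"
      then obtain y where y: "x = rvec y" unfolding latt_rvec by blast
      obtain c1 c2 c3 c4 c5 c6 where "y = c1 *s u 1 + c2 *s u 2 + c3 *s k3' + c4 *s k4' + c5 *s f + c6 *s w'"
        using zbasis6_expand[OF F.basis] .
      then have "x = of_int c1 *\<^sub>R v 1 + of_int c2 *\<^sub>R v 2 + of_int c3 *\<^sub>R rvec k3' + of_int c4 *\<^sub>R rvec k4' +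
          of_int c5 *\<^sub>R rvec f + of_int c6 *\<^sub>R rvec w'" unfolding y u' by simp
      then show "x \<in> {of_int c1 *\<^sub>R v 1 + of_int c2 *\<^sub>R v 2 + of_int c3 *\<^sub>R rvec k3' + of_int c4 *\<^sub>R rvec k4' +
          of_int c5 *\<^sub>R rvec f + of_int c6 *\<^sub>R rvec w' | c1 c2 c3 c4 c5 c6. True}"
        by (intro CollectI exI conjI TrueI)
    next
      fix x assume "x \<in> {of_int c1 *\<^sub>R v 1 + of_int c2 *\<^sub>R v 2 + of_int c3 *\<^sub>R rvec k3' + of_int c4 *\<^sub>R rvec k4' +
          of_int c5 *\<^sub>R rvec f + of_int c6 *\<^sub>R rvec w' | c1 c2 c3 c4 c5 c6. True}"
      moreover have "rvec y \<in> latt" for y by (simp add: latt_rvec)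
      ultimately show "x \<in> latt" unfolding u'
        by (elim CollectE exE conjE) (simp only:, intro latt_simps Ints_of_int)
    qed
    have "\<forall>x\<in>latt. \<forall>n::int. n \<noteq> 0 \<and> of_int n *\<^sub>R x \<in> E \<longrightarrow> x \<in> E"
      using prim unfolding primitive_isotropic_rank2_def by (elim conjE)
    then show "x \<in> E" if "x \<in> latt" "n \<noteq> 0" "of_int n *\<^sub>R x \<in> E" for x and n :: int
      using that by (elim ballE[of _ _ x] allE[of _ n] impE) simp_all
  qed (simp_all only: u' bil_rvec F.gram kw m of_int_0 of_int_1 of_int_of_nat_eq of_int_mult of_int_numeral)
  then show ?thesis by (rule that)
qed

section \<open>The boundary component\<close>

lemma openin_proj_top_vimage:
  assumes "openin proj_top T"
  shows "open {x. x \<noteq> 0 \<and> line x \<in> T}"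
proof -
  have "openin (top_of_set (- {0})) {x \<in> - {0}. line x \<in> T}"
    using assms unfolding proj_top_def openin_quot_topology by simp
  then have "open {x \<in> - {0}. line x \<in> T}"
    by (rule openin_open_trans) (intro open_Compl closed_singleton)
  then show ?thesis by simp
qed

lemma line_in_half_period_D:
  assumes "line x \<in> half_period d s"
  shows "period_vec d x" "0 < s * orient x"
proof -
  obtain y where y: "line y = line x" "period_vec d y" using assms unfolding half_period_def by blast
  then obtain c where "y = c *s x" using line_eqD[OF y(1)] by (auto simp: period_vec_def)
  then have "x \<noteq> 0" using y(2) by (auto simp: period_vec_def)
  then show "period_vec d x" "0 < s * orient x" using assms line_in_half_period_iff by auto
qed

context frame
begin

lemmas gram_sym = gram(2)[unfolded bil_commute[of d v1]] gram(4)[unfolded bil_commute[of d v1]]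
  gram(5)[unfolded bil_commute[of d v1]] gram(6)[unfolded bil_commute[of d v2]]
  gram(7)[unfolded bil_commute[of d v2]] gram(8)[unfolded bil_commute[of d v1]]
  gram(9)[unfolded bil_commute[of d v1]] gram(10)[unfolded bil_commute[of d v2]]
  gram(11)[unfolded bil_commute[of d v2]] gram(13)[unfolded bil_commute[of d f]]
  gram(14)[unfolded bil_commute[of d f]] gram(15)[unfolded bil_commute[of d f]]
  gram(16)[unfolded bil_commute[of d k3]] gram(17)[unfolded bil_commute[of d k4]]

lemmas gram_all = gram gram_sym

text \<open>The isotropic vector dual to \<open>v1\<close> over the reals: \<open>v1\<close>,
  \<open>f1\<close> and \<open>v2\<close>, \<open>f\<close> span orthogonal hyperbolic planes. It
  need not be integral.\<close>

definition f1 :: "real ^ 6" where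
  "f1 = (1 / real a) *\<^sub>R w - (of_int m / (real a)\<^sup>2) *\<^sub>R v1"

lemma f1_gram:
  "bil d v1 f1 = 1" "bil d v2 f1 = 0" "bil d f f1 = 0" "bil d f1 f1 = 0" "bil d k3 f1 = 0" "bil d k4 f1 = 0"
  "bil d f1 v1 = 1" "bil d f1 v2 = 0" "bil d f1 f = 0" "bil d f1 k3 = 0" "bil d f1 k4 = 0"
  using a_pos by (simp_all add: f1_def gram_all power2_eq_square)

lemma w_eq: "w = real a *\<^sub>R f1 + (of_int m / real a) *\<^sub>R v1"
  using a_pos by (simp add: f1_def vec_eq_iff field_simps power2_eq_square)

lemma v_latt: "v1 \<in> latt" "v2 \<in> latt" "k3 \<in> latt" "k4 \<in> latt" "f \<in> latt" "w \<in> latt"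
proof -
  have "of_int c1 *\<^sub>R v1 + of_int c2 *\<^sub>R v2 + of_int c3 *\<^sub>R k3 + of_int c4 *\<^sub>R k4 +
      of_int c5 *\<^sub>R f + of_int c6 *\<^sub>R w \<in> latt" for c1 c2 c3 c4 c5 c6
    unfolding latt_eq by (intro CollectI exI conjI TrueI) (rule refl)
  from this[of 1 0 0 0 0 0] this[of 0 1 0 0 0 0] this[of 0 0 1 0 0 0] this[of 0 0 0 1 0 0]
    this[of 0 0 0 0 1 0] this[of 0 0 0 0 0 1]
  show "v1 \<in> latt" "v2 \<in> latt" "k3 \<in> latt" "k4 \<in> latt" "f \<in> latt" "w \<in> latt" by simp_all
qed

lemma E_mem: "of_int i *\<^sub>R v1 + of_int j *\<^sub>R v2 \<in> E"
  unfolding E_eq by (intro CollectI exI conjI TrueI) (rule refl)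

lemma v_E: "v1 \<in> E" "v2 \<in> E"
  using E_mem[of 1 0] E_mem[of 0 1] by simp_all

lemma E_cases:
  assumes "x \<in> E"
  obtains i j where "x = of_int i *\<^sub>R v1 + of_int j *\<^sub>R v2"
  using assms unfolding E_eq by (elim CollectE exE conjE) (rule that)

lemma latt_cases:
  assumes "x \<in> latt"
  obtains c1 c2 c3 c4 c5 c6 where "x = of_int c1 *\<^sub>R v1 + of_int c2 *\<^sub>R v2 + of_int c3 *\<^sub>R k3 + of_int c4 *\<^sub>R k4 +
      of_int c5 *\<^sub>R f + of_int c6 *\<^sub>R w"
  using assms unfolding latt_eq by (elim CollectE exE conjE) (rule that)

definition evec :: "complex \<Rightarrow> complex \<Rightarrow> complex ^ 6" where
  "evec x y = x *s cplx_vec v1 + y *s cplx_vec v2"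

lemma tensor_E: "tensor_C E = {evec x y | x y. True}"
proof (rule subset_antisym)
  have "vec.subspace {evec x y | x y. True}"
    unfolding vec.subspace_def
  proof (intro conjI ballI allI)
    show "0 \<in> {evec x y |x y. True}"
      by (intro CollectI exI[of _ 0]) (simp add: evec_def)
  next
    fix u v assume "u \<in> {evec x y |x y. True}" "v \<in> {evec x y |x y. True}"
    then obtain x y x' y' where "u = evec x y" "v = evec x' y'" by blast
    then have "u + v = evec (x + x') (y + y')" by (simp add: evec_def vec_eq_iff algebra_simps)
    then show "u + v \<in> {evec x y |x y. True}" by blast
  next
    fix c u assume "u \<in> {evec x y |x y. True}"
    then obtain x y where "u = evec x y" by blast
    then have "c *s u = evec (c * x) (c * y)" by (simp add: evec_def vec_eq_iff algebra_simps)
    then show "c *s u \<in> {evec x y |x y. True}" by blast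
  qed
  moreover have "cplx_vec ` E \<subseteq> {evec x y | x y. True}"
  proof
    fix u assume "u \<in> cplx_vec ` E"
    then obtain i j where "u = cplx_vec (of_int i *\<^sub>R v1 + of_int j *\<^sub>R v2)" by (auto elim: E_cases)
    then have "u = evec (of_int i) (of_int j)" by (simp add: evec_def)
    then show "u \<in> {evec x y | x y. True}" by blast
  qed
  ultimately show "tensor_C E \<subseteq> {evec x y | x y. True}"
    unfolding tensor_C_def by (intro vec.span_minimal)
next
  show "{evec x y | x y. True} \<subseteq> tensor_C E"
    unfolding tensor_C_def evec_def using v_E
    by (clarify, intro vec.span_add vec.span_scale vec.span_base imageI)
qed

lemma evec_coords: "bil d (evec x y) (cplx_vec w) = of_nat a * x" "bil d (evec x y) (cplx_vec f) = y"
  by (simp_all add: evec_def gram_all)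

lemma evec_eq_0_iff: "evec x y = 0 \<longleftrightarrow> x = 0 \<and> y = 0"
proof
  assume "evec x y = 0"
  then show "x = 0 \<and> y = 0" using evec_coords[of x y] a_pos by simp
qed (simp add: evec_def)

lemma evec_smult: "c *s evec x y = evec (c * x) (c * y)"
  by (simp add: evec_def vec_eq_iff algebra_simps)

lemma line_evec_eq:
  assumes "x \<noteq> 0"
  shows "line (evec x y) = line (evec 1 (y / x))"
  using line_smult[OF assms, of "evec 1 (y / x)"] assms by (simp add: evec_smult)

text \<open>Determinant of the projection of \<open>v1\<close>, \<open>v2\<close> to the positive
  definite plane in the coordinates of \<open>orient\<close>; its sign compares the two
  orientations.\<close>

definition kap :: real where
  "kap = (v1 $ 1 + v1 $ 2) * (v2 $ 3 + v2 $ 4) - (v1 $ 3 + v1 $ 4) * (v2 $ 1 + v2 $ 2)"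

lemma orient_evec: "orient (evec x y) = kap * Im (y * cnj x)"
  by (simp add: orient_def evec_def kap_def algebra_simps)

text \<open>\<open>E\<close> meets the negative definite complement of \<open>\<langle>e\<^sub>1 + e\<^sub>2, e\<^sub>3 + e\<^sub>4\<rangle>\<close> trivially.\<close>

lemma kap_nonzero:
  assumes "d > 0"
  shows "kap \<noteq> 0"
proof
  assume k: "kap = 0"
  define A1 A2 B1 B2 where "A1 = v1 $ 1 + v1 $ 2" and "A2 = v2 $ 1 + v2 $ 2" and "B1 = v1 $ 3 + v1 $ 4" and "B2 = v2 $ 3 + v2 $ 4"
  have zero: "s = 0 \<and> t = 0" if "s * A1 + t * A2 = 0" "s * B1 + t * B2 = 0" for s t
  proof -
    define x where "x = s *\<^sub>R v1 + t *\<^sub>R v2"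
    have x2: "x $ 2 = - x $ 1" and x4: "x $ 4 = - x $ 3"
      using that by (simp_all add: x_def A1_def A2_def B1_def B2_def algebra_simps)
    have "bil d x x = 0" by (simp add: x_def gram_all)
    then have "2 * (x $ 1)\<^sup>2 + 2 * (x $ 3)\<^sup>2 + 2 * (real d * (x $ 5)\<^sup>2) + 6 * (x $ 6)\<^sup>2 = 0"
      by (simp add: bil_def x2 x4 power2_eq_square)
    moreover have "0 \<le> (x $ 1)\<^sup>2" "0 \<le> (x $ 3)\<^sup>2" "0 \<le> real d * (x $ 5)\<^sup>2" "0 \<le> (x $ 6)\<^sup>2" by simp_all
    ultimately have "(x $ 1)\<^sup>2 = 0 \<and> (x $ 3)\<^sup>2 = 0 \<and> real d * (x $ 5)\<^sup>2 = 0 \<and> (x $ 6)\<^sup>2 = 0"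
      by linarith
    then have "x = 0" using assms by (simp add: vec6_eq_iff x2 x4)
    then have "bil d x w = 0" "bil d x f = 0" by simp_all
    then show ?thesis using a_pos by (simp add: x_def gram_all)
  qed
  have k': "A1 * B2 = B1 * A2" using k by (simp add: kap_def A1_def A2_def B1_def B2_def)
  have "A2 = 0 \<and> - A1 = 0" by (rule zero) (use k' in \<open>simp_all add: algebra_simps\<close>)
  then have "B2 = 0 \<and> - B1 = 0" by (intro zero) (use k' in \<open>simp_all add: algebra_simps\<close>)
  with \<open>A2 = 0 \<and> - A1 = 0\<close> zero[of 1 0] show False by simp
qed

text \<open>
  The increment is chosen so that the new vector \<open>z\<close> satisfies \<open>(z, z) = 0\<close> and
  \<open>(z, cnj z) = 4 e \<bar>Im (y cnj x)\<bar>\<close>.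
\<close>

definition nudge :: "complex \<Rightarrow> complex \<Rightarrow> real \<Rightarrow> complex ^ 6" where
  "nudge x y e = evec x y +
     e *\<^sub>R (let t = \<i> * of_real (sgn (Im (y * cnj x))) in (- y * t) *s cplx_vec f1 + (x * t) *s cplx_vec f)"

lemma nudge_period:
  assumes "Im (y * cnj x) \<noteq> 0" "e > 0"
  shows "period_vec d (nudge x y e)"
proof -
  define t where "t = \<i> * of_real (sgn (Im (y * cnj x)))"
  have n: "nudge x y e = x *s cplx_vec v1 + y *s cplx_vec v2 + (of_real e * (- y * t)) *s cplx_vec f1 +
      (of_real e * (x * t)) *s cplx_vec f"
    unfolding nudge_def evec_def Let_def t_def[symmetric] vec_eq_iff
    by (simp add: scaleR_conv_of_real[where 'a = complex] algebra_simps)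
  have 1: "bil d (nudge x y e) (nudge x y e) = 0"
    unfolding n by (simp add: gram_all f1_gram algebra_simps)
  have "bil d (nudge x y e) (cnj_vec (nudge x y e)) =
      of_real e * (x * cnj (- y * t) + y * cnj (x * t) + (- y * t) * cnj x + (x * t) * cnj y)"
    unfolding n by (simp add: gram_all f1_gram algebra_simps)
  also have "\<dots> = of_real (4 * e * (Im (y * cnj x) * sgn (Im (y * cnj x))))"
    by (simp add: t_def complex_eq_iff algebra_simps)
  also have "Im (y * cnj x) * sgn (Im (y * cnj x)) = \<bar>Im (y * cnj x)\<bar>"
    by (rule abs_sgn[symmetric])
  finally have 2: "0 < Re (bil d (nudge x y e) (cnj_vec (nudge x y e)))"
    using assms by simp
  then have "nudge x y e \<noteq> 0" by (auto simp: bil_def)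
  with 1 2 show ?thesis by (simp add: period_vec_def)
qed

lemma nudge_tendsto: "(nudge x y \<longlongrightarrow> evec x y) (at_right 0)"
  unfolding nudge_def by (auto intro!: tendsto_eq_intros)

definition half_line :: "real \<Rightarrow> (complex ^ 6) set set" where
  "half_line s = {line (evec 1 z) | z. 0 < s * Im z}"

text \<open>The sign of \<open>orient\<close> is an open condition, so limits of the component
  cannot lie on the opposite side; conversely \<open>nudge\<close> approaches every point of the
  right side from inside.\<close>

lemma bdry_points_half:
  assumes s: "s = 1 \<or> s = -1" and d: "d > 0"
  shows "bdry_points d (half_period d s) E = half_line (s * kap)"
proof (intro subset_antisym subsetI)
  fix l assume l: "l \<in> bdry_points d (half_period d s) E"
  let ?X = "subtopology proj_top (compact_dual d)"
  from l obtain u where u: "u \<in> tensor_C E" "u \<noteq> 0" "l = line u"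
    and cl: "l \<in> ?X closure_of (half_period d s)" and nr: "l \<notin> {line (cplx_vec x) | x. x \<noteq> 0}"
    unfolding bdry_points_def by (elim DiffE IntE CollectE exE conjE) (rule that)
  obtain x y where xy: "u = evec x y" using u(1) unfolding tensor_E by blast
  \<comment> \<open>A vanishing first coordinate means the real point \<open>[v2]\<close>, which has
    been removed.\<close>
  have x0: "x \<noteq> 0"
  proof
    assume "x = 0"
    then have "y \<noteq> 0" using u(2) xy evec_eq_0_iff by auto
    then have "l = line (cplx_vec v2)"
      unfolding u(3) xy \<open>x = 0\<close> evec_def using line_smult[of y "cplx_vec v2"] by simp
    moreover have "v2 \<noteq> 0" using evec_eq_0_iff[of 0 1] by (simp add: evec_def)
    ultimately show False using nr by blast
  qed
  define z where "z = y / x"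
  have lz: "l = line (evec 1 z)" unfolding u(3) xy z_def by (rule line_evec_eq[OF x0])
  have ez: "evec 1 z \<noteq> 0" by (simp add: evec_eq_0_iff)
  have "Im z \<noteq> 0"
  proof
    assume "Im z = 0"
    then have ev: "evec 1 z = cplx_vec (v1 + Re z *\<^sub>R v2)"
      by (simp add: evec_def complex_is_Real_iff complex_eq_iff vec_eq_iff)
    then have "l = line (cplx_vec (v1 + Re z *\<^sub>R v2))" using lz by (simp only:)
    moreover have "v1 + Re z *\<^sub>R v2 \<noteq> 0" using ez unfolding ev by (simp only: cplx_vec_eq_0_iff not_False_eq_True)
    ultimately show False using nr by blast
  qed
  then have "s * kap * Im z \<noteq> 0" using s kap_nonzero[OF d] by auto
  moreover have "\<not> s * kap * Im z < 0"
  proof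
    assume neg: "s * kap * Im z < 0"
    let ?T = "line ` {x. 0 < - s * orient x}"
    have "openin proj_top ?T" by (rule openin_proj_top_cone[OF cone_orient open_orient])
    then have "openin ?X (compact_dual d \<inter> ?T)" by (auto simp: openin_subtopology)
    moreover have "l \<in> ?T" unfolding lz
      using neg by (intro imageI) (simp add: orient_evec mult.assoc)
    moreover have "l \<in> compact_dual d"
      using cl by (auto simp: in_closure_of)
    ultimately have "l \<in> compact_dual d \<inter> ?T \<and> openin ?X (compact_dual d \<inter> ?T)" by (intro conjI IntI)
    with cl have "\<exists>l'. l' \<in> half_period d s \<and> l' \<in> compact_dual d \<inter> ?T"
      unfolding in_closure_of by (elim conjE allE[of _ "compact_dual d \<inter> ?T"] impE) (simp only: simp_thms)
    then obtain l' where l': "l' \<in> half_period d s" "l' \<in> ?T" by (elim exE conjE IntE) (rule that)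
    then obtain x' where x': "l' = line x'" "0 < - s * orient x'" by blast
    then show False using line_in_half_period_D(2)[of x' d s] l'(1) by simp
  qed
  ultimately have "0 < s * kap * Im z" by linarith
  then show "l \<in> half_line (s * kap)" unfolding half_line_def lz by blast
next
  fix l assume "l \<in> half_line (s * kap)"
  then obtain z where z: "l = line (evec 1 z)" "0 < s * kap * Im z" unfolding half_line_def by auto
  let ?X = "subtopology proj_top (compact_dual d)"
  have ez: "evec 1 z \<noteq> 0" by (simp add: evec_eq_0_iff)
  have Imz: "Im z \<noteq> 0" using z(2) by auto
  have "bil d (evec 1 z) (evec 1 z) = 0" by (simp add: evec_def gram_all)
  then have lc: "l \<in> compact_dual d" unfolding compact_dual_def z(1) using ez by blast
  have "l \<in> ?X closure_of (half_period d s)"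
    unfolding in_closure_of
  proof (intro conjI allI impI)
    show "l \<in> topspace ?X"
      using lc ez unfolding topspace_subtopology topspace_proj_top z(1) by blast
  next
    fix T assume T: "l \<in> T \<and> openin ?X T"
    then obtain T' where T': "openin proj_top T'" "T = T' \<inter> compact_dual d"
      by (auto simp: openin_subtopology)
    let ?W = "{x. x \<noteq> 0 \<and> line x \<in> T'} \<inter> {x. 0 < s * orient x}"
    have "open ?W" by (intro open_Int openin_proj_top_vimage[OF T'(1)] open_orient)
    moreover have "evec 1 z \<in> ?W"
      using T T'(2) z ez by (auto simp: orient_evec mult.assoc)
    ultimately have "\<forall>\<^sub>F e in at_right 0. nudge 1 z e \<in> ?W"
      by (rule topological_tendstoD[OF nudge_tendsto])
    then have "\<forall>\<^sub>F e in at_right (0::real). nudge 1 z e \<in> ?W \<and> e > 0"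
      by (intro eventually_conj eventually_at_right_less)
    then obtain e where e: "nudge 1 z e \<in> ?W" "e > 0"
      using eventually_happens'[OF trivial_limit_at_right_real] by blast
    have per: "period_vec d (nudge 1 z e)" using Imz e(2) by (intro nudge_period) auto
    then have "line (nudge 1 z e) \<in> half_period d s" using e(1) unfolding half_period_def by blast
    moreover have "line (nudge 1 z e) \<in> compact_dual d"
      using per unfolding compact_dual_def period_vec_def by blast
    ultimately show "\<exists>y. y \<in> half_period d s \<and> y \<in> T" using e(1) T'(2) by blast
  qed
  moreover have "l \<in> {line x | x. x \<in> tensor_C E \<and> x \<noteq> 0}"
    unfolding z(1) tensor_E using ez by blast
  moreover have "l \<notin> {line (cplx_vec x) | x. x \<noteq> 0}"
  proof
    assume "l \<in> {line (cplx_vec x) | x. x \<noteq> 0}"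
    then obtain x where "line (evec 1 z) = line (cplx_vec x)" unfolding z(1) by blast
    then obtain c where c: "c \<noteq> 0" "evec 1 z = c *s cplx_vec x" using line_eqD[OF _ ez] by blast
    \<comment> \<open>Pairing with \<open>w\<close> and \<open>f\<close> recovers the coordinates,
      so a real representative would make \<open>z\<close> real.\<close>
    have "of_nat a = c * of_real (bil d x w)" "z = c * of_real (bil d x f)"
      using evec_coords[of 1 z] unfolding c(2) by simp_all
    then have "z * of_real (bil d x w) = of_nat a * of_real (bil d x f)" by simp
    moreover have "bil d x w \<noteq> 0" using \<open>of_nat a = c * of_real (bil d x w)\<close> a_pos by auto
    ultimately have "z = of_real (real a * bil d x f / bil d x w)"
      by (simp add: field_simps)
    then show False using Imz by (metis Im_complex_of_real)
  qed
  ultimately show "l \<in> bdry_points d (half_period d s) E" unfolding bdry_points_def by blast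
qed

end

section \<open>The action of the stabiliser\<close>

lemma matrix_eq_cplx:
  "map_matrix complex_of_real g *v cplx_vec x = cplx_vec (g *v x)"
  by (simp add: vec_eq_iff matrix_vector_mult_def map_matrix_def)

lemma proj_act_line: "proj_act g (line x) = line (map_matrix complex_of_real g *v x)"
  by (simp add: proj_act_def line_def' image_image vector_scalar_commute)

lemma vstar_axis: "axis 5 1 = (2 * real d) *\<^sub>R vstar d" if "d > 0"
  using that by (simp add: vstar_def)

context frame
begin

lemma gC_evec:
  assumes "g *v v1 = al *\<^sub>R v1 + ga *\<^sub>R v2" "g *v v2 = be *\<^sub>R v1 + de *\<^sub>R v2"
  shows "map_matrix complex_of_real g *v evec x y = evec (of_real al * x + of_real be * y) (of_real ga * x + of_real de * y)"
  unfolding evec_def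
  by (simp add: matrix_vector_right_distrib vector_scalar_commute matrix_eq_cplx assms)
     (simp add: vec_eq_iff algebra_simps)

lemma v1_divisible:
  assumes "x \<in> latt"
  obtains c :: int where "bil d v1 x = of_int (int a * c)"
proof -
  obtain c1 c2 c3 c4 c5 c6 where "x = of_int c1 *\<^sub>R v1 + of_int c2 *\<^sub>R v2 + of_int c3 *\<^sub>R k3 + of_int c4 *\<^sub>R k4 +
      of_int c5 *\<^sub>R f + of_int c6 *\<^sub>R w" by (rule latt_cases[OF assms])
  then have "bil d v1 x = of_int (int a * c6)" by (simp add: gram_all)
  then show ?thesis by (rule that)
qed

lemma stab_action:
  assumes d: "d > 0" and D: "is_period_domain d D" and g: "g \<in> Stab (Gam d) E"
  obtains al be ga de :: int where "g *v v1 = of_int al *\<^sub>R v1 + of_int ga *\<^sub>R v2"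
    "g *v v2 = of_int be *\<^sub>R v1 + of_int de *\<^sub>R v2" "al * de - be * ga = 1" "int a dvd ga"
proof -
  have gG: "g \<in> Gam d" and gE: "(\<lambda>x. g *v x) ` E = E" using g by (auto simp: Stab_def)
  then have gO: "g \<in> O_latt d" "g \<in> O_plus_real d" by (auto simp: Gam_def O_plus_latt_def)
  then have iso: "bil d (g *v x) (g *v y) = bil d x y" for x y by (simp add: O_latt_def O_real_def)
  have gL: "(\<lambda>x. g *v x) ` latt = latt" using gO by (simp add: O_latt_def)
  have "g *v v1 \<in> E" "g *v v2 \<in> E" using gE v_E by blast+
  then obtain al be ga de :: int where g1: "g *v v1 = of_int al *\<^sub>R v1 + of_int ga *\<^sub>R v2"
    and g2: "g *v v2 = of_int be *\<^sub>R v1 + of_int de *\<^sub>R v2" by (metis E_cases)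
  have lin: "g *v (x *\<^sub>R v1 + y *\<^sub>R v2) = (x * of_int al + y * of_int be) *\<^sub>R v1 + (x * of_int ga + y * of_int de) *\<^sub>R v2" for x y
    by (simp add: matrix_vector_right_distrib matrix_vector_mult_scaleR g1 g2 algebra_simps)
  have coord: "x = x' \<and> y = y'"
    if "of_int x *\<^sub>R v1 + of_int y *\<^sub>R v2 = of_int x' *\<^sub>R v1 + of_int y' *\<^sub>R v2" for x y x' y' :: int
  proof -
    have "bil d (of_int x *\<^sub>R v1 + of_int y *\<^sub>R v2) w = bil d (of_int x' *\<^sub>R v1 + of_int y' *\<^sub>R v2) w"
      "bil d (of_int x *\<^sub>R v1 + of_int y *\<^sub>R v2) f = bil d (of_int x' *\<^sub>R v1 + of_int y' *\<^sub>R v2) f"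
      unfolding that by (rule refl)+
    then show ?thesis using a_pos by (simp add: gram_all)
  qed
  have preim: "\<exists>i j :: int. v = g *v (of_int i *\<^sub>R v1 + of_int j *\<^sub>R v2)" if "v \<in> E" for v
  proof -
    from that gE obtain e where "e \<in> E" "v = g *v e" by blast
    then show ?thesis by (elim E_cases) blast
  qed
  from preim[OF v_E(1)] obtain i1 j1 :: int where "v1 = g *v (of_int i1 *\<^sub>R v1 + of_int j1 *\<^sub>R v2)" by blast
  then have "of_int 1 *\<^sub>R v1 + of_int 0 *\<^sub>R v2 = of_int (i1 * al + j1 * be) *\<^sub>R v1 + of_int (i1 * ga + j1 * de) *\<^sub>R v2"
    unfolding lin by simp
  from coord[OF this] have 1: "i1 * al + j1 * be = 1" "i1 * ga + j1 * de = 0"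
    by (simp_all only:)
  from preim[OF v_E(2)] obtain i2 j2 :: int where "v2 = g *v (of_int i2 *\<^sub>R v1 + of_int j2 *\<^sub>R v2)" by blast
  then have "of_int 0 *\<^sub>R v1 + of_int 1 *\<^sub>R v2 = of_int (i2 * al + j2 * be) *\<^sub>R v1 + of_int (i2 * ga + j2 * de) *\<^sub>R v2"
    unfolding lin by simp
  from coord[OF this] have 2: "i2 * al + j2 * be = 0" "i2 * ga + j2 * de = 1"
    by (simp_all only:)
  \<comment> \<open>The second factor is the determinant of the inverse of \<open>g\<close> on
    \<open>E\<close>.\<close>
  have "(al * de - be * ga) * (i1 * j2 - j1 * i2) =
      (i1 * al + j1 * be) * (i2 * ga + j2 * de) - (i2 * al + j2 * be) * (i1 * ga + j1 * de)"
    by (simp add: algebra_simps)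
  also have "\<dots> = 1" unfolding 1 2 by simp
  finally have unit: "al * de - be * ga = 1 \<or> al * de - be * ga = -1"
    by (metis zmult_eq_1_iff)
  obtain s where s: "s = 1 \<or> s = -1" "D = half_period d s" using period_domain_half[OF D] .
  have gD: "proj_act g ` D = D" using D gO(2) unfolding is_period_domain_def by blast
  \<comment> \<open>The sign of \<open>y\<close> gives \<open>v1 + y v2\<close> the orientation of
    \<open>D\<close>, so that its nudged vectors represent points of \<open>D\<close>.\<close>
  define y where "y = of_real (s * sgn kap) * \<i>"
  have kap: "kap \<noteq> 0" by (rule kap_nonzero[OF d])
  have Imy: "Im y = s * sgn kap" by (simp add: y_def)
  have pos: "0 < s * orient (evec 1 y)" using s(1) kap by (auto simp: orient_evec Imy abs_sgn[symmetric] mult.commute sgn_if)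
  let ?g = "map_matrix complex_of_real g"
  have "\<forall>\<^sub>F e in at_right 0. 0 < s * orient (nudge 1 y e)"
    using topological_tendstoD[OF nudge_tendsto open_orient[of s], of 1 y] pos by simp
  then have ev: "\<forall>\<^sub>F e in at_right 0. 0 \<le> s * orient (?g *v nudge 1 y e)"
    using eventually_at_right_less
  proof eventually_elim
    case (elim e)
    have "period_vec d (nudge 1 y e)" using elim(2) s(1) kap by (intro nudge_period) (auto simp: Imy sgn_if)
    then have "line (nudge 1 y e) \<in> D" unfolding s(2) half_period_def using elim(1) by blast
    then have "line (?g *v nudge 1 y e) \<in> D" unfolding proj_act_line[symmetric] using gD by blast
    then show ?case using line_in_half_period_D(2) unfolding s(2) by fastforce
  qed
  have "((\<lambda>e. s * orient (?g *v nudge 1 y e)) \<longlongrightarrow> s * orient (?g *v evec 1 y)) (at_right 0)"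
  proof -
    have "continuous_on UNIV (\<lambda>x. s * orient (?g *v x))"
      unfolding orient_def matrix_vector_mult_def by (intro continuous_intros)
    then have "isCont (\<lambda>x. s * orient (?g *v x)) (evec 1 y)" by (simp add: continuous_on_eq_continuous_at)
    then show ?thesis by (rule isCont_tendsto_compose[OF _ nudge_tendsto])
  qed
  \<comment> \<open>The limit loses strictness, but the weak inequality already excludes determinant
    \<open>-1\<close>.\<close>
  then have "0 \<le> s * orient (?g *v evec 1 y)"
    using ev by (rule tendsto_lowerbound) simp
  also have "s * orient (?g *v evec 1 y) = (s * Im y * kap) * of_int (al * de - be * ga)"
    unfolding gC_evec[OF g1 g2] orient_evec by (simp add: y_def algebra_simps)
  finally have nonneg: "0 \<le> (s * Im y * kap) * of_int (al * de - be * ga)" .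
  have "s * Im y * kap > 0" using s(1) kap by (auto simp: Imy sgn_if)
  then have "\<not> real_of_int (al * de - be * ga) < 0"
    using nonneg mult_pos_neg by (metis not_less)
  then have "al * de - be * ga = 1" using unit by (simp only: of_int_less_0_iff) linarith
  moreover have "int a dvd ga"
  proof -
    have "f \<in> (\<lambda>x. g *v x) ` latt" unfolding gL by (rule v_latt)
    then obtain x where x: "x \<in> latt" "f = g *v x" by blast
    have "of_int ga = bil d (g *v v1) f" unfolding g1 by (simp add: gram_all)
    also have "\<dots> = bil d v1 x" unfolding x(2) by (rule iso)
    also obtain c where "bil d v1 x = of_int (int a * c)" by (rule v1_divisible[OF x(1)])
    finally have "ga = int a * c" by (simp only: of_int_eq_iff)
    then show ?thesis by simp
  qed
  ultimately show ?thesis using that g1 g2 by blast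
qed

text \<open>The \<open>p\<close>-part of the discriminant group is generated by \<open>2 v\<^sup>*\<close>, so \<open>v1/p\<close> is a multiple of it.\<close>

lemma stab_action_mod_p:
  fixes p :: nat
  assumes p: "prime p" "p > 3" "d = p\<^sup>2" "p dvd a" and g: "g \<in> Gam d"
    and g1: "g *v v1 = of_int al *\<^sub>R v1 + of_int ga *\<^sub>R v2" and ga: "int a dvd ga"
  shows "int p dvd al - 1"
proof -
  have p0: "p > 0" using p by simp
  have gL: "g *v x \<in> latt" if "x \<in> latt" for x
  proof -
    have "(\<lambda>x. g *v x) ` latt = latt" using g by (simp add: Gam_def O_plus_latt_def O_latt_def)
    then show ?thesis using that by blast
  qed
  have pp: "prime (int p)" using p by simp
  have p6: "\<not> int p dvd 6"
  proof -
    have "\<not> int p dvd 2" "\<not> int p dvd 3" using p by (auto dest!: zdvd_imp_le)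
    then have "\<not> int p dvd 2 * 3" using pp by (simp only: prime_dvd_mult_iff) blast
    then show ?thesis by simp
  qed
  have ax: "axis i 1 \<in> latt" for i by (simp add: latt_def axis_def)
  have mult: "\<exists>k :: int. bil d v1 x = of_int (int p * k)" if x: "x \<in> latt" for x
  proof -
    obtain c where "bil d v1 x = of_int (int a * c)" using v1_divisible[OF x] .
    moreover obtain b where "a = p * b" using p(4) by (elim dvdE)
    ultimately have "bil d v1 x = of_int (int p * (int b * c))" by simp
    then show ?thesis by blast
  qed
  have axb: "bil d v1 (axis 1 1) = v1 $ 2" "bil d v1 (axis 2 1) = v1 $ 1" "bil d v1 (axis 3 1) = v1 $ 4"
    "bil d v1 (axis 4 1) = v1 $ 3" "bil d v1 (axis 6 1) = - 6 * v1 $ 6"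
    by (simp_all add: bil_def axis_def)
  have "\<exists>k :: int. v1 $ 6 = of_int (int p * k)"
  proof -
    obtain k :: int where k: "- 6 * v1 $ 6 = of_int (int p * k)" using mult[OF ax, of 6] unfolding axb by blast
    have "v1 $ 6 \<in> \<int>" using v_latt(1) by (simp add: latt_def)
    then obtain n where n: "v1 $ 6 = of_int n" by (elim Ints_cases)
    have "of_int (- 6 * n) = (of_int (int p * k) :: real)" using k by (simp add: n)
    then have "- 6 * n = int p * k" by (simp only: of_int_eq_iff)
    then have "6 * n = int p * (- k)" by simp
    then have "int p dvd 6 * n" by (metis dvd_triv_left)
    then have "int p dvd n" using p6 pp by (simp add: prime_dvd_mult_iff)
    then show ?thesis by (elim dvdE) (use n in blast)
  qed
  moreover have "\<exists>k :: int. v1 $ 1 = of_int (int p * k)" "\<exists>k :: int. v1 $ 2 = of_int (int p * k)"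
    "\<exists>k :: int. v1 $ 3 = of_int (int p * k)" "\<exists>k :: int. v1 $ 4 = of_int (int p * k)"
    using mult[OF ax, of 2] mult[OF ax, of 1] mult[OF ax, of 4] mult[OF ax, of 3] unfolding axb by blast+
  ultimately obtain x1 x2 x3 x4 x6 :: int where x: "v1 $ 1 = of_int (int p * x1)" "v1 $ 2 = of_int (int p * x2)"
    "v1 $ 3 = of_int (int p * x3)" "v1 $ 4 = of_int (int p * x4)" "v1 $ 6 = of_int (int p * x6)"
    by (elim exE) (rule that)
  have "v1 $ 5 \<in> \<int>" using v_latt(1) by (simp add: latt_def)
  then obtain x5 where x5: "v1 $ 5 = of_int x5" by (elim Ints_cases)
  \<comment> \<open>\<open>v1 = p q + x5 e5\<close> with \<open>q\<close> integral and
    \<open>e5 = 2 p^2 v*\<close>, hence \<open>v1/p = q + 2 p x5 v*\<close>.\<close>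
  define q where "q = rvec (\<chi> i. if i = 1 then x1 else if i = 2 then x2 else if i = 3 then x3 else if i = 4 then x4 else if i = 5 then 0 else x6)"
  have ql: "q \<in> latt" by (simp add: q_def latt_rvec)
  have v1q: "v1 = real p *\<^sub>R q + real_of_int x5 *\<^sub>R axis 5 1"
    by (simp add: vec6_eq_iff q_def rvec_def x x5 axis_def)
  have "axis 5 1 = (2 * real d) *\<^sub>R vstar d" by (rule vstar_axis) (use p in simp)
  then have v1v: "v1 = real p *\<^sub>R (q + (2 * real p * of_int x5) *\<^sub>R vstar d)"
    unfolding v1q by (simp add: p(3) power2_eq_square scaleR_add_right)
  \<comment> \<open>This is \<open>g (v1/p) - v1/p\<close>; it is integral because \<open>g\<close>
    moves both \<open>q\<close> and \<open>v*\<close> by lattice vectors.\<close>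
  define u where "u = (g *v q - q) + (of_int (2 * int p * x5)) *\<^sub>R (g *v vstar d - vstar d)"
  have "g *v vstar d - vstar d \<in> latt" using g unfolding Gam_def by (elim CollectE conjE)
  then have ul: "u \<in> latt"
    unfolding u_def by (rule latt_simps(2)[OF latt_simps(3)[OF gL[OF ql] ql] latt_simps(5)[OF Ints_of_int]])
  have "g *v v1 - v1 = real p *\<^sub>R u"
    unfolding v1v u_def
    by (simp add: matrix_vector_right_distrib matrix_vector_mult_scaleR algebra_simps)
  then have pu: "of_int (int p) *\<^sub>R u = of_int (al - 1) *\<^sub>R v1 + of_int ga *\<^sub>R v2"
    unfolding g1 by (simp add: algebra_simps)
  then have "of_int (int p) *\<^sub>R u \<in> E" by (simp only: E_mem)
  \<comment> \<open>By primitivity \<open>u\<close> has integral coordinates in \<open>v1\<close>,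
    \<open>v2\<close>, which makes the coefficient \<open>al - 1\<close> in \<open>p u\<close>
    divisible by \<open>p\<close>.\<close>
  then have "u \<in> E" by (rule primitive[OF ul, rotated]) (use p0 in simp)
  then obtain i j where u: "u = of_int i *\<^sub>R v1 + of_int j *\<^sub>R v2" by (rule E_cases)
  have "bil d (of_int (int p) *\<^sub>R u) w = bil d (of_int (al - 1) *\<^sub>R v1 + of_int ga *\<^sub>R v2) w"
    unfolding pu ..
  then have "real_of_int (int p * i) * real a = of_int (al - 1) * real a"
    unfolding u by (simp add: gram_all)
  then have "real_of_int (int p * i) = of_int (al - 1)" using a_pos by simp
  then have "int p * i = al - 1" by (simp only: of_int_eq_iff)
  then show ?thesis by (metis dvd_triv_left)
qed

end

section \<open>Realising congruence matrices\<close>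

context frame
begin

text \<open>For determinant 1 the action on \<open>f1\<close>, \<open>f\<close> is the inverse
  transpose of that on \<open>v1\<close>, \<open>v2\<close>, as their duality requires.\<close>

definition hyp_act :: "real \<Rightarrow> real \<Rightarrow> real \<Rightarrow> real \<Rightarrow> (real ^ 6 \<Rightarrow> real ^ 6) \<Rightarrow> bool" where
  "hyp_act al be ga de F \<longleftrightarrow> refl_prod_pos d F \<and>
     F v1 = al *\<^sub>R v1 + ga *\<^sub>R v2 \<and> F v2 = be *\<^sub>R v1 + de *\<^sub>R v2 \<and>
     F f1 = de *\<^sub>R f1 - be *\<^sub>R f \<and> F f = al *\<^sub>R f - ga *\<^sub>R f1 \<and> F k3 = k3 \<and> F k4 = k4"

lemma hyp_act_comp:
  assumes F: "hyp_act al be ga de F" and G: "hyp_act al' be' ga' de' G"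
  shows "hyp_act (al * al' + be * ga') (al * be' + be * de') (ga * al' + de * ga') (ga * be' + de * de') (F \<circ> G)"
proof -
  have lin: "linear F" using F refl_prod_pos_linear unfolding hyp_act_def by blast
  have "refl_prod_pos d (F \<circ> G)" using F G refl_prod_pos_comp unfolding hyp_act_def by blast
  moreover have Fv: "F v1 = al *\<^sub>R v1 + ga *\<^sub>R v2" "F v2 = be *\<^sub>R v1 + de *\<^sub>R v2"
      "F f1 = de *\<^sub>R f1 - be *\<^sub>R f" "F f = al *\<^sub>R f - ga *\<^sub>R f1" "F k3 = k3" "F k4 = k4"
    using F unfolding hyp_act_def by blast+
  moreover have Gv: "G v1 = al' *\<^sub>R v1 + ga' *\<^sub>R v2" "G v2 = be' *\<^sub>R v1 + de' *\<^sub>R v2"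
      "G f1 = de' *\<^sub>R f1 - be' *\<^sub>R f" "G f = al' *\<^sub>R f - ga' *\<^sub>R f1" "G k3 = k3" "G k4 = k4"
    using G unfolding hyp_act_def by blast+
  ultimately show ?thesis
    unfolding hyp_act_def comp_def Gv linear_add[OF lin] linear_diff[OF lin] linear_scale[OF lin] Fv
    by (simp add: algebra_simps)
qed

text \<open>An elementary matrix is a transvection along an isotropic multiple of \<open>f\<close>;
  \<open>v2\<close> is the auxiliary isotropic vector pairing with it, so the pairing is nonzero
  only for nonzero \<open>s\<close>.\<close>

lemma hyp_act_upper: "\<exists>F. hyp_act 1 s 0 1 F"
proof (cases "s = 0")
  case True
  then show ?thesis by (intro exI[of _ id]) (simp add: hyp_act_def refl_prod_pos_id)
next
  case False
  then have "refl_prod_pos d (eichler d v1 ((- s) *\<^sub>R f))"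
    by (intro eichler_isotropic_refl_prod_pos[where b = v2]) (simp_all add: gram_all)
  then show ?thesis
    by (intro exI[of _ "eichler d v1 ((- s) *\<^sub>R f)"]) (simp add: hyp_act_def eichler_def gram_all f1_gram)
qed

lemma hyp_act_lower: "\<exists>F. hyp_act 1 0 s 1 F"
proof (cases "s = 0")
  case True
  then show ?thesis by (intro exI[of _ id]) (simp add: hyp_act_def refl_prod_pos_id)
next
  case False
  then have "refl_prod_pos d (eichler d v2 ((- s) *\<^sub>R f1))"
    by (intro eichler_isotropic_refl_prod_pos[where b = v1]) (simp_all add: gram_all f1_gram)
  then show ?thesis
    by (intro exI[of _ "eichler d v2 ((- s) *\<^sub>R f1)"]) (simp add: hyp_act_def eichler_def gram_all f1_gram)
qed

lemma hyp_act_exists: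
  assumes det: "al * de - be * ga = 1"
  shows "\<exists>F. hyp_act al be ga de F"
proof -
  have nonzero: "\<exists>F. hyp_act al be ga de F" if "ga \<noteq> 0" and det: "al * de - be * ga = 1" for al be ga de
  proof -
    \<comment> \<open>Factorisation into upper, lower and upper elementary matrices;
      \<open>x\<close> and \<open>y\<close> are forced by the diagonal entries.\<close>
    define x y where "x = (al - 1) / ga" and "y = (de - 1) / ga"
    obtain F1 where F1: "hyp_act 1 x 0 1 F1" using hyp_act_upper by blast
    obtain F2 where F2: "hyp_act 1 0 ga 1 F2" using hyp_act_lower by blast
    obtain F3 where F3: "hyp_act 1 y 0 1 F3" using hyp_act_upper by blast
    have e: "x * ga = al - 1" "ga * y = de - 1" using that by (simp_all add: x_def y_def)
    have "ga * (al * y + x) = al * (ga * y) + x * ga" by (simp add: algebra_simps)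
    also have "\<dots> = al * de - 1" unfolding e by (simp add: algebra_simps)
    also have "\<dots> = ga * be" using det by (simp add: algebra_simps)
    finally have "al * y + x = be" using that by simp
    then have "hyp_act al be ga de (F1 \<circ> F2 \<circ> F3)"
      using hyp_act_comp[OF hyp_act_comp[OF F1 F2] F3] by (simp add: e)
    then show ?thesis by blast
  qed
  show ?thesis
  proof (cases "ga = 0")
    case True
    \<comment> \<open>Subtracting the first row from the second creates a nonzero entry;
      \<open>G\<close> adds it back.\<close>
    then have "al \<noteq> 0" using det by auto
    then obtain F where F: "hyp_act al be (- al) (de - be) F"
      using nonzero[of "- al" al "de - be" be] det True by (auto simp: algebra_simps)
    obtain G where G: "hyp_act 1 0 1 1 G" using hyp_act_lower by blast
    have "hyp_act al be ga de (G \<circ> F)"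
      using hyp_act_comp[OF G F] True by simp
    then show ?thesis by blast
  qed (use nonzero[OF _ det] in blast)
qed

lemma vstar_expand:
  assumes "d > 0"
  obtains c1 c2 c3 c4 c5 c6 :: real where
    "vstar d = c1 *\<^sub>R v1 + c2 *\<^sub>R v2 + c3 *\<^sub>R k3 + c4 *\<^sub>R k4 + c5 *\<^sub>R f + c6 *\<^sub>R w"
proof -
  have "axis 5 1 \<in> latt" by (simp add: latt_def axis_def)
  then obtain c1 c2 c3 c4 c5 c6 where c: "axis 5 1 = of_int c1 *\<^sub>R v1 + of_int c2 *\<^sub>R v2 + of_int c3 *\<^sub>R k3 + of_int c4 *\<^sub>R k4 +
      of_int c5 *\<^sub>R f + of_int c6 *\<^sub>R w" by (rule latt_cases)
  show ?thesis
    by (rule that[of "of_int c1 / (2 * real d)" "of_int c2 / (2 * real d)" "of_int c3 / (2 * real d)" "of_int c4 / (2 * real d)"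
          "of_int c5 / (2 * real d)" "of_int c6 / (2 * real d)"])
       (simp add: vstar_def c scaleR_add_right)
qed

lemma bil_vstar: "d > 0 \<Longrightarrow> bil d (vstar d) x = - x $ 5"
  by (simp add: bil_def vstar_def axis_def)

text \<open>
  The element of the Levi subgroup given by the matrix preserves the lattice only up to the
  denominator \<open>a\<close> of \<open>f1\<close>; the unipotent factor \<open>U\<close> below, which acts trivially on \<open>E\<close>, corrects this.
\<close>

lemma stab_exists:
  assumes d: "d > 0" and det: "al * de - be * ga = (1::int)"
    and cong: "int a dvd ga" "int a dvd al - 1" "int a dvd de - 1"
  obtains g where "g \<in> Stab (Gam d) E" "g *v v1 = of_int al *\<^sub>R v1 + of_int ga *\<^sub>R v2"
    "g *v v2 = of_int be *\<^sub>R v1 + of_int de *\<^sub>R v2"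
proof -
  obtain c where c: "ga = int a * c" using cong(1) by (elim dvdE)
  obtain A where A: "al - 1 = int a * A" using cong(2) by (elim dvdE)
  obtain B where B: "de - 1 = int a * B" using cong(3) by (elim dvdE)
  have al: "al = 1 + int a * A" and de: "de = 1 + int a * B" using A B by auto
  have a0: "int a \<noteq> 0" "real a \<noteq> 0" using a_pos by auto
  \<comment> \<open>The determinant relation, about to be divided by \<open>a\<close>.\<close>
  have "int a * (A + B + int a * A * B - be * c) = 0"
    using det unfolding al de c by (simp add: algebra_simps)
  then have AB: "A + B + int a * A * B = be * c" using a0 by simp
  \<comment> \<open>The term \<open>- ga f1\<close> brings \<open>(m c / a) v1\<close> into
    \<open>F f\<close>; this value of \<open>t\<close> cancels the fraction.\<close>
  define t where "t = - of_int (m * c) / real a"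
  have "of_int al * of_int de - of_int be * of_int ga = (1 :: real)"
    using det by (simp flip: of_int_mult of_int_diff)
  then obtain F where F: "hyp_act (of_int al) (of_int be) (of_int ga) (of_int de) F"
    using hyp_act_exists by blast
  define U where "U = eichler d v1 ((- t) *\<^sub>R v2)"
  have U: "refl_prod_pos d U"
  proof (cases "t = 0")
    case True
    then have "U = id" by (simp add: U_def fun_eq_iff eichler_def)
    then show ?thesis by (simp add: refl_prod_pos_id)
  next
    case False
    then show ?thesis unfolding U_def
      by (intro eichler_isotropic_refl_prod_pos[where b = f]) (simp_all add: gram_all)
  qed
  have Uv: "U v1 = v1" "U v2 = v2" "U k3 = k3" "U k4 = k4" "U f = f + t *\<^sub>R v1" "U w = w - (t * real a) *\<^sub>R v2"
    by (simp_all add: U_def eichler_def gram_all)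
  define G where "G = F \<circ> U"
  have G: "refl_prod_pos d G" using F U refl_prod_pos_comp unfolding G_def hyp_act_def by blast
  note linG = refl_prod_pos_linear[OF G]
  have linF: "linear F" using F refl_prod_pos_linear unfolding hyp_act_def by blast
  have Fv: "F v1 = of_int al *\<^sub>R v1 + of_int ga *\<^sub>R v2" "F v2 = of_int be *\<^sub>R v1 + of_int de *\<^sub>R v2"
    "F f1 = of_int de *\<^sub>R f1 - of_int be *\<^sub>R f" "F f = of_int al *\<^sub>R f - of_int ga *\<^sub>R f1" "F k3 = k3" "F k4 = k4"
    using F unfolding hyp_act_def by blast+
  have G1: "G v1 = of_int al *\<^sub>R v1 + of_int ga *\<^sub>R v2" and G2: "G v2 = of_int be *\<^sub>R v1 + of_int de *\<^sub>R v2"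
    and Gk: "G k3 = k3" "G k4 = k4"
    by (simp_all add: G_def Uv Fv)
  have Gf: "G f = of_int al *\<^sub>R f - of_int c *\<^sub>R w - of_int (c * m * A) *\<^sub>R v1 - of_int (m * c * c) *\<^sub>R v2"
  proof -
    have "G f = of_int al *\<^sub>R f - of_int ga *\<^sub>R f1 + t *\<^sub>R (of_int al *\<^sub>R v1 + of_int ga *\<^sub>R v2)"
      by (simp add: G_def Uv linear_add[OF linF] linear_scale[OF linF] Fv)
    also have "\<dots> = of_int al *\<^sub>R f - of_int c *\<^sub>R w - of_int (c * m * A) *\<^sub>R v1 - of_int (m * c * c) *\<^sub>R v2"
      unfolding f1_def t_def al c vec_eq_iff using a0 by (simp add: field_simps power2_eq_square)
    finally show ?thesis .
  qed
  have Gw: "G w = of_int de *\<^sub>R w - of_int (int a * be) *\<^sub>R f + of_int (m * (A - B) + m * c * be) *\<^sub>R v1 + of_int (m * c * (1 + de)) *\<^sub>R v2"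
  proof -
    have "F w = real a *\<^sub>R F f1 + (of_int m / real a) *\<^sub>R F v1"
      by (subst w_eq) (simp add: linear_add[OF linF] linear_scale[OF linF])
    then have "G w = real a *\<^sub>R (of_int de *\<^sub>R f1 - of_int be *\<^sub>R f) + (of_int m / real a) *\<^sub>R (of_int al *\<^sub>R v1 + of_int ga *\<^sub>R v2)
        - (t * real a) *\<^sub>R (of_int be *\<^sub>R v1 + of_int de *\<^sub>R v2)"
      by (simp add: G_def Uv linear_diff[OF linF] linear_scale[OF linF] Fv)
    also have "\<dots> = of_int de *\<^sub>R w - of_int (int a * be) *\<^sub>R f + of_int (m * (A - B) + m * c * be) *\<^sub>R v1 + of_int (m * c * (1 + de)) *\<^sub>R v2"
      unfolding f1_def t_def al de c vec_eq_iff using a0 by (simp add: field_simps power2_eq_square)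
    finally show ?thesis .
  qed
  define g where "g = matrix G"
  have gG: "g *v x = G x" for x unfolding g_def using linG by (simp add: matrix_works)
  note Gsimps = linear_add[OF linG] linear_scale[OF linG] linear_diff[OF linG]
  have into: "G x \<in> latt" if x: "x \<in> latt" for x
  proof -
    obtain c1 c2 c3 c4 c5 c6 where "x = of_int c1 *\<^sub>R v1 + of_int c2 *\<^sub>R v2 + of_int c3 *\<^sub>R k3 + of_int c4 *\<^sub>R k4 +
      of_int c5 *\<^sub>R f + of_int c6 *\<^sub>R w" by (rule latt_cases[OF x])
    then have "G x = of_int c1 *\<^sub>R G v1 + of_int c2 *\<^sub>R G v2 + of_int c3 *\<^sub>R G k3 + of_int c4 *\<^sub>R G k4 +
      of_int c5 *\<^sub>R G f + of_int c6 *\<^sub>R G w" by (simp add: Gsimps)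
    also have "\<dots> \<in> latt"
      unfolding G1 G2 Gk Gf Gw by (intro latt_simps Ints_of_int v_latt)
    finally show ?thesis .
  qed
  \<comment> \<open>Surjectivity: once \<open>v1\<close> and \<open>v2\<close> are reached,
    \<open>f\<close> and \<open>w\<close> need only be reached up to multiples of them.\<close>
  let ?S = "G ` latt"
  have Sadd: "x + y \<in> ?S" if "x \<in> ?S" "y \<in> ?S" for x y
    using that by (auto simp flip: Gsimps(1) intro!: imageI)
  have Sscale: "of_int n *\<^sub>R x \<in> ?S" if "x \<in> ?S" for n x
    using that by (auto simp flip: Gsimps(2) intro!: imageI)
  have v1S: "v1 \<in> ?S"
  proof -
    have "v1 = of_int (al * de - be * ga) *\<^sub>R v1" unfolding det by simp
    also have "\<dots> = G (of_int de *\<^sub>R v1 - of_int ga *\<^sub>R v2)"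
      unfolding Gsimps G1 G2 vec_eq_iff by (simp add: algebra_simps)
    finally show ?thesis by (rule image_eqI) (intro latt_simps Ints_of_int v_latt)
  qed
  have v2S: "v2 \<in> ?S"
  proof -
    have "v2 = of_int (al * de - be * ga) *\<^sub>R v2" unfolding det by simp
    also have "\<dots> = G (of_int al *\<^sub>R v2 - of_int be *\<^sub>R v1)"
      unfolding Gsimps G1 G2 vec_eq_iff by (simp add: algebra_simps)
    finally show ?thesis by (rule image_eqI) (intro latt_simps Ints_of_int v_latt)
  qed
  have kS: "k3 \<in> ?S" "k4 \<in> ?S" using Gk v_latt by (metis imageI)+
  have fS: "f \<in> ?S"
  proof -
    have "f = of_int (al * de - be * ga) *\<^sub>R f" unfolding det by simp
    also have "\<dots> = G (of_int de *\<^sub>R f + of_int c *\<^sub>R w) +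
       (of_int (de * c * m * A - c * (m * (A - B) + m * c * be)) *\<^sub>R v1 + of_int (de * m * c * c - c * (m * c * (1 + de))) *\<^sub>R v2)"
      unfolding Gsimps Gf Gw vec_eq_iff by (simp add: c algebra_simps)
    also have "\<dots> \<in> ?S"
      using v1S v2S by (intro Sadd Sscale imageI latt_simps Ints_of_int v_latt)
    finally show ?thesis .
  qed
  have wS: "w \<in> ?S"
  proof -
    have "w = of_int (al * de - be * ga) *\<^sub>R w" unfolding det by simp
    also have "\<dots> = G (of_int al *\<^sub>R w + of_int (int a * be) *\<^sub>R f) +
       (of_int (int a * be * c * m * A - al * (m * (A - B) + m * c * be)) *\<^sub>R v1 +
        of_int (int a * be * m * c * c - al * (m * c * (1 + de))) *\<^sub>R v2)"
      unfolding Gsimps Gf Gw vec_eq_iff by (simp add: c algebra_simps)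
    also have "\<dots> \<in> ?S"
      using v1S v2S by (intro Sadd Sscale imageI latt_simps Ints_of_int v_latt)
    finally show ?thesis .
  qed
  have onto: "x \<in> ?S" if x: "x \<in> latt" for x
  proof -
    obtain c1 c2 c3 c4 c5 c6 where "x = of_int c1 *\<^sub>R v1 + of_int c2 *\<^sub>R v2 + of_int c3 *\<^sub>R k3 + of_int c4 *\<^sub>R k4 +
      of_int c5 *\<^sub>R f + of_int c6 *\<^sub>R w" by (rule latt_cases[OF x])
    then show ?thesis using v1S v2S kS fS wS by (simp only:) (intro Sadd Sscale)
  qed
  have "g \<in> O_plus_real d" unfolding g_def by (rule refl_prod_pos_matrix[OF G])
  moreover have "(\<lambda>x. g *v x) ` latt = latt" unfolding gG using into onto by blast
  moreover have "g *v vstar d - vstar d \<in> latt"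
  proof -
    obtain c1 c2 c3 c4 c5 c6 where x: "vstar d = c1 *\<^sub>R v1 + c2 *\<^sub>R v2 + c3 *\<^sub>R k3 + c4 *\<^sub>R k4 + c5 *\<^sub>R f + c6 *\<^sub>R w"
      using vstar_expand[OF d] .
    \<comment> \<open>\<open>v*\<close> lies in the dual lattice, and its pairings with the basis
      bound the denominators of its coordinates.\<close>
    have int: "bil d (vstar d) y \<in> \<int>" if "y \<in> latt" for y
      using that d by (simp add: bil_vstar latt_def)
    have "c5 = bil d (vstar d) v2" "c2 = bil d (vstar d) f" "real a * c6 = bil d (vstar d) v1"
      "real a * c1 + 2 * of_int m * c6 = bil d (vstar d) w"
      unfolding x by (simp_all add: gram_all)
    with int v_latt obtain n5 n2 n1 n6 :: int where n: "c5 = of_int n5" "c2 = of_int n2" "real a * c6 = of_int n1"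
      "real a * c1 + 2 * of_int m * c6 = of_int n6" by (metis Ints_cases)
    have c6: "c6 = of_int n1 / real a" using n(3) a0 by (simp add: field_simps)
    have c1: "c1 = of_int n6 / real a - 2 * of_int m * of_int n1 / (real a)\<^sup>2"
      using n(4) a0 unfolding c6 by (simp add: field_simps power2_eq_square)
    have AB': "of_int be * of_int c = (of_int A + of_int B + real a * of_int A * of_int B :: real)"
      using arg_cong[OF AB, of real_of_int] by simp
    have "g *v vstar d - vstar d = c1 *\<^sub>R (G v1 - v1) + of_int n2 *\<^sub>R (G v2 - v2) + of_int n5 *\<^sub>R (G f - f) + c6 *\<^sub>R (G w - w)"
      unfolding gG x by (simp add: Gsimps Gk n algebra_simps)
    \<comment> \<open>The parts with denominator \<open>a\<close> in this term and in the next one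
      are opposite.\<close>
    also have "c1 *\<^sub>R (G v1 - v1) = of_int (n6 * A) *\<^sub>R v1 + of_int (n6 * c) *\<^sub>R v2
        - (2 * of_int (m * n1) / real a) *\<^sub>R (of_int A *\<^sub>R v1 + of_int c *\<^sub>R v2)"
      unfolding G1 al c c1 vec_eq_iff using a0 by (simp add: field_simps power2_eq_square)
    also have "c6 *\<^sub>R (G w - w) = of_int (n1 * B) *\<^sub>R w - of_int (n1 * be) *\<^sub>R f + of_int (n1 * m * c * B) *\<^sub>R v2
        + of_int (n1 * m * A * B) *\<^sub>R v1 + (2 * of_int (m * n1) / real a) *\<^sub>R (of_int A *\<^sub>R v1 + of_int c *\<^sub>R v2)"
    proof -
      \<comment> \<open>The determinant relation turns \<open>A - B + c be\<close> into
        \<open>2 A + a A B\<close>, whose first part matches the fraction coming from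
        \<open>v1\<close>.\<close>
      have *: "of_int (m * (A - B) + m * c * be) = of_int m * (2 * of_int A + real a * of_int A * of_int B)"
      proof -
        have "of_int (m * (A - B) + m * c * be) = of_int m * (of_int A - of_int B + of_int be * of_int c :: real)"
          by (simp add: algebra_simps)
        then show ?thesis unfolding AB' by (simp add: algebra_simps)
      qed
      show ?thesis unfolding Gw * de c6 vec_eq_iff using a0 by (simp add: field_simps)
    qed
    finally have "g *v vstar d - vstar d = of_int (n6 * A) *\<^sub>R v1 + of_int (n6 * c) *\<^sub>R v2 + of_int n2 *\<^sub>R (G v2 - v2) +
        of_int n5 *\<^sub>R (G f - f) + (of_int (n1 * B) *\<^sub>R w - of_int (n1 * be) *\<^sub>R f + of_int (n1 * m * c * B) *\<^sub>R v2
        + of_int (n1 * m * A * B) *\<^sub>R v1)"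
      by (simp add: algebra_simps)
    also have "\<dots> \<in> latt"
      using into v_latt by (intro latt_simps Ints_of_int) auto
    finally show ?thesis .
  qed
  ultimately have "g \<in> Gam d"
    unfolding Gam_def O_plus_latt_def O_latt_def O_plus_real_def by blast
  moreover have "(\<lambda>x. g *v x) ` E = E"
  proof (intro subset_antisym subsetI)
    fix y assume "y \<in> (\<lambda>x. g *v x) ` E"
    then obtain x where "x \<in> E" "y = G x" unfolding gG by blast
    then obtain i j where "y = G (of_int i *\<^sub>R v1 + of_int j *\<^sub>R v2)" by (metis E_cases)
    also have "\<dots> = of_int (i * al + j * be) *\<^sub>R v1 + of_int (i * ga + j * de) *\<^sub>R v2"
      unfolding Gsimps G1 G2 vec_eq_iff by (simp add: algebra_simps)
    finally show "y \<in> E" by (simp only: E_mem)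
  next
    fix y assume "y \<in> E"
    then obtain i j where y: "y = of_int i *\<^sub>R v1 + of_int j *\<^sub>R v2" by (rule E_cases)
    have "y = of_int (al * de - be * ga) *\<^sub>R y" unfolding det by simp
    also have "\<dots> = G (of_int (i * de - j * be) *\<^sub>R v1 + of_int (j * al - i * ga) *\<^sub>R v2)"
      unfolding y Gsimps G1 G2 vec_eq_iff by (simp add: algebra_simps)
    finally show "y \<in> (\<lambda>x. g *v x) ` E" unfolding gG by (rule image_eqI) (rule E_mem)
  qed
  ultimately have "g \<in> Stab (Gam d) E" by (simp add: Stab_def)
  then show ?thesis using that gG G1 G2 by simp
qed

end

section \<open>Quotients\<close>

lemma topspace_quot_topology: "topspace (quot_topology X q) = q ` topspace X"
  using quotient_imp_surjective_map[OF quotient_map_quot_topology[of X q]] by simp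

text \<open>Orbits are mapped by taking images. \<open>stable\<close> keeps them inside the space,
  where \<open>\<phi>\<close> is injective; \<open>cong\<close> enters because the two pullbacks of
  a function are known to agree only on points of the space.\<close>

lemma quot_space_biholomorphic:
  fixes X :: "'a hspace" and Y :: "'b hspace"
  assumes homeo: "homeomorphic_map (hs_top X) (hs_top Y) \<phi>"
    and hol: "\<And>V h. openin (hs_top Y) V \<Longrightarrow>
          hs_hol Y V h \<longleftrightarrow> hs_hol X {x \<in> topspace (hs_top X). \<phi> x \<in> V} (h \<circ> \<phi>)"
    and cong: "\<And>U h h'. U \<subseteq> topspace (hs_top X) \<Longrightarrow> (\<And>x. x \<in> U \<Longrightarrow> h x = h' x) \<Longrightarrow> hs_hol X U h \<longleftrightarrow> hs_hol X U h'"
    and orb: "\<And>x. x \<in> topspace (hs_top X) \<Longrightarrow> \<phi> ` orbit act G x = orbit act' G' (\<phi> x)"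
    and stable: "\<And>x. x \<in> topspace (hs_top X) \<Longrightarrow> orbit act G x \<subseteq> topspace (hs_top X)"
  shows "quot_space X act G \<cong>\<^sub>h quot_space Y act' G'"
proof -
  define TX TY where "TX = topspace (hs_top X)" and "TY = topspace (hs_top Y)"
  define q q' where "q = orbit act G" and "q' = orbit act' G'"
  have qm: "quotient_map (hs_top X) (hs_top Y) \<phi>" and inj: "inj_on \<phi> TX"
    using homeo unfolding homeomorphic_map_def TX_def by auto
  have im: "\<phi> ` TX = TY" using quotient_imp_surjective_map[OF qm] by (simp add: TX_def TY_def)
  have Fq: "\<phi> ` q x = q' (\<phi> x)" if "x \<in> TX" for x using orb that by (simp add: q_def q'_def TX_def)
  have tX: "topspace (quot_topology (hs_top X) q) = q ` TX" and tY: "topspace (quot_topology (hs_top Y) q') = q' ` TY"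
    by (simp_all add: topspace_quot_topology TX_def TY_def)
  have pre: "{x \<in> TX. q x \<in> {S \<in> q ` TX. \<phi> ` S \<in> U}} = {x \<in> TX. \<phi> x \<in> {y \<in> TY. q' y \<in> U}}" for U
    using im Fq by auto
  have "homeomorphic_map (quot_topology (hs_top X) q) (quot_topology (hs_top Y) q') ((`) \<phi>)"
    unfolding homeomorphic_map_def quotient_map_def tX tY
  proof (intro conjI allI impI)
    have "(`) \<phi> ` q ` TX = (\<lambda>x. q' (\<phi> x)) ` TX"
      unfolding image_image by (intro image_cong refl Fq)
    then show "(`) \<phi> ` q ` TX = q' ` TY"
      unfolding im[symmetric] image_image .
    show "inj_on ((`) \<phi>) (q ` TX)"
    proof (rule inj_onI)
      fix S T assume "S \<in> q ` TX" "T \<in> q ` TX" and eq: "\<phi> ` S = \<phi> ` T"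
      then have "S \<subseteq> TX" "T \<subseteq> TX" using stable unfolding q_def TX_def by blast+
      then show "S = T" using eq inj_on_image_eq_iff[OF inj] by blast
    qed
    fix U assume U: "U \<subseteq> q' ` TY"
    have "openin (quot_topology (hs_top X) q) {S \<in> q ` TX. \<phi> ` S \<in> U} \<longleftrightarrow>
        openin (hs_top X) {x \<in> TX. q x \<in> {S \<in> q ` TX. \<phi> ` S \<in> U}}"
      unfolding openin_quot_topology TX_def by blast
    also have "\<dots> \<longleftrightarrow> openin (hs_top Y) {y \<in> TY. q' y \<in> U}"
      unfolding pre using qm unfolding quotient_map_def TX_def TY_def
      by (elim conjE allE[of _ "{y \<in> topspace (hs_top Y). q' y \<in> U}"] impE) auto
    also have "\<dots> \<longleftrightarrow> openin (quot_topology (hs_top Y) q') U"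
      unfolding openin_quot_topology using U by (simp add: TY_def)
    finally show "openin (quot_topology (hs_top X) q) {S \<in> q ` TX. \<phi> ` S \<in> U} =
        openin (quot_topology (hs_top Y) q') U" .
  qed
  moreover have "hs_hol (quot_space Y act' G') V h \<longleftrightarrow>
      hs_hol (quot_space X act G) {S \<in> topspace (quot_topology (hs_top X) q). \<phi> ` S \<in> V} (h \<circ> (`) \<phi>)"
    if V: "openin (quot_topology (hs_top Y) q') V" for V h
  proof -
    let ?W = "{y \<in> TY. q' y \<in> V}"
    have W: "openin (hs_top Y) ?W" using V unfolding openin_quot_topology TY_def by blast
    have "hs_hol (quot_space Y act' G') V h \<longleftrightarrow> hs_hol Y ?W (h \<circ> q')"
      by (simp add: quot_space_def TY_def q'_def)
    also have "\<dots> \<longleftrightarrow> hs_hol X {x \<in> TX. \<phi> x \<in> ?W} ((h \<circ> q') \<circ> \<phi>)"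
      unfolding hol[OF W] TX_def ..
    also have "\<dots> \<longleftrightarrow> hs_hol X {x \<in> TX. \<phi> x \<in> ?W} ((h \<circ> (`) \<phi>) \<circ> q)"
      by (intro cong) (auto simp: TX_def[symmetric] Fq)
    also have "\<dots> \<longleftrightarrow> hs_hol (quot_space X act G) {S \<in> topspace (quot_topology (hs_top X) q). \<phi> ` S \<in> V} (h \<circ> (`) \<phi>)"
      unfolding tX pre[symmetric] by (simp add: quot_space_def TX_def q_def)
    finally show ?thesis .
  qed
  ultimately show ?thesis
    unfolding biholomorphic_def by (intro exI[of _ "(`) \<phi>"]) (simp add: quot_space_def q_def q'_def)
qed

text \<open>\<open>quot_space_cosets\<close> sees only this union, so quotients by
  \<open>Stab Mod Fix\<close> and by \<open>PSL2Z\<close> are quotients by the stabiliser and by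
  \<open>SL2Z\<close>.\<close>

lemma Union_carrier_Mod:
  assumes "mat 1 \<in> H" "\<And>h g. h \<in> H \<Longrightarrow> g \<in> G \<Longrightarrow> h ** g \<in> G"
  shows "\<Union> (carrier (matrix_monoid G Mod H)) = G"
proof -
  have "\<Union> (carrier (matrix_monoid G Mod H)) = {h ** g | h g. h \<in> H \<and> g \<in> G}"
    by (auto simp: matrix_monoid_def FactGroup_def RCOSETS_def r_coset_def)
  also have "\<dots> = G"
    using assms by (force intro: exI[of _ "mat 1"])
  finally show ?thesis .
qed

lemma has_spinor_norm_1_iff:
  "has_spinor_norm d g 1 \<longleftrightarrow>
    (\<exists>ws. (\<forall>w\<in>set ws. bil d w w \<noteq> 0) \<and> (\<forall>x. g *v x = foldr (reflect d) ws x) \<and> 0 < (\<Prod>w\<leftarrow>ws. - bil d w w / 2))"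
  unfolding has_spinor_norm_def by (simp add: eq_commute[of "1::real"] sgn_1_pos del: bil_linear)

lemma O_plus_real_mult:
  assumes "g \<in> O_plus_real d" "h \<in> O_plus_real d"
  shows "g ** h \<in> O_plus_real d"
proof -
  obtain us where us: "\<forall>w\<in>set us. bil d w w \<noteq> 0" "\<And>x. g *v x = foldr (reflect d) us x" "0 < (\<Prod>w\<leftarrow>us. - bil d w w / 2)"
    using assms(1) unfolding O_plus_real_def has_spinor_norm_1_iff by blast
  obtain ws where ws: "\<forall>w\<in>set ws. bil d w w \<noteq> 0" "\<And>x. h *v x = foldr (reflect d) ws x" "0 < (\<Prod>w\<leftarrow>ws. - bil d w w / 2)"
    using assms(2) unfolding O_plus_real_def has_spinor_norm_1_iff by blast
  have "has_spinor_norm d (g ** h) 1"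
    unfolding has_spinor_norm_1_iff using us ws
    by (intro exI[of _ "us @ ws"]) (auto simp flip: matrix_vector_mul_assoc)
  then show ?thesis
    using assms by (simp add: O_plus_real_def O_real_def flip: matrix_vector_mul_assoc)
qed

lemma Gam_mult:
  assumes g: "g \<in> Gam d" and h: "h \<in> Gam d"
  shows "g ** h \<in> Gam d"
proof -
  have gL: "(\<lambda>x. g *v x) ` latt = latt" and hL: "(\<lambda>x. h *v x) ` latt = latt"
    using g h by (simp_all add: Gam_def O_plus_latt_def O_latt_def)
  have "(\<lambda>x. (g ** h) *v x) ` latt = (\<lambda>x. g *v x) ` (\<lambda>x. h *v x) ` latt"
    by (simp add: image_image matrix_vector_mul_assoc)
  then have "(\<lambda>x. (g ** h) *v x) ` latt = latt" by (simp only: gL hL)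
  moreover have "g ** h \<in> O_plus_real d"
    using g h by (intro O_plus_real_mult) (simp_all add: Gam_def O_plus_latt_def)
  moreover have "(g ** h) *v vstar d - vstar d \<in> latt"
  proof -
    have a: "h *v vstar d - vstar d \<in> latt" and b: "g *v vstar d - vstar d \<in> latt"
      using g h by (simp_all add: Gam_def)
    have "g *v (h *v vstar d - vstar d) \<in> latt" using a gL by blast
    then have "g *v (h *v vstar d - vstar d) + (g *v vstar d - vstar d) \<in> latt"
      using b by (rule latt_simps(2))
    then show ?thesis by (simp add: matrix_vector_mult_diff_distrib matrix_vector_mul_assoc)
  qed
  ultimately show ?thesis by (simp add: Gam_def O_plus_latt_def O_latt_def O_plus_real_def)
qed

lemma mat_1_Gam: "mat 1 \<in> Gam d"
proof -
  have "has_spinor_norm d (mat 1) 1"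
    unfolding has_spinor_norm_1_iff by (intro exI[of _ "[]"]) simp
  then show ?thesis by (simp add: Gam_def O_plus_latt_def O_latt_def O_plus_real_def O_real_def)
qed

lemma Union_carrier_G_E: "\<Union> (carrier (G_E (Gam d) E)) = Stab (Gam d) E"
  unfolding G_E_def
proof (rule Union_carrier_Mod)
  show "mat 1 \<in> Fix (Gam d) E" by (simp add: Fix_def mat_1_Gam)
next
  fix h g assume h: "h \<in> Fix (Gam d) E" and g: "g \<in> Stab (Gam d) E"
  then have gE: "(\<lambda>x. g *v x) ` E = E" by (simp add: Stab_def)
  have "(\<lambda>x. (h ** g) *v x) ` E = (\<lambda>x. h *v x) ` (\<lambda>x. g *v x) ` E"
    by (simp add: image_image matrix_vector_mul_assoc)
  also have "\<dots> = E" unfolding gE using h by (auto simp: Fix_def)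
  finally show "h ** g \<in> Stab (Gam d) E"
    using g h by (simp add: Stab_def Fix_def Gam_mult)
qed

text \<open>Congruences modulo 1 are vacuous, which makes \<open>a = 1\<close> an instance of the
  general case.\<close>

lemma Union_carrier_PSL2Z: "\<Union> (carrier PSL2Z) = Gamma1 1"
proof -
  have "Gamma1 1 = SL2Z" by (auto simp: Gamma1_def cong_def)
  moreover have "\<Union> (carrier PSL2Z) = SL2Z"
    unfolding PSL2Z_def
  proof (rule Union_carrier_Mod)
    fix h Z :: "int ^ 2 ^ 2" assume h: "h \<in> {mat 1, - mat 1}" and Z: "Z \<in> SL2Z"
    have "det h = 1" using h by (auto simp: det_2 mat_def)
    then show "h ** Z \<in> SL2Z" using Z by (simp add: SL2Z_def det_mul)
  qed simp
  ultimately show ?thesis by simp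
qed

section \<open>The boundary curve\<close>

context frame
begin

text \<open>Negating \<open>v1\<close> reverses the sign of \<open>kap\<close>, which allows the
  boundary component to be the upper half plane; \<open>w\<close> is negated too in order to keep
  \<open>(v1, w) = a\<close>.\<close>

lemma frame_flip: "frame d a E (- v1) v2 k3 k4 f (- w) m"
proof
  show "E = {of_int i *\<^sub>R - v1 + of_int j *\<^sub>R v2 |i j. True}"
  proof (intro subset_antisym subsetI)
    fix x assume "x \<in> E"
    then obtain i j where "x = of_int i *\<^sub>R v1 + of_int j *\<^sub>R v2" by (rule E_cases)
    then have "x = of_int (- i) *\<^sub>R - v1 + of_int j *\<^sub>R v2" by simp
    then show "x \<in> {of_int i *\<^sub>R - v1 + of_int j *\<^sub>R v2 |i j. True}" by blast
  next
    fix x assume "x \<in> {of_int i *\<^sub>R - v1 + of_int j *\<^sub>R v2 |i j. True}"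
    then obtain i j where "x = of_int (- i) *\<^sub>R v1 + of_int j *\<^sub>R v2" by auto
    then show "x \<in> E" by (simp only: E_mem)
  qed
  show "latt = {of_int c1 *\<^sub>R - v1 + of_int c2 *\<^sub>R v2 + of_int c3 *\<^sub>R k3 + of_int c4 *\<^sub>R k4 +
      of_int c5 *\<^sub>R f + of_int c6 *\<^sub>R - w |c1 c2 c3 c4 c5 c6. True}"
  proof (intro subset_antisym subsetI)
    fix x assume "x \<in> latt"
    then obtain c1 c2 c3 c4 c5 c6 where "x = of_int c1 *\<^sub>R v1 + of_int c2 *\<^sub>R v2 + of_int c3 *\<^sub>R k3 + of_int c4 *\<^sub>R k4 +
      of_int c5 *\<^sub>R f + of_int c6 *\<^sub>R w" by (rule latt_cases)
    then have "x = of_int (- c1) *\<^sub>R - v1 + of_int c2 *\<^sub>R v2 + of_int c3 *\<^sub>R k3 + of_int c4 *\<^sub>R k4 +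
      of_int c5 *\<^sub>R f + of_int (- c6) *\<^sub>R - w" by simp
    then show "x \<in> {of_int c1 *\<^sub>R - v1 + of_int c2 *\<^sub>R v2 + of_int c3 *\<^sub>R k3 + of_int c4 *\<^sub>R k4 +
      of_int c5 *\<^sub>R f + of_int c6 *\<^sub>R - w |c1 c2 c3 c4 c5 c6. True}" by (intro CollectI exI conjI TrueI)
  next
    fix x assume "x \<in> {of_int c1 *\<^sub>R - v1 + of_int c2 *\<^sub>R v2 + of_int c3 *\<^sub>R k3 + of_int c4 *\<^sub>R k4 +
      of_int c5 *\<^sub>R f + of_int c6 *\<^sub>R - w |c1 c2 c3 c4 c5 c6. True}"
    then show "x \<in> latt"
      by (elim CollectE exE conjE) (simp only:, intro latt_simps Ints_of_int v_latt)
  qed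
  show "x \<in> E" if "x \<in> latt" "n \<noteq> 0" "of_int n *\<^sub>R x \<in> E" for x n
    using that by (rule primitive)
qed (simp_all add: gram_all a_pos)

definition slope :: "(complex ^ 6) set \<Rightarrow> complex" where
  "slope l = (THE z. l = line (evec 1 z))"

lemma slope_evec [simp]:
  assumes "x \<noteq> 0"
  shows "slope (line (evec x y)) = y / x"
proof -
  have inj: "z = y / x" if e: "line (evec 1 (y / x)) = line (evec 1 z)" for z
  proof -
    have "evec 1 (y / x) \<noteq> 0" by (simp add: evec_eq_0_iff)
    then obtain c where c: "evec 1 (y / x) = c *s evec 1 z" using line_eqD[OF e] by blast
    have "of_nat a * 1 = of_nat a * (c * 1)" "y / x = c * z"
      using evec_coords[of 1 "y / x"] evec_coords[of "c * 1" "c * z"] unfolding c evec_smult by simp_all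
    then show ?thesis using a_pos by simp
  qed
  show ?thesis unfolding slope_def line_evec_eq[OF assms]
    by (rule the_equality, rule refl, rule inj)
qed

lemma slope_line_iff: "line (evec x y) \<in> half_line 1 \<longleftrightarrow> x \<noteq> 0 \<and> 0 < Im (y / x)"
proof
  assume "line (evec x y) \<in> half_line 1"
  then obtain z where z: "line (evec x y) = line (evec 1 z)" "0 < Im z" unfolding half_line_def by auto
  have "evec 1 z \<noteq> 0" by (simp add: evec_eq_0_iff)
  then obtain c where c: "c \<noteq> 0" "evec 1 z = c *s evec x y" using line_eqD[OF z(1)[symmetric]] by blast
  then have "of_nat a * 1 = of_nat a * (c * x)"
    using evec_coords(1)[of 1 z] evec_coords(1)[of "c * x" "c * y"] unfolding c evec_smult by simp
  then have "x \<noteq> 0" using a_pos by auto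
  moreover from this have "y / x = z" using slope_evec[of x y] slope_evec[of 1 z] z(1) by simp
  ultimately show "x \<noteq> 0 \<and> 0 < Im (y / x)" using z(2) by simp
next
  assume "x \<noteq> 0 \<and> 0 < Im (y / x)"
  then show "line (evec x y) \<in> half_line 1"
    unfolding half_line_def using line_evec_eq[of x y] by auto
qed

lemma topspace_half: "topspace (subtopology proj_top (half_line s)) = half_line s"
proof -
  have "half_line s \<subseteq> topspace proj_top"
    unfolding half_line_def topspace_proj_top by (auto simp: evec_eq_0_iff intro!: imageI)
  then show ?thesis by (simp add: topspace_subtopology Int_absorb1)
qed

lemma slope_homeomorphic:
  "homeomorphic_map (subtopology proj_top (half_line 1)) (top_of_set {z. 0 < Im z}) slope"
  unfolding homeomorphic_map_maps
proof (intro exI[of _ "\<lambda>z. line (evec 1 z)"])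
  have "continuous_map (top_of_set {z. 0 < Im z}) proj_top (\<lambda>z. line (evec 1 z))"
  proof (rule continuous_map_line)
    have "evec 1 = (\<lambda>z. cplx_vec v1 + (\<chi> i. z * cplx_vec v2 $ i))"
      by (simp add: evec_def vec_eq_iff fun_eq_iff)
    then show "continuous_on {z. 0 < Im z} (evec 1)"
      by (simp only:) (intro continuous_intros)
  qed (simp add: evec_eq_0_iff)
  then have 1: "continuous_map (top_of_set {z. 0 < Im z}) (subtopology proj_top (half_line 1)) (\<lambda>z. line (evec 1 z))"
    by (auto simp: continuous_map_in_subtopology half_line_def)
  have 2: "continuous_map (subtopology proj_top (half_line 1)) (top_of_set {z. 0 < Im z}) slope"
    unfolding continuous_map_def topspace_half
  proof (intro conjI allI impI)
    show "slope \<in> half_line 1 \<rightarrow> topspace (top_of_set {z. 0 < Im z})"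
      by (auto simp: half_line_def)
    fix V assume V: "openin (top_of_set {z. 0 < Im z}) V"
    have "open {z. 0 < Im z}" by (rule open_halfspace_Im_gt)
    with V have oV: "open V" by (rule openin_open_trans)
    \<comment> \<open>\<open>slope\<close> is the restriction of \<open>a (x, f) / (x, w)\<close>, a
      ratio continuous on an open cone of the whole space.\<close>
    let ?S = "{x. bil d x (cplx_vec w) \<noteq> 0}"
    let ?r = "\<lambda>x. of_nat a * bil d x (cplx_vec f) / bil d x (cplx_vec w)"
    let ?W = "?S \<inter> ?r -` V"
    have cont: "continuous_on S (\<lambda>x. bil d x y)" for S and y :: "complex ^ 6"
      unfolding bil_def by (intro continuous_intros)
    have "open ?S" by (intro open_Collect_neq cont continuous_on_const)
    moreover have "continuous_on ?S ?r" by (intro continuous_intros cont) auto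
    ultimately have "open ?W" by (rule continuous_open_preimage[OF _ _ oV, rotated])
    moreover have cW: "cone ?W" by (auto simp: cone_def)
    ultimately have "openin proj_top (line ` ?W)" by (intro openin_proj_top_cone)
    moreover have "{l \<in> half_line 1. slope l \<in> V} = line ` ?W \<inter> half_line 1"
    proof -
      have "line (evec 1 z) \<in> line ` ?W \<longleftrightarrow> z \<in> V" for z
      proof -
        have "line (evec 1 z) \<in> line ` ?W \<longleftrightarrow> evec 1 z \<in> ?W"
          by (rule line_in_cone_iff[OF cW]) (simp add: evec_eq_0_iff)
        also have "\<dots> \<longleftrightarrow> z \<in> V" using a_pos by (simp add: evec_coords)
        finally show ?thesis .
      qed
      note evec_W = this
      have "l \<in> line ` ?W \<longleftrightarrow> slope l \<in> V" if l: "l \<in> half_line 1" for l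
      proof -
        obtain z where "l = line (evec 1 z)" using l unfolding half_line_def by blast
        then show ?thesis by (simp only: evec_W slope_evec[OF one_neq_zero] div_by_1)
      qed
      then show ?thesis by blast
    qed
    ultimately show "openin (subtopology proj_top (half_line 1)) {l \<in> half_line 1. slope l \<in> V}"
      unfolding openin_subtopology by blast
  qed
  show "homeomorphic_maps (subtopology proj_top (half_line 1)) (top_of_set {z. 0 < Im z}) slope (\<lambda>z. line (evec 1 z))"
    unfolding homeomorphic_maps_def using 1 2 unfolding topspace_half
    by (auto simp: half_line_def)
qed

text \<open>In an affine coordinate \<open>slope\<close> is a fractional linear function; conversely
  \<open>v1 + t v2\<close> has slope \<open>t\<close> itself.\<close>

lemma slope_holomorphic:
  assumes V: "V \<subseteq> {z. 0 < Im z}"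
  shows "h holomorphic_on V \<longleftrightarrow>
    (\<forall>x\<in>tensor_C E. \<forall>y\<in>tensor_C E.
       (\<lambda>t. (h \<circ> slope) (line (x + t *s y))) holomorphic_on
         {t. x + t *s y \<noteq> 0 \<and> line (x + t *s y) \<in> {l \<in> half_line 1. slope l \<in> V}})"
    (is "_ \<longleftrightarrow> ?R")
proof
  assume h: "h holomorphic_on V"
  show ?R
  proof (intro ballI)
    fix x y assume "x \<in> tensor_C E" "y \<in> tensor_C E"
    then obtain x1 x2 y1 y2 where "x = evec x1 x2" "y = evec y1 y2" unfolding tensor_E by blast
    then have xy: "x + t *s y = evec (x1 + t * y1) (x2 + t * y2)" for t
      by (simp add: evec_def vec_eq_iff algebra_simps)
    let ?S = "{t. x + t *s y \<noteq> 0 \<and> line (x + t *s y) \<in> {l \<in> half_line 1. slope l \<in> V}}"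
    let ?r = "\<lambda>t. (x2 + t * y2) / (x1 + t * y1)"
    have S: "x1 + t * y1 \<noteq> 0 \<and> ?r t \<in> V" if "t \<in> ?S" for t
      using that unfolding xy by (auto simp: slope_line_iff)
    then have "?r holomorphic_on ?S" by (intro holomorphic_intros) blast
    then have "(h \<circ> ?r) holomorphic_on ?S"
      using h S by (intro holomorphic_on_compose_gen[of _ _ _ V]) auto
    moreover have "(h \<circ> slope) (line (x + t *s y)) = (h \<circ> ?r) t" if "t \<in> ?S" for t
      using S[OF that] unfolding xy by simp
    ultimately show "(\<lambda>t. (h \<circ> slope) (line (x + t *s y))) holomorphic_on ?S"
      by (simp only: cong: holomorphic_cong)
  qed
next
  assume R: ?R
  have "evec 1 0 \<in> tensor_C E" "evec 0 1 \<in> tensor_C E" unfolding tensor_E by blast+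
  with R have "(\<lambda>t. (h \<circ> slope) (line (evec 1 0 + t *s evec 0 1))) holomorphic_on
         {t. evec 1 0 + t *s evec 0 1 \<noteq> 0 \<and> line (evec 1 0 + t *s evec 0 1) \<in> {l \<in> half_line 1. slope l \<in> V}}"
    by blast
  moreover have "evec 1 0 + t *s evec 0 1 = evec 1 t" for t by (simp add: evec_def)
  moreover have "{t. evec 1 t \<noteq> 0 \<and> line (evec 1 t) \<in> {l \<in> half_line 1. slope l \<in> V}} = V"
    using V by (auto simp: slope_line_iff evec_eq_0_iff)
  ultimately show "h holomorphic_on V" by simp
qed

lemma denominator_nonzero:
  fixes al be ga de :: int
  assumes "al * de - be * ga = 1" "0 < Im z"
  shows "of_int al + of_int be * z \<noteq> 0"
proof
  assume 0: "of_int al + of_int be * z = 0"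
  then have "Im (of_int al + of_int be * z) = 0" by simp
  then have "be = 0" using assms(2) by simp
  then have "al = 0" using 0 by simp
  with \<open>be = 0\<close> show False using assms(1) by simp
qed

lemma Im_moebius_pos:
  fixes al be ga de :: int
  assumes det: "al * de - be * ga = 1" and z: "0 < Im z"
  shows "0 < Im ((of_int ga + of_int de * z) / (of_int al + of_int be * z))"
proof -
  let ?p = "of_int al + of_int be * z" and ?q = "of_int ga + of_int de * z"
  have p: "?p \<noteq> 0" by (rule denominator_nonzero[OF assms])
  have "Im (?q * cnj ?p) = of_int (al * de - be * ga) * Im z" by (simp add: algebra_simps)
  then have "0 < Im (?q * cnj ?p)" using z by (simp only: det)
  moreover have "?q / ?p = (?q * cnj ?p) / of_real ((cmod ?p)\<^sup>2)"
    using p by (metis complex_div_cnj)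
  ultimately show ?thesis using p by (simp only: Im_divide_of_real) simp
qed

text \<open>The arithmetic of the prime is isolated in \<open>al_cong\<close>; the congruence of
  \<open>de\<close> then follows from the determinant.\<close>

lemma boundary_curve_Gamma1:
  assumes d: "d > 0" and D: "is_period_domain d D" "D = half_period d s" "s = 1 \<or> s = -1" and pos: "0 < s * kap"
    and al_cong: "\<And>g al be ga de. g \<in> Gam d \<Longrightarrow> g *v v1 = of_int al *\<^sub>R v1 + of_int ga *\<^sub>R v2 \<Longrightarrow>
        al * de - be * ga = 1 \<Longrightarrow> int a dvd ga \<Longrightarrow> int a dvd al - 1"
  shows "boundary_curve d D (Gam d) E \<cong>\<^sub>h quot_space upper_half_plane moebius_act (Gamma1 a)"
proof -
  have "half_line (s * kap) = half_line 1"
    unfolding half_line_def using mult_less_cancel_left_pos[OF pos, of 0] by simp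
  then have B: "bdry_points d D E = half_line 1"
    using bdry_points_half[OF D(3) d] by (simp add: D(2))
  have top: "hs_top (bdry_component d D E) = subtopology proj_top (half_line 1)"
    by (simp add: bdry_component_def B)
  have ts: "topspace (hs_top (bdry_component d D E)) = half_line 1"
    unfolding top by (rule topspace_half)
  have act: "proj_act g (line (evec 1 z)) = line (evec (of_int al + of_int be * z) (of_int ga + of_int de * z))"
    if "g *v v1 = of_int al *\<^sub>R v1 + of_int ga *\<^sub>R v2" "g *v v2 = of_int be *\<^sub>R v1 + of_int de *\<^sub>R v2"
    for g z and al be ga de :: int
    unfolding proj_act_line gC_evec[OF that] by simp
  have forward: "proj_act g (line (evec 1 z)) \<in> half_line 1 \<and>
      (\<exists>Z\<in>Gamma1 a. slope (proj_act g (line (evec 1 z))) = moebius_act Z z)"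
    if g: "g \<in> Stab (Gam d) E" and z: "0 < Im z" for g z
  proof -
    obtain al be ga de :: int where G: "g *v v1 = of_int al *\<^sub>R v1 + of_int ga *\<^sub>R v2"
      "g *v v2 = of_int be *\<^sub>R v1 + of_int de *\<^sub>R v2" "al * de - be * ga = 1" "int a dvd ga"
      using stab_action[OF d D(1) g] .
    have "g \<in> Gam d" using g by (simp add: Stab_def)
    then have al: "int a dvd al - 1" using al_cong G by blast
    have "de - 1 = be * ga - de * (al - 1)" using G(3) by (simp add: algebra_simps)
    then have de: "int a dvd de - 1" using al G(4) by simp
    \<comment> \<open>On \<open>z = c2/c1\<close> the action is
      \<open>(de z + ga)/(be z + al)\<close>: the matrix of \<open>g\<close> with the two
      coordinates interchanged, which leaves the lower left entry free.\<close>
    define Z :: "int ^ 2 ^ 2" where "Z = vector [vector [de, ga], vector [be, al]]"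
    have Zc: "Z $ 1 $ 1 = de" "Z $ 1 $ 2 = ga" "Z $ 2 $ 1 = be" "Z $ 2 $ 2 = al"
      by (simp_all add: Z_def)
    have "Z \<in> Gamma1 a"
      using G(3,4) al de by (simp add: Gamma1_def SL2Z_def det_2 Zc cong_iff_dvd_diff algebra_simps)
    moreover have "slope (proj_act g (line (evec 1 z))) = moebius_act Z z"
      unfolding act[OF G(1,2)] using denominator_nonzero[OF G(3) z]
      by (simp add: moebius_act_def moebius_def Zc add.commute)
    moreover have "proj_act g (line (evec 1 z)) \<in> half_line 1"
      unfolding act[OF G(1,2)] slope_line_iff using denominator_nonzero[OF G(3) z] Im_moebius_pos[OF G(3) z] by blast
    ultimately show ?thesis by blast
  qed
  have backward: "\<exists>g\<in>Stab (Gam d) E. slope (proj_act g (line (evec 1 z))) = moebius_act Z z"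
    if Z: "Z \<in> Gamma1 a" and z: "0 < Im z" for Z z
  proof -
    have det: "Z $ 2 $ 2 * Z $ 1 $ 1 - Z $ 2 $ 1 * Z $ 1 $ 2 = 1"
      using Z by (simp add: Gamma1_def SL2Z_def det_2 algebra_simps)
    have "int a dvd Z $ 1 $ 2" "int a dvd Z $ 2 $ 2 - 1" "int a dvd Z $ 1 $ 1 - 1"
      using Z by (auto simp: Gamma1_def cong_iff_dvd_diff)
    from stab_exists[OF d det this] obtain g where g: "g \<in> Stab (Gam d) E"
      "g *v v1 = of_int (Z $ 2 $ 2) *\<^sub>R v1 + of_int (Z $ 1 $ 2) *\<^sub>R v2"
      "g *v v2 = of_int (Z $ 2 $ 1) *\<^sub>R v1 + of_int (Z $ 1 $ 1) *\<^sub>R v2" .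
    have "slope (proj_act g (line (evec 1 z))) = moebius_act Z z"
      unfolding act[OF g(2,3)] using denominator_nonzero[OF det z]
      by (simp add: moebius_act_def moebius_def add.commute)
    then show ?thesis using g(1) by blast
  qed
  have "quot_space (bdry_component d D E) proj_act (Stab (Gam d) E) \<cong>\<^sub>h
      quot_space upper_half_plane moebius_act (Gamma1 a)"
  proof (rule quot_space_biholomorphic[where \<phi> = slope])
    show "homeomorphic_map (hs_top (bdry_component d D E)) (hs_top upper_half_plane) slope"
      using slope_homeomorphic unfolding top upper_half_plane_def by simp
  next
    fix V h assume "openin (hs_top upper_half_plane) V"
    then have "V \<subseteq> {z. 0 < Im z}" using openin_subset by (fastforce simp: upper_half_plane_def)
    from slope_holomorphic[OF this, of h]
    show "hs_hol upper_half_plane V h \<longleftrightarrow>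
        hs_hol (bdry_component d D E) {x \<in> topspace (hs_top (bdry_component d D E)). slope x \<in> V} (h \<circ> slope)"
      unfolding ts by (simp add: upper_half_plane_def bdry_component_def)
  next
    fix U and h h' :: "(complex ^ 6) set \<Rightarrow> complex"
    assume "\<And>x. x \<in> U \<Longrightarrow> h x = h' x"
    then have "(\<lambda>t. h (line (x + t *s y))) holomorphic_on {t. x + t *s y \<noteq> 0 \<and> line (x + t *s y) \<in> U} \<longleftrightarrow>
        (\<lambda>t. h' (line (x + t *s y))) holomorphic_on {t. x + t *s y \<noteq> 0 \<and> line (x + t *s y) \<in> U}" for x y
      by (intro holomorphic_cong refl) auto
    then show "hs_hol (bdry_component d D E) U h \<longleftrightarrow> hs_hol (bdry_component d D E) U h'"
      unfolding bdry_component_def by simp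
  next
    fix l assume "l \<in> topspace (hs_top (bdry_component d D E))"
    then obtain z where z: "l = line (evec 1 z)" "0 < Im z" unfolding ts half_line_def by auto
    show "slope ` orbit proj_act (Stab (Gam d) E) l = orbit moebius_act (Gamma1 a) (slope l)"
    proof (intro subset_antisym subsetI)
      fix y assume "y \<in> slope ` orbit proj_act (Stab (Gam d) E) l"
      then obtain g where g: "g \<in> Stab (Gam d) E" "y = slope (proj_act g l)" unfolding orbit_def by blast
      then obtain Z where Z: "Z \<in> Gamma1 a" "y = moebius_act Z z" using forward[OF g(1) z(2)] z(1) by blast
      then show "y \<in> orbit moebius_act (Gamma1 a) (slope l)" unfolding orbit_def z(1) by simp
    next
      fix y assume "y \<in> orbit moebius_act (Gamma1 a) (slope l)"
      then obtain Z where Z: "Z \<in> Gamma1 a" "y = moebius_act Z z" unfolding orbit_def z(1) by auto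
      then obtain g where "g \<in> Stab (Gam d) E" "y = slope (proj_act g l)" using backward[OF Z(1) z(2)] z(1) by metis
      then show "y \<in> slope ` orbit proj_act (Stab (Gam d) E) l" unfolding orbit_def by blast
    qed
    show "orbit proj_act (Stab (Gam d) E) l \<subseteq> topspace (hs_top (bdry_component d D E))"
      unfolding ts orbit_def z(1) using forward[OF _ z(2)] by blast
  qed
  then show ?thesis
    unfolding boundary_curve_def quot_space_cosets_def Union_carrier_G_E .
qed

end

theorem theorem3p8:
  fixes p a :: nat and D :: "(complex ^ 6) set set" and E :: "(real ^ 6) set"
  assumes "prime p" and "p > 3"
    and "is_period_domain (p\<^sup>2) D"
    and "primitive_isotropic_rank2 (p\<^sup>2) E"
    and "of_type (p\<^sup>2) p E a"
  shows "boundary_curve (p\<^sup>2) D (Gam (p\<^sup>2)) E \<cong>\<^sub>h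
           (if a = 1 then quot_space_cosets upper_half_plane moebius_act PSL2Z
            else quot_space upper_half_plane moebius_act (Gamma1 a))"
proof -
  have d: "p\<^sup>2 > 0" using assms(2) by simp
  obtain s where s: "s = 1 \<or> s = -1" "D = half_period (p\<^sup>2) s"
    using period_domain_half[OF assms(3)] .
  obtain u1 v2 k3 k4 f u m where F: "frame (p\<^sup>2) a E u1 v2 k3 k4 f u m"
    using frame_exists[OF assms(1,2,4,5)] .
  have "\<exists>v1 w. frame (p\<^sup>2) a E v1 v2 k3 k4 f w m \<and> 0 < s * frame.kap v1 v2"
  proof (cases "0 < s * frame.kap u1 v2")
    case True
    then show ?thesis using F by blast
  next
    case False
    have F': "frame (p\<^sup>2) a E (- u1) v2 k3 k4 f (- u) m" by (rule frame.frame_flip[OF F])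
    have "frame.kap (- u1) v2 = - frame.kap u1 v2"
      unfolding frame.kap_def[OF F] frame.kap_def[OF F'] by (simp add: algebra_simps)
    then have "s * frame.kap (- u1) v2 = - (s * frame.kap u1 v2)" by simp
    moreover have "s * frame.kap u1 v2 \<noteq> 0" using frame.kap_nonzero[OF F d] s(1) by auto
    ultimately have "0 < s * frame.kap (- u1) v2" using False by linarith
    then show ?thesis using F' by blast
  qed
  then obtain v1 w where F: "frame (p\<^sup>2) a E v1 v2 k3 k4 f w m" and pos: "0 < s * frame.kap v1 v2" by blast
  interpret frame "p\<^sup>2" a E v1 v2 k3 k4 f w m by (rule F)
  have a: "a \<in> {1, 2, p, 2 * p}" using assms(5) by (simp add: of_type_def)
  have "int a dvd al - 1"
    if g: "g \<in> Gam (p\<^sup>2)" "g *v v1 = of_int al *\<^sub>R v1 + of_int ga *\<^sub>R v2"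
      and det: "al * de - be * ga = 1" and ga: "int a dvd ga" for g al be ga de
  proof -
    have modp: "int p dvd al - 1" if "p dvd a"
      by (rule stab_action_mod_p[OF assms(1,2) refl that g ga])
    \<comment> \<open>Since \<open>ga\<close> is even, \<open>al de = 1 + be ga\<close> is
      odd.\<close>
    have mod2: "2 dvd al - 1" if "2 dvd a"
    proof -
      have "even (int a)" using that by simp
      then have "even ga" using ga by (rule dvd_trans)
      then have "odd (al * de)" using det by (metis dvd_diff_right_iff dvd_mult odd_one)
      then show ?thesis by simp
    qed
    consider "a = 1" | "a = 2" | "a = p" | "a = 2 * p" using a by blast
    then show ?thesis
    proof cases
      case 4
      have "coprime (2::int) (int p)"
        using assms(1,2) by (simp add: prime_odd_nat)
      then show ?thesis using modp mod2 4 by (simp add: divides_mult)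
    qed (use modp mod2 in simp_all)
  qed
  then have bc: "boundary_curve (p\<^sup>2) D (Gam (p\<^sup>2)) E \<cong>\<^sub>h quot_space upper_half_plane moebius_act (Gamma1 a)"
    by (intro boundary_curve_Gamma1[OF d assms(3) s(2,1) pos])
  show ?thesis
  proof (cases "a = 1")
    case True
    show ?thesis
      using bc unfolding True by (simp only: simp_thms if_True quot_space_cosets_def Union_carrier_PSL2Z)
  next
    case False
    show ?thesis using bc by (simp only: False if_False)
  qed
qed

end
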